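(* Let $\alpha_*$ be the unique solution in $(\pi/4,3\pi/10)$ of $\sin(7\alpha)-\sin(3\alpha)+\sin(\alpha)=0$. For all $\alpha\in(\alpha_*,3\pi/10)$ with $\cos(5\alpha)/\cos(3\alpha)\in\mathbb{R}\setminus\mathbb{Q}$, in particular for all $\alpha\in(\alpha_*,3\pi/10)$ with $\alpha/\pi$ algebraic and irrational, the billiard dynamics in the isosceles triangle with inner angles $(\alpha,\alpha,\pi-2\alpha)$ contains trajectories which are non-periodic and not everywhere dense in the triangle.
   Context: The billiard dynamics in a triangle is the motion of a point particle along straight lines inside the triangle with elastic reflections (angle of incidence equals angle of reflection) at the sides. A trajectory is the planar curve, consisting of straight line segments, traced out by the particle. The number $\alpha_*$ satisfies $\pi/4<\alpha_*<2\pi/7$. *)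

theory Defs
  imports "HOL-Analysis.Analysis" "HOL-Computational_Algebra.Polynomial"
begin

(* The Euclidean plane is the type complex, used only as a real inner product space. *)

definition inner_angle :: "complex \<Rightarrow> complex \<Rightarrow> complex \<Rightarrow> real" where
  "inner_angle P Q R = arccos (((P - Q) \<bullet> (R - Q)) / (norm (P - Q) * norm (R - Q)))"

definition triangle_with_angles ::
    "complex \<Rightarrow> complex \<Rightarrow> complex \<Rightarrow> real \<Rightarrow> real \<Rightarrow> real \<Rightarrow> bool" where
  "triangle_with_angles A B C a b c \<longleftrightarrow>
     \<not> collinear {A, B, C} \<and>
     inner_angle C A B = a \<and> inner_angle A B C = b \<and> inner_angle B C A = c"

(* Orthogonal reflection of the velocity v in the line spanned by d: the component of v
   along the side is kept and the component normal to it changes sign. *)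
definition reflect :: "complex \<Rightarrow> complex \<Rightarrow> complex" where
  "reflect d v = (2 * (v \<bullet> d) / (d \<bullet> d)) *\<^sub>R d - v"

(* The position of the particle as a function of time: unit speed, with collision times \<tau> n
   and velocity v n between the collisions n and n + 1. The motion is defined for all times,
   past and future; a particle that runs into a vertex has no continuation, so collisions
   happen at relatively interior points of the sides. *)
definition billiard_motion :: "complex \<Rightarrow> complex \<Rightarrow> complex \<Rightarrow> (real \<Rightarrow> complex) \<Rightarrow> bool" where
  "billiard_motion A B C \<gamma> \<longleftrightarrow>
     (\<exists>(\<tau> :: int \<Rightarrow> real) (v :: int \<Rightarrow> complex).
        strict_mono \<tau> \<and> filterlim \<tau> at_top at_top \<and> filterlim \<tau> at_bot at_bot \<and>
        (\<forall>n. norm (v n) = 1) \<and>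
        (\<forall>n. \<forall>t \<in> {\<tau> n..\<tau> (n + 1)}. \<gamma> t = \<gamma> (\<tau> n) + (t - \<tau> n) *\<^sub>R v n) \<and>
        (\<forall>n. \<forall>t \<in> {\<tau> n<..<\<tau> (n + 1)}. \<gamma> t \<in> interior (convex hull {A, B, C})) \<and>
        (\<forall>n. \<exists>(P, Q) \<in> {(A, B), (B, C), (C, A)}.
            \<gamma> (\<tau> n) \<in> open_segment P Q \<and> v n = reflect (Q - P) (v (n - 1))))"

definition periodic_motion :: "(real \<Rightarrow> complex) \<Rightarrow> bool" where
  "periodic_motion \<gamma> \<longleftrightarrow> (\<exists>T > 0. \<forall>t. \<gamma> (t + T) = \<gamma> t)"

definition trajectory :: "(real \<Rightarrow> complex) \<Rightarrow> complex set" where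
  "trajectory \<gamma> = range \<gamma>"

definition everywhere_dense_in :: "complex set \<Rightarrow> complex set \<Rightarrow> bool" where
  "everywhere_dense_in S X \<longleftrightarrow> X \<subseteq> closure S"

definition has_nonperiodic_nondense_trajectory :: "complex \<Rightarrow> complex \<Rightarrow> complex \<Rightarrow> bool" where
  "has_nonperiodic_nondense_trajectory A B C \<longleftrightarrow>
     (\<exists>\<gamma>. billiard_motion A B C \<gamma> \<and> \<not> periodic_motion \<gamma> \<and>
          \<not> everywhere_dense_in (trajectory \<gamma>) (convex hull {A, B, C}))"

definition is_alpha_star :: "real \<Rightarrow> bool" where
  "is_alpha_star x \<longleftrightarrow>
     x \<in> {pi / 4<..<3 * pi / 10} \<and> sin (7 * x) - sin (3 * x) + sin x = 0"

definition alpha_star :: real where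
  "alpha_star = (THE x. is_alpha_star x)"

end

(* Billiard part.  Normalise the triangle to vertices -cos a, cos a and i sin a.  For a direction
   phi, chosen below in terms of a, the orbits leaving the base at angle phi return to the base at
   the same angle after 4 or 10 collisions, and the return map on the base is the exchange of two
   intervals, i.e. a rotation, of lengths in the ratio cos(5a) : cos(3a).  For an irrational ratio
   an orbit through infinitely many points of the base that never hits a vertex is non-periodic.
   All sign conditions needed for this combinatorics follow from a in (pi/4, 3pi/10) except one,
   phi < a, which is the condition a > alpha_star; it also keeps all collisions away from the apex.

   Arithmetic part.  If cos(5a)/cos(3a) is rational then w = exp(2ia) is algebraic, which contradicts
   the Gelfond-Schneider theorem for exp(2 pi i b) with b = a/pi.  That is proved by Schneider's
   method: a nonzero F(z) = sum x_ij z^i exp(2 pi i j z) vanishing at all m + n b with m, n < N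
   (Siegel's lemma) is shown, by the Schwarz lemma and a Liouville bound, to vanish at all m + n b.
   As exp has period 2 pi i, for fixed n this is a polynomial identity in m, which forces x = 0. *)

theory Submission
  imports Defs "HOL-Complex_Analysis.Complex_Analysis" "HOL-Real_Asymp.Real_Asymp"
begin

section \<open>Siegel's lemma and a Liouville inequality\<close>

text \<open>Reflections in the three sides turn a direction psi into -psi, -2 alpha - psi or 2 alpha
  - psi, so all directions of the orbit are, up to sign, j alpha + phi with j in {0, 2, 4, 6}. By
  the law of sines, hit points are governed by quotients of the numbers \<open>\<sigma> j\<close>.
  The angle phi solves \<open>\<sigma> 2 - \<sigma> 0 = \<sigma> 6\<close>, an equation linear in
  cos phi and sin phi; with it the middle base hit of the branch of 10 collisions sweeps exactly the
  whole base. One obstacle is that flights become arbitrarily short near the base vertices, so it is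
  not clear at once that infinitely many collisions take infinite time; the two flights adjacent to
  a return to the base have constant total length, which settles this. In the arithmetic part,
  algebraic numbers act by integer matrices on a finitely generated module. Siegel's lemma, applied
  to the coordinates in this module, yields both the auxiliary function and the Liouville
  bound.\<close>

lemma siegel_lemma:
  fixes a :: "'j \<Rightarrow> 'i \<Rightarrow> int" and A :: nat
  assumes fin: "finite I" "finite J" and ne: "I \<noteq> {}" and card: "2 * card J \<le> card I"
    and A: "A \<ge> 1" and bound: "\<And>j i. j \<in> J \<Longrightarrow> i \<in> I \<Longrightarrow> \<bar>a j i\<bar> \<le> int A"
  shows "\<exists>x :: 'i \<Rightarrow> int. (\<exists>i\<in>I. x i \<noteq> 0) \<and> (\<forall>i\<in>I. \<bar>x i\<bar> \<le> int (card I * A)) \<and>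
           (\<forall>j\<in>J. (\<Sum>i\<in>I. a j i * x i) = 0)"
proof -
  define H where "H = int (card I * A)"
  have cI: "card I \<ge> 1" using fin ne by (simp add: Suc_leI card_gt_0_iff)
  have H1: "H \<ge> 1" using cI A unfolding H_def
    by (metis One_nat_def mult_le_mono nat_mult_1 of_nat_1 of_nat_le_iff)
  define X where "X = PiE I (\<lambda>_. {0..H})"
  \<comment> \<open>Splitting each row by the sign of its entries confines its value to an interval
    of length at most \<open>H * H\<close>. The symmetric interval given by the absolute values
    would be twice as long, too long for the count below.\<close>
  define P where "P = (\<lambda>j. \<Sum>i\<in>I. H * max 0 (a j i))"
  define N where "N = (\<lambda>j. \<Sum>i\<in>I. H * max 0 (- a j i))"
  define f where "f = (\<lambda>x. \<lambda>j\<in>J. \<Sum>i\<in>I. a j i * x i)"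
  define Y where "Y = PiE J (\<lambda>j. {- N j..P j})"
  have PN: "P j + N j \<le> H * H" if j: "j \<in> J" for j
  proof -
    have "P j + N j = (\<Sum>i\<in>I. H * \<bar>a j i\<bar>)"
      unfolding P_def N_def sum.distrib[symmetric]
      by (intro sum.cong refl) (auto simp: max_def algebra_simps)
    also have "\<dots> \<le> (\<Sum>i\<in>I. H * int A)"
      using H1 bound[OF j] by (intro sum_mono mult_left_mono) auto
    also have "\<dots> = H * H" by (simp add: H_def algebra_simps)
    finally show ?thesis .
  qed
  have P0: "P j \<ge> 0" "N j \<ge> 0" for j
    unfolding P_def N_def using H1 by (auto intro!: sum_nonneg)
  have img: "f ` X \<subseteq> Y"
  proof
    fix y assume "y \<in> f ` X"
    then obtain x where x: "x \<in> X" and y: "y = f x" by auto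
    have xi: "0 \<le> x i" "x i \<le> H" if "i \<in> I" for i using x that unfolding X_def by (auto simp: PiE_iff)
    have up: "a j i * x i \<le> H * max 0 (a j i)" if "i \<in> I" for i j
    proof (cases "a j i \<ge> 0")
      case True
    then have "a j i * x i \<le> a j i * H" using xi[OF that] by (intro mult_left_mono)
    then show ?thesis using True by (simp add: max_def mult.commute)
    next
      case False then show ?thesis using xi[OF that] H1 by (simp add: max_def mult_nonpos_nonneg)
    qed
    have lo: "- (H * max 0 (- a j i)) \<le> a j i * x i" if "i \<in> I" for i j
    proof (cases "a j i \<ge> 0")
      case True then show ?thesis using xi[OF that] by (simp add: max_def)
    next
      case False
    then have "a j i * H \<le> a j i * x i" using xi[OF that] by (intro mult_left_mono_neg) auto
    then show ?thesis using False by (simp add: max_def mult.commute)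
    qed
    have "(\<Sum>i\<in>I. a j i * x i) \<le> P j" "- N j \<le> (\<Sum>i\<in>I. a j i * x i)" for j
      unfolding P_def N_def sum_negf[symmetric] by (intro sum_mono up lo; assumption)+
    then show "y \<in> Y" unfolding y f_def Y_def by (auto simp: PiE_iff)
  qed
  have finY: "finite Y" unfolding Y_def using fin by (intro finite_PiE) auto
  have finX: "finite X" unfolding X_def using fin by (intro finite_PiE) auto
  have cX: "card X = nat (H + 1) ^ card I" unfolding X_def using fin by (simp add: card_PiE)
  have "card Y = (\<Prod>j\<in>J. card {- N j..P j})" unfolding Y_def using fin by (simp add: card_PiE)
  also have "\<dots> \<le> (\<Prod>j\<in>J. nat (H * H + 1))"
    using PN by (intro prod_mono) (auto intro!: nat_mono)
  also have "\<dots> = nat (H * H + 1) ^ card J" by simp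
  \<comment> \<open>There are fewer values than vectors: a row takes at most
    \<open>H * H + 1\<close> values, which is less than the square of \<open>H + 1\<close>, and
    there are at least two unknowns per equation.\<close>
  also have "\<dots> < nat (H + 1) ^ card I"
  proof (cases "card J = 0")
    case True
    have "1 < nat (H + 1)" using H1 by linarith
    then have "1 < nat (H + 1) ^ card I" using cI by (intro one_less_power) auto
    then show ?thesis using True by simp
  next
    case False
    have "H * H + 1 < (H + 1) * (H + 1)" using H1 by (simp add: algebra_simps)
    then have "nat (H * H + 1) < nat ((H + 1) * (H + 1))" using H1
      by (metis add_increasing le_add_same_cancel1 mult_nonneg_nonneg nat_less_eq_zless zero_le_one order_trans)
    also have "\<dots> = nat (H + 1) ^ 2" using H1 by (simp add: power2_eq_square nat_mult_distrib)
    finally have "nat (H * H + 1) ^ card J < (nat (H + 1) ^ 2) ^ card J"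
      using False by (intro power_strict_mono) auto
    also have "\<dots> = nat (H + 1) ^ (2 * card J)" by (simp add: power_mult)
    also have "\<dots> \<le> nat (H + 1) ^ card I" using card H1 by (intro power_increasing) auto
    finally show ?thesis .
  qed
  finally have "card Y < card X" using cX by simp
  then have "card (f ` X) < card X" using card_mono[OF finY img] by linarith
  then have "\<not> inj_on f X" by (rule pigeonhole)
  then obtain x y where xy: "x \<in> X" "y \<in> X" "x \<noteq> y" "f x = f y" by (auto simp: inj_on_def)
  define z where "z = (\<lambda>i. x i - y i)"
  have "\<exists>i\<in>I. z i \<noteq> 0"
  proof (rule ccontr)
    assume "\<not> ?thesis"
    then have "\<And>i. i \<in> I \<Longrightarrow> x i = y i" by (simp add: z_def)
    then show False using xy unfolding X_def by (metis PiE_ext)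
  qed
  moreover have "\<bar>z i\<bar> \<le> int (card I * A)" if "i \<in> I" for i
  proof -
    have "x i \<in> {0..H}" "y i \<in> {0..H}" using xy that unfolding X_def by (auto simp: PiE_iff)
    then show ?thesis unfolding z_def H_def[symmetric] by auto
  qed
  moreover have "(\<Sum>i\<in>I. a j i * z i) = 0" if "j \<in> J" for j
  proof -
    have "f x j = f y j" using xy by simp
    then show ?thesis using that unfolding f_def z_def by (simp add: algebra_simps sum_subtractf)
  qed
  ultimately show ?thesis by blast
qed

text \<open>Multiplication by \<open>x\<close> maps the integer span of the (possibly dependent) family \<open>e\<close> to itself,
  with \<open>\<ell>\<^sup>1\<close> operator norm at most \<open>K\<close> in suitable coordinates. This submultiplicative size replaces
  heights and conjugates.\<close>

definition zbounded :: "'i set \<Rightarrow> ('i \<Rightarrow> complex) \<Rightarrow> complex \<Rightarrow> real \<Rightarrow> bool" where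
  "zbounded I e x K \<longleftrightarrow> (\<forall>k\<in>I. \<exists>n :: 'i \<Rightarrow> int.
     x * e k = (\<Sum>l\<in>I. of_int (n l) * e l) \<and> (\<Sum>l\<in>I. \<bar>real_of_int (n l)\<bar>) \<le> K)"

lemma zbounded_mono: "zbounded I e x K \<Longrightarrow> K \<le> L \<Longrightarrow> zbounded I e x L"
  unfolding zbounded_def by (meson order_trans)

lemma zbounded_of_int:
  assumes "finite I"
  shows "zbounded I e (of_int m) \<bar>of_int m\<bar>"
  unfolding zbounded_def
proof
  fix k assume k: "k \<in> I"
  show "\<exists>n. of_int m * e k = (\<Sum>l\<in>I. of_int (n l) * e l) \<and> (\<Sum>l\<in>I. \<bar>real_of_int (n l)\<bar>) \<le> \<bar>of_int m\<bar>"
    using assms k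
    by (intro exI[of _ "\<lambda>l. if l = k then m else 0"]) (simp add: if_distrib[of of_int] if_distribR if_distrib[of "\<lambda>x. x * _"] if_distrib[of abs] cong: if_cong)
qed

lemma zbounded_add:
  assumes "zbounded I e x K" "zbounded I e y L"
  shows "zbounded I e (x + y) (K + L)"
  unfolding zbounded_def
proof
  fix k assume k: "k \<in> I"
  obtain n where n: "x * e k = (\<Sum>l\<in>I. of_int (n l) * e l)" "(\<Sum>l\<in>I. \<bar>real_of_int (n l)\<bar>) \<le> K"
    using assms(1) k unfolding zbounded_def by blast
  obtain m where m: "y * e k = (\<Sum>l\<in>I. of_int (m l) * e l)" "(\<Sum>l\<in>I. \<bar>real_of_int (m l)\<bar>) \<le> L"
    using assms(2) k unfolding zbounded_def by blast
  have "(\<Sum>l\<in>I. \<bar>real_of_int (n l + m l)\<bar>) \<le> (\<Sum>l\<in>I. \<bar>real_of_int (n l)\<bar> + \<bar>real_of_int (m l)\<bar>)"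
    by (intro sum_mono) auto
  also have "\<dots> \<le> K + L" using n(2) m(2) by (simp add: sum.distrib)
  finally show "\<exists>n. (x + y) * e k = (\<Sum>l\<in>I. of_int (n l) * e l) \<and> (\<Sum>l\<in>I. \<bar>real_of_int (n l)\<bar>) \<le> K + L"
    using n(1) m(1) by (intro exI[of _ "\<lambda>l. n l + m l"]) (simp add: algebra_simps sum.distrib)
qed

text \<open>Composing the two multiplications multiplies their coordinate matrices, and the largest
  \<open>\<ell>\<^sup>1\<close> norm of a row is submultiplicative.\<close>

lemma zbounded_mult:
  assumes "zbounded I e x K" "zbounded I e y L" "K \<ge> 0"
  shows "zbounded I e (x * y) (K * L)"
  unfolding zbounded_def
proof
  fix k assume k: "k \<in> I"
  from assms(1) have "\<forall>k\<in>I. \<exists>n :: _ \<Rightarrow> int.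
     x * e k = (\<Sum>l\<in>I. of_int (n l) * e l) \<and> (\<Sum>l\<in>I. \<bar>real_of_int (n l)\<bar>) \<le> K"
    unfolding zbounded_def .
  then obtain n :: "_ \<Rightarrow> _ \<Rightarrow> int" where n: "\<And>k. k \<in> I \<Longrightarrow> x * e k = (\<Sum>l\<in>I. of_int (n k l) * e l)"
      "\<And>k. k \<in> I \<Longrightarrow> (\<Sum>l\<in>I. \<bar>real_of_int (n k l)\<bar>) \<le> K" by metis
  obtain m where m: "y * e k = (\<Sum>l\<in>I. of_int (m l) * e l)" "(\<Sum>l\<in>I. \<bar>real_of_int (m l)\<bar>) \<le> L"
    using assms(2) k unfolding zbounded_def by blast
  define p where "p = (\<lambda>r. \<Sum>l\<in>I. m l * n l r)"
  have "x * y * e k = x * (\<Sum>l\<in>I. of_int (m l) * e l)" using m(1) by (simp add: mult.assoc)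
  also have "\<dots> = (\<Sum>l\<in>I. of_int (m l) * (x * e l))" by (simp add: sum_distrib_left algebra_simps)
  also have "\<dots> = (\<Sum>l\<in>I. \<Sum>r\<in>I. of_int (m l * n l r) * e r)"
    using n(1) by (intro sum.cong) (auto simp: sum_distrib_left algebra_simps)
  also have "\<dots> = (\<Sum>r\<in>I. of_int (p r) * e r)"
    by (subst sum.swap) (simp add: p_def sum_distrib_right)
  finally have 1: "x * y * e k = (\<Sum>r\<in>I. of_int (p r) * e r)" .
  have "(\<Sum>r\<in>I. \<bar>real_of_int (p r)\<bar>) \<le> (\<Sum>r\<in>I. \<Sum>l\<in>I. \<bar>real_of_int (m l)\<bar> * \<bar>real_of_int (n l r)\<bar>)"
    unfolding p_def by (intro sum_mono) (simp add: order_trans[OF sum_abs] abs_mult)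
  also have "\<dots> = (\<Sum>l\<in>I. \<bar>real_of_int (m l)\<bar> * (\<Sum>r\<in>I. \<bar>real_of_int (n l r)\<bar>))"
    by (subst sum.swap) (simp add: sum_distrib_left)
  also have "\<dots> \<le> (\<Sum>l\<in>I. \<bar>real_of_int (m l)\<bar> * K)"
    using n(2) by (intro sum_mono mult_left_mono) auto
  also have "\<dots> = (\<Sum>l\<in>I. \<bar>real_of_int (m l)\<bar>) * K" by (simp add: sum_distrib_right)
  also have "\<dots> \<le> L * K" using m(2) assms(3) by (rule mult_right_mono)
  finally show "\<exists>n. x * y * e k = (\<Sum>l\<in>I. of_int (n l) * e l) \<and> (\<Sum>l\<in>I. \<bar>real_of_int (n l)\<bar>) \<le> K * L"
    using 1 by (auto simp: mult.commute)
qed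

lemma zbounded_1: "finite I \<Longrightarrow> zbounded I e 1 1"
  using zbounded_of_int[of I e 1] by simp

lemma zbounded_power:
  assumes "finite I" "zbounded I e x K" "K \<ge> 0"
  shows "zbounded I e (x ^ n) (K ^ n)"
  by (induction n) (auto intro: zbounded_1 zbounded_mult assms)

lemma zbounded_sum:
  assumes "finite I" "finite S" "\<And>s. s \<in> S \<Longrightarrow> zbounded I e (f s) (g s)"
  shows "zbounded I e (\<Sum>s\<in>S. f s) (\<Sum>s\<in>S. g s)"
  using assms(2,3)
proof (induction S rule: finite_induct)
  case empty
  then show ?case using zbounded_of_int[OF assms(1), of e 0] by simp
next
  case (insert s S)
  then show ?case by (simp add: zbounded_add)
qed

text \<open>Siegel's lemma gives an integer relation with small coefficients between the powers of \<open>x\<close>;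
  its lowest nonzero coefficient has absolute value at least 1.\<close>

lemma zbounded_liouville:
  assumes I: "finite I" "k \<in> I" "e k = 1" and x: "zbounded I e x K" "x \<noteq> 0" and K: "K \<ge> 1"
  shows "1 \<le> norm x * (2 * real (card I) + 1)\<^sup>2 * K ^ (2 * card I)"
proof (cases "norm x \<ge> 1")
  case True
  have "1 * 1 * 1 \<le> norm x * (2 * real (card I) + 1)\<^sup>2 * K ^ (2 * card I)"
    using True K by (intro mult_mono one_le_power) auto
  then show ?thesis by simp
next
  case False
  define d where "d = card I"
  have "\<exists>n. x ^ i * e k = (\<Sum>l\<in>I. of_int (n l) * e l) \<and> (\<Sum>l\<in>I. \<bar>real_of_int (n l)\<bar>) \<le> K ^ i" for i
    using zbounded_power[OF I(1) x(1), of i] K I(2) unfolding zbounded_def by auto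
  then have "\<exists>n :: nat \<Rightarrow> _ \<Rightarrow> int. \<forall>i. x ^ i = (\<Sum>l\<in>I. of_int (n i l) * e l) \<and>
      (\<Sum>l\<in>I. \<bar>real_of_int (n i l)\<bar>) \<le> K ^ i"
    unfolding I(3) mult_1_right by (intro choice allI)
  then obtain n :: "nat \<Rightarrow> _ \<Rightarrow> int" where n: "\<And>i. x ^ i = (\<Sum>l\<in>I. of_int (n i l) * e l)"
     "\<And>i. (\<Sum>l\<in>I. \<bar>real_of_int (n i l)\<bar>) \<le> K ^ i" by blast
  define A where "A = nat \<lfloor>K ^ (2 * d)\<rfloor>"
  have K1: "1 \<le> K ^ (2 * d)" using K by simp
  have A1: "A \<ge> 1" unfolding A_def using K1 by linarith
  have AK: "real A \<le> K ^ (2 * d)" unfolding A_def using K1 by linarith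
  have bd: "\<bar>n i l\<bar> \<le> int A" if "l \<in> I" "i \<in> {..2*d}" for i l
  proof -
    have "\<bar>real_of_int (n i l)\<bar> \<le> (\<Sum>l\<in>I. \<bar>real_of_int (n i l)\<bar>)"
      using that I by (intro member_le_sum) auto
    also have "\<dots> \<le> K ^ (2 * d)" using n(2)[of i] that K power_increasing[of i "2*d" K] by auto
    finally show ?thesis unfolding A_def by linarith
  qed
  \<comment> \<open>There are \<open>2 * d + 1\<close> unknown coefficients against \<open>d\<close>
    equations, one per coordinate. A relation between the coordinate vectors gives one between the
    powers of \<open>x\<close> even if the family \<open>e\<close> is dependent.\<close>
  have "\<exists>a :: nat \<Rightarrow> int. (\<exists>i\<in>{..2*d}. a i \<noteq> 0) \<and> (\<forall>i\<in>{..2*d}. \<bar>a i\<bar> \<le> int (card {..2*d} * A)) \<and>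
           (\<forall>l\<in>I. (\<Sum>i\<in>{..2*d}. n i l * a i) = 0)"
    by (rule siegel_lemma) (use I A1 bd in \<open>auto simp: d_def\<close>)
  then obtain a :: "nat \<Rightarrow> int" where a: "\<exists>i\<in>{..2*d}. a i \<noteq> 0" "\<forall>i\<in>{..2*d}. \<bar>a i\<bar> \<le> int ((2*d+1) * A)"
     "\<forall>l\<in>I. (\<Sum>i\<in>{..2*d}. n i l * a i) = 0" by auto
  have "(\<Sum>i\<in>{..2*d}. of_int (a i) * x ^ i) = (\<Sum>i\<in>{..2*d}. \<Sum>l\<in>I. of_int (n i l * a i) * e l)"
    by (simp add: n(1) sum_distrib_left algebra_simps)
  also have "\<dots> = (\<Sum>l\<in>I. of_int (\<Sum>i\<in>{..2*d}. n i l * a i) * e l)"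
    by (subst sum.swap) (simp add: sum_distrib_right)
  also have "\<dots> = 0" using a(3) by simp
  finally have root: "(\<Sum>i\<in>{..2*d}. of_int (a i) * x ^ i) = 0" .
  \<comment> \<open>Dividing by \<open>x ^ m\<close> leaves the nonzero integer \<open>a m\<close>
    plus terms with a positive power of \<open>x\<close>; as \<open>norm x < 1\<close>, each of
    these is at most the coefficient bound times \<open>norm x\<close>.\<close>
  define m where "m = (LEAST i. a i \<noteq> 0)"
  obtain i where i: "i \<le> 2*d" "a i \<noteq> 0" using a(1) by auto
  have m: "a m \<noteq> 0" "m \<le> 2*d" unfolding m_def
    using LeastI[of "\<lambda>i. a i \<noteq> 0", OF i(2)] Least_le[of "\<lambda>i. a i \<noteq> 0", OF i(2)] i(1) by auto
  have least: "\<And>i. i < m \<Longrightarrow> a i = 0" unfolding m_def using not_less_Least by blast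
  have "(\<Sum>i\<in>{..2*d}. of_int (a i) * x ^ i) = (\<Sum>i\<in>{m..2*d}. of_int (a i) * x ^ i)"
    using least by (intro sum.mono_neutral_right) auto
  also have "\<dots> = x ^ m * (\<Sum>i\<in>{m..2*d}. of_int (a i) * x ^ (i - m))"
    unfolding sum_distrib_left by (intro sum.cong) (auto simp: power_add[symmetric] algebra_simps)
  finally have "(\<Sum>i\<in>{m..2*d}. of_int (a i) * x ^ (i - m)) = 0" using root x(2) by simp
  also have "{m..2*d} = insert m {m<..2*d}" using m by auto
  finally have "of_int (a m) = - (\<Sum>i\<in>{m<..2*d}. of_int (a i) * x ^ (i - m))"
    by (simp add: eq_neg_iff_add_eq_0)
  then have "norm (of_int (a m) :: complex) = norm (\<Sum>i\<in>{m<..2*d}. of_int (a i) * x ^ (i - m))"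
    by (metis norm_minus_cancel)
  also have "\<dots> \<le> (\<Sum>i\<in>{m<..2*d}. norm (of_int (a i) * x ^ (i - m)))" by (rule norm_sum)
  also have "\<dots> \<le> (\<Sum>i\<in>{m<..2*d}. real ((2*d+1) * A) * norm x)"
  proof (rule sum_mono)
    fix i assume i: "i \<in> {m<..2*d}"
    have "\<bar>real_of_int (a i)\<bar> \<le> real ((2*d+1) * A)" using a(2) i
      by (metis atMost_iff greaterThanAtMost_iff of_int_abs of_int_le_iff of_int_of_nat_eq)
    moreover have "norm x ^ (i - m) \<le> norm x ^ 1" using i False by (intro power_decreasing) auto
    ultimately show "norm (of_int (a i) * x ^ (i - m)) \<le> real ((2*d+1) * A) * norm x"
      unfolding norm_mult norm_power norm_of_int by (intro mult_mono) auto
  qed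
  also have "\<dots> = real (2*d - m) * (real ((2*d+1) * A) * norm x)" by simp
  also have "\<dots> \<le> real (2*d + 1) * (real ((2*d+1) * A) * norm x)" by (intro mult_right_mono) auto
  also have "\<dots> = norm x * (2 * real d + 1)\<^sup>2 * real A" by (simp add: power2_eq_square algebra_simps)
  also have "\<dots> \<le> norm x * (2 * real d + 1)\<^sup>2 * K ^ (2 * d)" using AK by (intro mult_left_mono) auto
  finally have "norm (of_int (a m) :: complex) \<le> norm x * (2 * real d + 1)\<^sup>2 * K ^ (2 * d)" .
  moreover have "1 \<le> norm (of_int (a m) :: complex)" using m(1) by simp
  ultimately show ?thesis unfolding d_def by linarith
qed

section \<open>From algebraic numbers to integer modules\<close>

lemma algebraic_imp_monic_relation:
  fixes x :: complex
  assumes "algebraic x"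
  shows "\<exists>(b::int) (n::nat) (c :: nat \<Rightarrow> int). b \<noteq> 0 \<and> n > 0 \<and>
           (of_int b * x) ^ n = (\<Sum>i<n. of_int (c i) * (of_int b * x) ^ i)"
proof -
  obtain p :: "int poly" where p: "p \<noteq> 0" "poly (map_poly of_int p) x = 0"
    using assms by (rule algebraicE')
  define n where "n = degree p"
  define b where "b = lead_coeff p"
  have b: "b \<noteq> 0" using p(1) by (simp add: b_def)
  have n: "n > 0"
  proof (rule ccontr)
    assume "\<not> n > 0"
    then obtain a where "p = [:a:]" unfolding n_def using degree_eq_zeroE by auto
    then show False using p by (auto simp: map_poly_pCons)
  qed
  have "poly (map_poly of_int p) x = (\<Sum>i\<le>n. of_int (coeff p i) * x ^ i)"
    unfolding n_def poly_altdef by (simp add: coeff_map_poly degree_map_poly)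
  also have "\<dots> = of_int b * x ^ n + (\<Sum>i<n. of_int (coeff p i) * x ^ i)"
    unfolding lessThan_Suc_atMost[symmetric] by (simp add: b_def n_def)
  finally have 1: "of_int b * x ^ n = - (\<Sum>i<n. of_int (coeff p i) * x ^ i)"
    using p(2) by (simp add: eq_neg_iff_add_eq_0)
  \<comment> \<open>Multiplying the equation by this power of the leading coefficient makes it monic
    in \<open>of_int b * x\<close>.\<close>
  have "(of_int b * x) ^ n = of_int (b ^ (n - 1)) * (of_int b * x ^ n)"
    using n by (cases n) (auto simp: power_mult_distrib algebra_simps)
  also have "\<dots> = (\<Sum>i<n. of_int (- coeff p i * b ^ (n - 1)) * x ^ i)"
    unfolding 1 by (simp add: sum_negf sum_distrib_left algebra_simps)
  also have "\<dots> = (\<Sum>i<n. of_int (- coeff p i * b ^ (n - 1 - i)) * (of_int b * x) ^ i)"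
  proof (intro sum.cong refl)
    fix i assume "i \<in> {..<n}"
    then have "b ^ (n - 1) = b ^ (n - 1 - i) * b ^ i" by (simp add: power_add[symmetric])
    then show "of_int (- coeff p i * b ^ (n - 1)) * x ^ i =
        of_int (- coeff p i * b ^ (n - 1 - i)) * (of_int b * x) ^ i"
      by (simp add: power_mult_distrib)
  qed
  finally show ?thesis using b n
    by (intro exI[of _ b] exI[of _ n] exI[of _ "\<lambda>i. - coeff p i * b ^ (n - 1 - i)"]) simp
qed

text \<open>Multiplication by \<open>u\<close> shifts the powers, except for the last one, where the
  relation takes over. The bound adds the two cases, with 1 for the shift.\<close>

lemma zbounded_monic_relation:
  fixes u :: complex
  assumes "n > 0" and rel: "u ^ n = (\<Sum>i<n. of_int (c i) * u ^ i)"
  shows "zbounded {..<n} (\<lambda>i. u ^ i) u (1 + (\<Sum>i<n. \<bar>real_of_int (c i)\<bar>))"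
  unfolding zbounded_def
proof
  fix k assume k: "k \<in> {..<n}"
  show "\<exists>m. u * u ^ k = (\<Sum>l<n. of_int (m l) * u ^ l) \<and>
       (\<Sum>l<n. \<bar>real_of_int (m l)\<bar>) \<le> 1 + (\<Sum>i<n. \<bar>real_of_int (c i)\<bar>)"
  proof (cases "Suc k = n")
    case True
    then show ?thesis using rel by (intro exI[of _ c]) auto
  next
    case False
    then have "Suc k < n" using k by auto
    then show ?thesis
      by (intro exI[of _ "\<lambda>l. if l = Suc k then 1 else 0"])
        (auto simp: if_distrib[of of_int] if_distribR if_distrib[of "\<lambda>x. x * _"] if_distrib[of abs]
           intro!: sum_nonneg cong: if_cong)
  qed
qed

text \<open>On the products of two families \<open>x\<close> acts on the first factor only. This
  lets two numbers act on one common module.\<close>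

lemma zbounded_Times_left:
  assumes "finite A" "finite B" "zbounded A e x K"
  shows "zbounded (A \<times> B) (\<lambda>(i, j). e i * f j) x K"
  unfolding zbounded_def
proof
  fix k assume "k \<in> A \<times> B"
  then obtain i j where k: "k = (i, j)" "i \<in> A" "j \<in> B" by auto
  obtain n where n: "x * e i = (\<Sum>l\<in>A. of_int (n l) * e l)" "(\<Sum>l\<in>A. \<bar>real_of_int (n l)\<bar>) \<le> K"
    using assms(3) k unfolding zbounded_def by blast
  define m where "m = (\<lambda>(i', j'). if j' = j then n i' else 0)"
  have "(\<Sum>l\<in>A\<times>B. of_int (m l) * (case l of (i, j) \<Rightarrow> e i * f j)) =
      (\<Sum>i'\<in>A. \<Sum>j'\<in>B. if j' = j then of_int (n i') * (e i' * f j') else 0)"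
    unfolding sum.cartesian_product by (intro sum.cong) (auto simp: m_def)
  also have "\<dots> = (\<Sum>i'\<in>A. of_int (n i') * (e i' * f j))" using k assms by simp
  also have "\<dots> = x * e i * f j" unfolding n(1) by (simp add: sum_distrib_right mult.assoc)
  finally have 1: "x * (case k of (i, j) \<Rightarrow> e i * f j) = (\<Sum>l\<in>A\<times>B. of_int (m l) * (case l of (i, j) \<Rightarrow> e i * f j))"
    by (simp add: k)
  have "(\<Sum>l\<in>A\<times>B. \<bar>real_of_int (m l)\<bar>) = (\<Sum>i'\<in>A. \<Sum>j'\<in>B. if j' = j then \<bar>real_of_int (n i')\<bar> else 0)"
    unfolding sum.cartesian_product by (intro sum.cong) (auto simp: m_def)
  also have "\<dots> \<le> K" using k assms n(2) by simp
  finally show "\<exists>n. x * (case k of (i, j) \<Rightarrow> e i * f j) = (\<Sum>l\<in>A\<times>B. of_int (n l) * (case l of (i, j) \<Rightarrow> e i * f j))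
      \<and> (\<Sum>l\<in>A\<times>B. \<bar>real_of_int (n l)\<bar>) \<le> K" using 1 by blast
qed

lemma zbounded_reindex:
  assumes "zbounded A e x K" "bij_betw h B A" "\<And>b. b \<in> B \<Longrightarrow> g b = e (h b)"
  shows "zbounded B g x K"
  unfolding zbounded_def
proof
  fix k assume k: "k \<in> B"
  then have "h k \<in> A" using assms(2) by (auto simp: bij_betw_def)
  then obtain n where n: "x * e (h k) = (\<Sum>l\<in>A. of_int (n l) * e l)" "(\<Sum>l\<in>A. \<bar>real_of_int (n l)\<bar>) \<le> K"
    using assms(1) unfolding zbounded_def by blast
  have "(\<Sum>l\<in>A. of_int (n l) * e l) = (\<Sum>b\<in>B. of_int (n (h b)) * e (h b))"
    by (rule sum.reindex_bij_betw[OF assms(2), symmetric])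
  also have "\<dots> = (\<Sum>b\<in>B. of_int (n (h b)) * g b)" using assms(3) by simp
  finally have 1: "x * g k = (\<Sum>b\<in>B. of_int (n (h b)) * g b)" using n(1) assms(3)[OF k] by simp
  have "(\<Sum>l\<in>A. \<bar>real_of_int (n l)\<bar>) = (\<Sum>b\<in>B. \<bar>real_of_int (n (h b))\<bar>)"
    by (rule sum.reindex_bij_betw[OF assms(2), symmetric])
  then show "\<exists>n. x * g k = (\<Sum>l\<in>B. of_int (n l) * g l) \<and> (\<Sum>l\<in>B. \<bar>real_of_int (n l)\<bar>) \<le> K"
    using 1 n(2) by (intro exI[of _ "\<lambda>b. n (h b)"]) simp
qed

lemma zbounded_Times_right:
  assumes "finite A" "finite B" "zbounded B f x K"
  shows "zbounded (A \<times> B) (\<lambda>(i, j). e i * f j) x K"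
  using zbounded_Times_left[OF assms(2,1,3), of e]
  by (rule zbounded_reindex[where h = prod.swap])
     (auto simp: bij_betw_def mult.commute intro!: inj_onI)

text \<open>Products of powers give one family for both numbers, as \<open>zbounded_mult\<close>
  demands. The integers \<open>b\<close> and \<open>c\<close> are denominators; the index with
  \<open>e k = 1\<close> is the one needed by \<open>zbounded_liouville\<close>.\<close>

lemma algebraic_pair_zbounded:
  fixes x y :: complex
  assumes "algebraic x" "algebraic y"
  shows "\<exists>(b::int) (c::int) (I :: (nat \<times> nat) set) e k K L. b \<noteq> 0 \<and> c \<noteq> 0 \<and> finite I \<and> k \<in> I \<and> e k = 1 \<and>
    zbounded I e (of_int b * x) K \<and> zbounded I e (of_int c * y) L \<and> K \<ge> 0 \<and> L \<ge> 1"
proof -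
  obtain b :: int and m f where b: "b \<noteq> 0" "m > 0" "(of_int b * x) ^ m = (\<Sum>i<m. of_int (f i) * (of_int b * x) ^ i)"
    using algebraic_imp_monic_relation[OF assms(1)] by blast
  obtain c :: int and n g where c: "c \<noteq> 0" "n > 0" "(of_int c * y) ^ n = (\<Sum>i<n. of_int (g i) * (of_int c * y) ^ i)"
    using algebraic_imp_monic_relation[OF assms(2)] by blast
  let ?e = "\<lambda>(i, j). (of_int b * x) ^ i * (of_int c * y) ^ j"
  let ?I = "{..<m} \<times> {..<n}"
  have 1: "zbounded ?I ?e (of_int b * x) (1 + (\<Sum>i<m. \<bar>real_of_int (f i)\<bar>))"
    by (intro zbounded_Times_left zbounded_monic_relation b) auto
  have 2: "zbounded ?I ?e (of_int c * y) (1 + (\<Sum>i<n. \<bar>real_of_int (g i)\<bar>))"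
    by (intro zbounded_Times_right zbounded_monic_relation c) auto
  have 3: "1 + (\<Sum>i<m. \<bar>real_of_int (f i)\<bar>) \<ge> 0" "1 + (\<Sum>i<n. \<bar>real_of_int (g i)\<bar>) \<ge> 1"
    by (auto intro!: sum_nonneg add_nonneg_nonneg)
  show ?thesis
    using 1 2 3 b c
    by (intro exI[of _ b] exI[of _ c] exI[of _ ?I] exI[of _ ?e] exI[of _ "(0, 0)"] exI conjI) auto
qed

section \<open>Schneider's method\<close>

lemma entire_factor_zeros:
  assumes "finite Z" "f holomorphic_on UNIV" "\<And>z. z \<in> Z \<Longrightarrow> f z = 0"
  shows "\<exists>g. g holomorphic_on UNIV \<and> (\<forall>z. f z = (\<Prod>p\<in>Z. (z - p)) * g z)"
  using assms
proof (induction Z arbitrary: f rule: finite_induct)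
  case empty
  then show ?case by auto
next
  case (insert a Z)
  define h where "h = (\<lambda>z. if z = a then deriv f a else (f z - f a) / (z - a))"
  have h: "h holomorphic_on UNIV" unfolding h_def
    by (rule pole_lemma_open) (use insert in auto)
  have fh: "f z = (z - a) * h z" for z using insert.prems(2)[of a] by (auto simp: h_def)
  have "h z = 0" if "z \<in> Z" for z
    using insert.prems(2)[of z] insert.hyps fh[of z] that by auto
  then obtain g where "g holomorphic_on UNIV" "\<And>z. h z = (\<Prod>p\<in>Z. (z - p)) * g z"
    using insert.IH[OF h] by blast
  then show ?case using fh insert.hyps by (intro exI[of _ g]) (simp add: mult.assoc)
qed

text \<open>The quotient of \<open>f\<close> by its zeros is entire, and the maximum modulus
  principle carries its bound from the circle of radius \<open>R\<close> to \<open>w\<close>. Each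
  zero contributes a factor \<open>s / (R - r)\<close>.\<close>

lemma schwarz_zeros:
  assumes "finite Z" "f holomorphic_on UNIV" "\<And>z. z \<in> Z \<Longrightarrow> f z = 0"
    and Z: "\<And>p. p \<in> Z \<Longrightarrow> norm p \<le> r" "\<And>p. p \<in> Z \<Longrightarrow> norm (w - p) \<le> s"
    and w: "norm w \<le> R" "r < R" "0 < R" and s: "s \<ge> 0"
    and B: "\<And>z. norm z = R \<Longrightarrow> norm (f z) \<le> B"
  shows "norm (f w) \<le> (s / (R - r)) ^ card Z * B"
proof -
  obtain g where g: "g holomorphic_on UNIV" "\<And>z. f z = (\<Prod>p\<in>Z. (z - p)) * g z"
    using entire_factor_zeros[OF assms(1-3)] by blast
  have gR: "norm (g z) \<le> B / (R - r) ^ card Z" if z: "norm z = R" for z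
  proof -
    have "(R - r) ^ card Z = (\<Prod>p\<in>Z. R - r)" by simp
    also have "\<dots> \<le> (\<Prod>p\<in>Z. norm (z - p))"
    proof (rule prod_mono)
      fix p assume "p \<in> Z"
      then show "0 \<le> R - r \<and> R - r \<le> norm (z - p)"
        using Z(1)[of p] z w norm_triangle_ineq2[of z p] by simp
    qed
    also have "\<dots> = norm (\<Prod>p\<in>Z. (z - p))" by (simp add: prod_norm)
    finally have "(R - r) ^ card Z * norm (g z) \<le> norm (\<Prod>p\<in>Z. (z - p)) * norm (g z)"
      by (rule mult_right_mono) simp
    also have "\<dots> \<le> B" using B[OF z] unfolding g(2) norm_mult .
    finally show ?thesis using w by (simp add: field_simps)
  qed
  have "norm (g w) \<le> B / (R - r) ^ card Z"
  proof (rule maximum_modulus_frontier[where S = "cball 0 R" and f = g])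
    show "g holomorphic_on interior (cball 0 R)" using g(1) by (rule holomorphic_on_subset) simp
    show "continuous_on (closure (cball 0 R)) g"
      using g(1) by (intro holomorphic_on_imp_continuous_on) (rule holomorphic_on_subset, auto)
    show "bounded (cball 0 R :: complex set)" by simp
    show "w \<in> cball 0 R" using w by simp
    fix z :: complex assume "z \<in> frontier (cball 0 R)"
    then have "norm z = R" using w by (simp add: frontier_cball)
    then show "norm (g z) \<le> B / (R - r) ^ card Z" by (rule gR)
  qed
  moreover have "norm (\<Prod>p\<in>Z. (w - p)) \<le> s ^ card Z"
  proof -
    have "norm (\<Prod>p\<in>Z. (w - p)) = (\<Prod>p\<in>Z. norm (w - p))" by (simp add: prod_norm)
    also have "\<dots> \<le> (\<Prod>p\<in>Z. s)" by (intro prod_mono) (use Z in auto)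
    finally show ?thesis by simp
  qed
  ultimately have "norm (f w) \<le> s ^ card Z * (B / (R - r) ^ card Z)"
    unfolding g(2) norm_mult using s by (intro mult_mono) auto
  then show ?thesis by (simp add: power_divide)
qed

text \<open>This inequality contradicts the Liouville bound during the extrapolation. The logarithms
  of the factors are of two kinds. Those of size q M are at most a constant times M^2 / K, so
  \<open>K\<close>, fixed first, makes them at most half of M^2 ln 2. The others are O(M ln M) once
  K is fixed, because the degree 2 d K^2 q is at most 2 d K M; so \<open>q\<close>, chosen last,
  makes M large enough for the other half.\<close>

lemma growth_parameters:
  fixes d h :: nat and \<kappa> \<mu> :: real
  assumes d: "d \<ge> 1" and \<kappa>: "\<kappa> \<ge> 1" and \<mu>: "\<mu> \<ge> 1"
  shows "\<exists>K q :: nat. K \<ge> 1 \<and> q \<ge> 1 \<and> (\<forall>M \<ge> K * q.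
     (2 * real d + 1)\<^sup>2 * real (2 * d * K\<^sup>2 * q\<^sup>2) ^ h * ((\<kappa> * real M) ^ (2 * d * K\<^sup>2 * q) * \<mu> ^ (q * M)) ^ h *
       ((6 * real M) ^ (2 * d * K\<^sup>2 * q) * exp (12 * pi * real q * real M)) < 2 ^ (M\<^sup>2))"
proof -
  \<comment> \<open>The total rate of the factors that are exponential in q M.\<close>
  define \<Lambda> where "\<Lambda> = real h * ln \<mu> + 12 * pi"
  have ln0: "ln \<mu> \<ge> 0" "ln \<kappa> \<ge> 0" using \<mu> \<kappa> by auto
  have \<Lambda>: "\<Lambda> \<ge> 0" using ln0 by (simp add: \<Lambda>_def)
  obtain K :: nat where "real K \<ge> 2 * \<Lambda> / ln 2 + 1" using real_arch_simple by blast
  moreover have "2 * \<Lambda> / ln 2 \<ge> 0" using \<Lambda> by simp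
  ultimately have K: "real K \<ge> 2 * \<Lambda> / ln 2" "real K \<ge> 1" by linarith+
  then have K\<Lambda>: "\<Lambda> / real K \<le> ln 2 / 2" using \<Lambda> by (simp add: field_simps)
  define A where "A = 2 * real d * real K"
  have A: "A \<ge> 0" by (simp add: A_def)
  \<comment> \<open>All remaining logarithms, with the degree replaced by its bound
    \<open>A * M\<close>.\<close>
  define g where "g = (\<lambda>M::real. 2 * ln (2 * real d + 1) + real h * (ln (2 * real d) + 2 * ln M)
      + A * real h * M * (ln \<kappa> + ln M) + A * M * (ln 6 + ln M))"
  have l0: "((\<lambda>M::real. 1 / M\<^sup>2) \<longlongrightarrow> 0) at_top" "((\<lambda>M::real. ln M / M\<^sup>2) \<longlongrightarrow> 0) at_top"
     "((\<lambda>M::real. 1 / M) \<longlongrightarrow> 0) at_top" "((\<lambda>M::real. ln M / M) \<longlongrightarrow> 0) at_top"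
    by real_asymp+
  have "((\<lambda>M. 2 * ln (2 * real d + 1) * (1 / M\<^sup>2) + real h * (ln (2 * real d) * (1 / M\<^sup>2) + 2 * (ln M / M\<^sup>2))
      + A * real h * (ln \<kappa> * (1 / M) + ln M / M) + A * (ln 6 * (1 / M) + ln M / M)) \<longlongrightarrow>
      2 * ln (2 * real d + 1) * 0 + real h * (ln (2 * real d) * 0 + 2 * 0)
      + A * real h * (ln \<kappa> * 0 + 0) + A * (ln 6 * 0 + 0)) at_top"
    by (intro tendsto_intros l0)
  moreover have "eventually (\<lambda>M::real. 2 * ln (2 * real d + 1) * (1 / M\<^sup>2) + real h * (ln (2 * real d) * (1 / M\<^sup>2) + 2 * (ln M / M\<^sup>2))
      + A * real h * (ln \<kappa> * (1 / M) + ln M / M) + A * (ln 6 * (1 / M) + ln M / M) = g M / M\<^sup>2) at_top"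
    using eventually_gt_at_top[of 0]
    by eventually_elim (simp add: g_def field_simps power2_eq_square)
  ultimately have "((\<lambda>M. g M / M\<^sup>2) \<longlongrightarrow> 0) at_top"
    by (simp add: tendsto_cong)
  then have "eventually (\<lambda>M. g M / M\<^sup>2 < ln 2 / 2) at_top"
    by (rule order_tendstoD) simp
  then obtain M0 where M0: "\<And>M. M \<ge> M0 \<Longrightarrow> g M / M\<^sup>2 < ln 2 / 2"
    unfolding eventually_at_top_linorder by blast
  obtain q' :: nat where "real q' \<ge> M0" using real_arch_simple by blast
  define q where "q = Suc q'"
  have q: "q \<ge> 1" "real q \<ge> M0" using \<open>real q' \<ge> M0\<close> by (auto simp: q_def)
  show ?thesis
  proof (rule exI[of _ K], rule exI[of _ q], intro conjI allI impI)
    fix M :: nat assume M: "M \<ge> K * q"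
    have M': "real M \<ge> real K * real q" using M by (metis of_nat_le_iff of_nat_mult)
    also have "real K * real q \<ge> 1 * real q" using K by (intro mult_right_mono) auto
    finally have Mq: "real M \<ge> real q" by simp
    have M1: "real M \<ge> 1" using Mq q by simp
    have q1: "real q \<le> real M / real K" using M' K by (simp add: field_simps)
    define D where "D = 2 * d * K\<^sup>2 * q"
    define n where "n = 2 * d * K\<^sup>2 * q\<^sup>2"
    have D: "real D \<le> A * M" using mult_left_mono[OF M', of A] A
      by (simp add: D_def A_def power2_eq_square algebra_simps)
    have n1: "real n \<ge> 1" "real D \<ge> 0"
    proof -
      have "n > 0" using d K q by (auto simp: n_def)
      then show "real n \<ge> 1" "real D \<ge> 0" by auto
    qed
    have "real n = 2 * d * (real K * real q)\<^sup>2" by (simp add: n_def power_mult_distrib)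
    also have "\<dots> \<le> 2 * d * (real M)\<^sup>2" using M' by (intro mult_left_mono power_mono) auto
    finally have n: "ln (real n) \<le> ln (2 * real d) + 2 * ln M"
      using n1 d M1 by (subst (asm) ln_le_cancel_iff[symmetric]) (auto simp: ln_mult ln_realpow)
    let ?L = "2 * ln (2 * real d + 1) + h * ln n + h * (D * (ln \<kappa> + ln M) + q * M * ln \<mu>)
      + (D * (ln 6 + ln M) + 12 * pi * real q * real M)"
    have ln6: "ln (6::real) \<ge> 0" "ln (real M) \<ge> 0" using M1 by auto
    have "?L \<le> 2 * ln (2 * real d + 1) + h * (ln (2 * real d) + 2 * ln M)
       + h * (A * M * (ln \<kappa> + ln M) + q * M * ln \<mu>) + (A * M * (ln 6 + ln M) + 12 * pi * real q * real M)"
      using n D ln6 ln0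
      by (intro add_mono mult_left_mono mult_right_mono order_refl) auto
    also have "\<dots> = g M + q * M * \<Lambda>" by (simp add: g_def \<Lambda>_def algebra_simps)
    also have "q * M * \<Lambda> \<le> (M / K) * M * \<Lambda>" using mult_right_mono[OF q1, of "real M"] \<Lambda> by (intro mult_right_mono) simp_all
    also have "\<dots> = (real M)\<^sup>2 * (\<Lambda> / K)" by (simp add: power2_eq_square)
    also have "\<dots> \<le> (real M)\<^sup>2 * (ln 2 / 2)" using K\<Lambda> by (intro mult_left_mono) auto
    also have "g M < (real M)\<^sup>2 * (ln 2 / 2)"
      using M0[of M] q Mq M1 by (simp add: field_simps)
    finally have L: "?L < ln 2 * real (M\<^sup>2)" by (simp add: algebra_simps)
    have e1: "exp (2 * ln (2 * real d + 1)) = (2 * real d + 1)\<^sup>2"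
      using exp_of_nat_mult[of 2 "ln (2 * real d + 1)"] by simp
    have e2: "exp (real q * real M * ln \<mu>) = \<mu> ^ (q * M)"
      using exp_of_nat_mult[of "q * M" "ln \<mu>"] \<mu> by simp
    have "(2 * real d + 1)\<^sup>2 * real n ^ h * ((\<kappa> * real M) ^ D * \<mu> ^ (q * M)) ^ h *
       ((6 * real M) ^ D * exp (12 * pi * real q * real M)) = exp ?L"
      using n1 d \<kappa> \<mu> M1
      by (simp add: e1 e2 exp_add ln_mult ln_realpow exp_of_nat_mult power_mult_distrib exp_ln
            flip: power_mult mult.assoc)
    also have "\<dots> < exp (ln 2 * real (M\<^sup>2))" using L by simp
    also have "\<dots> = 2 ^ (M\<^sup>2)" by (metis exp_ln exp_of_nat2_mult zero_less_numeral)
    finally show "(2 * real d + 1)\<^sup>2 * real (2 * d * K\<^sup>2 * q\<^sup>2) ^ h * ((\<kappa> * real M) ^ (2 * d * K\<^sup>2 * q) * \<mu> ^ (q * M)) ^ h *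
       ((6 * real M) ^ (2 * d * K\<^sup>2 * q) * exp (12 * pi * real q * real M)) < 2 ^ (M\<^sup>2)"
      unfolding D_def n_def by simp
  qed (use K q in auto)
qed

text \<open>Roots are counted twice. For fixed b the sum is a polynomial in a + b beta with too many
  roots, so its coefficients, the values of \<open>Q i\<close> at \<open>\<omega> ^ b\<close>,
  vanish. Each \<open>Q i\<close> in turn vanishes at all powers of \<open>\<omega>\<close>, which
  are distinct because \<open>\<omega>\<close> is not a root of unity.\<close>

lemma exp_poly_coeffs_zero:
  fixes x :: "nat \<times> nat \<Rightarrow> complex" and \<beta> \<omega> :: complex
  assumes w: "\<omega> \<noteq> 0" "\<And>n. n > 0 \<Longrightarrow> \<omega> ^ n \<noteq> 1"
    and zero: "\<And>a b. (\<Sum>(i, j) \<in> {..<D} \<times> {..<q}. x (i, j) * (of_nat a + of_nat b * \<beta>) ^ i * \<omega> ^ (j * b)) = 0"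
    and ij: "i < D" "j < q"
  shows "x (i, j) = 0"
proof -
  have neq: "\<omega> ^ a \<noteq> \<omega> ^ b" if "a < b" for a b
  proof
    assume "\<omega> ^ a = \<omega> ^ b"
    also have "\<omega> ^ b = \<omega> ^ a * \<omega> ^ (b - a)" using that by (simp flip: power_add)
    finally have "\<omega> ^ (b - a) = 1" using w(1) by simp
    then show False using w(2)[of "b - a"] that by simp
  qed
  have inj: "inj (\<lambda>b. \<omega> ^ b)"
    using neq by (intro injI) (metis linorder_neqE_nat)
  have zero_poly: "f = 0" if "degree f < m" "inj_on g {..<m}" "\<And>a. a < m \<Longrightarrow> poly f (g a) = 0"
    for f :: "complex poly" and g m
  proof (rule ccontr)
    assume f: "f \<noteq> 0"
    have "card (g ` {..<m}) \<le> card {z. poly f z = 0}"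
      using that f by (intro card_mono poly_roots_finite) auto
    also have "\<dots> \<le> degree f" using f by (rule card_poly_roots_bound)
    finally show False using that by (simp add: card_image)
  qed
  define Q where "Q = (\<lambda>i. \<Sum>j<q. monom (x (i, j)) j)"
  have Q_deg: "degree (Q i) < q" for i
    unfolding Q_def using ij by (intro degree_sum_less) (auto intro: le_less_trans[OF degree_monom_le])
  have Q_val: "poly (Q i) (\<omega> ^ b) = 0" if i: "i < D" for i b
  proof -
    define R where "R = (\<Sum>i<D. monom (poly (Q i) (\<omega> ^ b)) i)"
    have "R = 0"
    proof (rule zero_poly)
      show "degree R < D" unfolding R_def
        using ij by (intro degree_sum_less) (auto intro: le_less_trans[OF degree_monom_le])
      show "inj_on (\<lambda>a. of_nat a + of_nat b * \<beta>) {..<D}" by (auto intro: inj_onI)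
      fix a
      have "poly R (of_nat a + of_nat b * \<beta>) =
          (\<Sum>i<D. \<Sum>j<q. x (i, j) * (of_nat a + of_nat b * \<beta>) ^ i * \<omega> ^ (j * b))"
        unfolding R_def Q_def
        by (simp add: poly_sum poly_monom sum_distrib_left sum_distrib_right power_mult[symmetric] mult_ac)
      also have "\<dots> = 0" using zero[of a b] unfolding sum.cartesian_product .
      finally show "poly R (of_nat a + of_nat b * \<beta>) = 0" .
    qed
    then have "coeff R i = 0" by simp
    then show ?thesis using i by (simp add: R_def coeff_sum)
  qed
  have "Q i = 0"
    using inj Q_val[OF ij(1)] by (intro zero_poly[OF Q_deg, of "\<lambda>b. \<omega> ^ b"]) (auto intro: inj_on_subset)
  then have "coeff (Q i) j = 0" by simp
  then show ?thesis using ij by (simp add: Q_def coeff_sum)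
qed

theorem gelfond_schneider_unit_circle:
  fixes \<beta> :: real
  assumes \<beta>: "0 < \<beta>" "\<beta> < 1" "\<beta> \<notin> \<rat>" "algebraic \<beta>"
  shows "\<not> algebraic (exp (2 * pi * \<i> * \<beta>))"
proof
  define \<omega> where "\<omega> = exp (2 * pi * \<i> * \<beta>)"
  assume "algebraic (exp (2 * pi * \<i> * \<beta>))"
  then have "algebraic \<omega>" by (simp add: \<omega>_def)
  moreover have "algebraic (of_real \<beta> :: complex)" using \<beta> by simp
  ultimately obtain b c :: int and I :: "(nat \<times> nat) set" and e k Ku Kv where bc: "b \<noteq> 0" "c \<noteq> 0"
    and I: "finite I" "k \<in> I" "e k = 1"
    and zb: "zbounded I e (of_int b * of_real \<beta>) Ku" "zbounded I e (of_int c * \<omega>) Kv" "Ku \<ge> 0" "Kv \<ge> 1"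
    using algebraic_pair_zbounded[of "of_real \<beta>" \<omega>] by metis
  define d where "d = card I"
  have d: "d \<ge> 1" using I unfolding d_def by (metis One_nat_def Suc_leI card_gt_0_iff empty_iff)
  define p :: "nat \<Rightarrow> nat \<Rightarrow> complex" where "p = (\<lambda>x y. of_nat x + of_nat y * of_real \<beta>)"
  have p_real: "p x y = of_real (real x + real y * \<beta>)" for x y by (simp add: p_def)
  have norm_w: "norm \<omega> = 1" by (simp add: \<omega>_def)
  \<comment> \<open>Whole periods drop out: at the interpolation points the exponential is a power
    of \<open>\<omega>\<close> independent of \<open>x\<close>.\<close>
  have exp_p: "exp (2 * pi * \<i> * j * p x y) = \<omega> ^ (j * y)" for j x y :: nat
  proof -
    have "2 * pi * \<i> * j * p x y = of_nat (j * x) * (2 * of_real pi * \<i>) + of_nat (j * y) * (2 * pi * \<i> * \<beta>)"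
      by (simp add: p_def algebra_simps)
    then show ?thesis unfolding \<omega>_def by (simp only: exp_add exp_of_nat_mult exp_two_pi_i power_one mult_1_left)
  qed
  have inj_p: "x = x' \<and> y = y'" if "p x y = p x' y'" for x y x' y'
  proof -
    have eq: "real x + real y * \<beta> = real x' + real y' * \<beta>" using that unfolding p_real of_real_eq_iff .
    have "y = y'"
    proof (rule ccontr)
      assume ne: "y \<noteq> y'"
      then have "\<beta> = (real x - real x') / (real y' - real y)" using eq by (simp add: field_simps)
      also have "\<dots> \<in> \<rat>" by simp
      finally show False using \<beta> by simp
    qed
    then show ?thesis using eq by simp
  qed
  \<comment> \<open>For points with coordinates up to M, \<open>\<kappa> * M\<close> bounds
    \<open>b\<close> and \<open>b * p x y\<close> in the sense of \<open>zbounded\<close>;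
    \<open>\<mu>\<close> does so for \<open>c\<close> and \<open>c * \<omega>\<close>.\<close>
  define \<kappa> where "\<kappa> = \<bar>real_of_int b\<bar> + Ku"
  define \<mu> where "\<mu> = max \<bar>real_of_int c\<bar> Kv"
  have b1: "\<bar>real_of_int b\<bar> \<ge> 1" "\<bar>real_of_int c\<bar> \<ge> 1" using bc by auto
  have \<kappa>: "\<kappa> \<ge> 1" "\<bar>real_of_int b\<bar> \<le> \<kappa>" using b1 zb by (auto simp: \<kappa>_def)
  have \<mu>: "\<mu> \<ge> 1" "\<bar>real_of_int c\<bar> \<le> \<mu>" "Kv \<le> \<mu>" using b1 by (auto simp: \<mu>_def)
  \<comment> \<open>The exponent of n G in the final estimate: 4 d from the Liouville bound, 2 from
    the analytic bound together with the denominators.\<close>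
  define h where "h = 2 + 4 * d"
  obtain K q :: nat where Kq: "K \<ge> 1" "q \<ge> 1" and growth: "\<And>M. M \<ge> K * q \<Longrightarrow>
     (2 * real d + 1)\<^sup>2 * real (2 * d * K\<^sup>2 * q\<^sup>2) ^ h * ((\<kappa> * real M) ^ (2 * d * K\<^sup>2 * q) * \<mu> ^ (q * M)) ^ h *
       ((6 * real M) ^ (2 * d * K\<^sup>2 * q) * exp (12 * pi * real q * real M)) < 2 ^ (M\<^sup>2)"
    using growth_parameters[OF d \<kappa>(1) \<mu>(1), of h] by blast
  \<comment> \<open>With this choice there are \<open>D * q = 2 * (N * N * d)\<close> unknowns,
    twice the number of equations: \<open>d\<close> coordinates at each of the \<open>N * N\<close>
    points.\<close>
  define D where "D = 2 * d * K\<^sup>2 * q"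
  define N where "N = K * q"
  define U where "U = {..<D} \<times> {..<q}"
  define n where "n = 2 * d * K\<^sup>2 * q\<^sup>2"
  have cU: "card U = n" by (simp add: U_def n_def D_def power2_eq_square)
  have nN: "n = 2 * (N * N * d)" by (simp add: n_def N_def power2_eq_square)
  have N1: "N \<ge> 1" using Kq by (simp add: N_def Suc_le_eq)
  have finU: "finite U" by (simp add: U_def)
  define G :: "nat \<Rightarrow> real" where "G = (\<lambda>M. (\<kappa> * real M) ^ D * \<mu> ^ (q * M))"
  \<comment> \<open>The exponents \<open>D\<close> and \<open>q * M\<close> clear the denominators
    of every term of \<open>F\<close> at all points whose coordinates are at most
    \<open>M\<close>.\<close>
  define T where "T = (\<lambda>M i j x y. of_int b ^ D * of_int c ^ (q * M) * (p x y ^ i * \<omega> ^ (j * y)))"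
  have zbT: "zbounded I e (T M i j x y) (G M)" if M: "M \<ge> 1" "x \<le> M" "y \<le> M" and ij: "(i, j) \<in> U" for M i j x y
  proof -
    have ij': "i < D" "j < q" using ij by (auto simp: U_def)
    have zbp: "zbounded I e (of_int b * p x y) (\<kappa> * real M)"
    proof -
      have "zbounded I e (of_int b * of_int (int x) + of_int (int y) * (of_int b * of_real \<beta>))
         (\<bar>of_int b\<bar> * \<bar>of_int (int x)\<bar> + \<bar>of_int (int y)\<bar> * Ku)"
        using zb I by (intro zbounded_add zbounded_mult zbounded_of_int) auto
      moreover have "\<bar>of_int b\<bar> * \<bar>of_int (int x)\<bar> + \<bar>of_int (int y)\<bar> * Ku \<le> \<bar>real_of_int b\<bar> * M + M * Ku"
        using M zb(3) by (intro add_mono mult_mono) auto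
      ultimately have "zbounded I e (of_int b * of_int (int x) + of_int (int y) * (of_int b * of_real \<beta>)) (\<kappa> * real M)"
        unfolding \<kappa>_def by (elim zbounded_mono) (simp add: algebra_simps)
      then show ?thesis by (simp add: p_def algebra_simps)
    qed
    have jy: "j * y \<le> q * M" using ij' M by (intro mult_mono) auto
    have \<kappa>M: "\<kappa> * M \<ge> 0" "\<bar>real_of_int b\<bar> \<le> \<kappa> * M"
      using \<kappa> M mult_mono[of "\<bar>real_of_int b\<bar>" \<kappa> 1 "real M"] by auto
    define \<nu> where "\<nu> = \<kappa> * real M"
    have \<nu>: "\<nu> \<ge> 0" "zbounded I e (of_int b) \<nu>" "zbounded I e (of_int b * p x y) \<nu>"
      using \<kappa>M zbp zbounded_mono[OF zbounded_of_int[OF I(1)] \<kappa>M(2)] by (auto simp: \<nu>_def)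
    have \<mu>': "\<mu> \<ge> 0" "zbounded I e (of_int c) \<mu>" "zbounded I e (of_int c * \<omega>) \<mu>"
      using \<mu> zbounded_mono[OF zbounded_of_int[OF I(1)] \<mu>(2)] zbounded_mono[OF zb(2) \<mu>(3)] by auto
    have "zbounded I e (of_int b ^ (D - i) * (of_int b * p x y) ^ i * (of_int c ^ (q * M - j * y) * (of_int c * \<omega>) ^ (j * y)))
       (\<nu> ^ (D - i) * \<nu> ^ i * (\<mu> ^ (q * M - j * y) * \<mu> ^ (j * y)))"
      using \<nu> \<mu>' by (intro zbounded_mult zbounded_power I mult_nonneg_nonneg zero_le_power)
    moreover have "of_int b ^ (D - i) * (of_int b * p x y) ^ i * (of_int c ^ (q * M - j * y) * (of_int c * \<omega>) ^ (j * y)) = T M i j x y"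
    proof -
      have "of_int b ^ D = (of_int b ^ (D - i) * of_int b ^ i :: complex)"
        "of_int c ^ (q * M) = (of_int c ^ (q * M - j * y) * of_int c ^ (j * y) :: complex)"
        using ij' jy by (simp_all flip: power_add)
      then show ?thesis unfolding T_def by (simp add: power_mult_distrib)
    qed
    moreover have "\<nu> ^ (D - i) * \<nu> ^ i * (\<mu> ^ (q * M - j * y) * \<mu> ^ (j * y)) = G M"
      using ij' jy unfolding G_def \<nu>_def by (simp flip: power_add)
    ultimately show ?thesis by simp
  qed
  have Gmono: "G M \<le> G M'" if "M \<le> M'" "M \<ge> 1" for M M'
    unfolding G_def using that \<kappa> \<mu>
    by (intro mult_mono power_mono power_increasing mult_left_mono) auto
  have G1: "G M \<ge> 1" if "M \<ge> 1" for M
  proof -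
    have "1 * 1 \<le> \<kappa> * real M" using \<kappa> that by (intro mult_mono) auto
    then have "1 * 1 \<le> G M" unfolding G_def using \<mu> by (intro mult_mono one_le_power) auto
    then show ?thesis by simp
  qed
  \<comment> \<open>The integer coordinates of the cleared terms are the coefficients of the linear
    system. Requiring every coordinate of the sum to vanish makes \<open>F\<close> vanish at the
    point.\<close>
  have "\<exists>m. T N i j x y = (\<Sum>l\<in>I. of_int (m l) * e l) \<and> (\<Sum>l\<in>I. \<bar>real_of_int (m l)\<bar>) \<le> G N"
    if "(i, j) \<in> U" "x < N" "y < N" for i j x y
    using zbT[OF N1, of x y i j] that I(2,3) unfolding zbounded_def by force
  then have "\<exists>m. (case z of (i, j, x, y) \<Rightarrow> (i, j) \<in> U \<longrightarrow> x < N \<longrightarrow> y < N \<longrightarrow>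
      T N i j x y = (\<Sum>l\<in>I. of_int (m l) * e l) \<and> (\<Sum>l\<in>I. \<bar>real_of_int (m l)\<bar>) \<le> G N)" for z
    by (cases z) auto
  then have "\<exists>m :: nat \<times> nat \<times> nat \<times> nat \<Rightarrow> nat \<times> nat \<Rightarrow> int. \<forall>z. (case z of (i, j, x, y) \<Rightarrow> (i, j) \<in> U \<longrightarrow> x < N \<longrightarrow> y < N \<longrightarrow>
      T N i j x y = (\<Sum>l\<in>I. of_int (m z l) * e l) \<and> (\<Sum>l\<in>I. \<bar>real_of_int (m z l)\<bar>) \<le> G N)"
    by (intro choice allI)
  then obtain m :: "nat \<times> nat \<times> nat \<times> nat \<Rightarrow> nat \<times> nat \<Rightarrow> int" where m': "\<And>z. (case z of (i, j, x, y) \<Rightarrow> (i, j) \<in> U \<longrightarrow> x < N \<longrightarrow> y < N \<longrightarrow>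
      T N i j x y = (\<Sum>l\<in>I. of_int (m z l) * e l) \<and> (\<Sum>l\<in>I. \<bar>real_of_int (m z l)\<bar>) \<le> G N)"
    by blast
  have m: "T N i j x y = (\<Sum>l\<in>I. of_int (m (i, j, x, y) l) * e l)"
      "(\<Sum>l\<in>I. \<bar>real_of_int (m (i, j, x, y) l)\<bar>) \<le> G N" if "(i, j) \<in> U" "x < N" "y < N" for i j x y
    using m'[of "(i, j, x, y)"] that by auto
  define J where "J = ({..<N} \<times> {..<N}) \<times> I"
  define a where "a = (\<lambda>((x, y), l) (i, j). m (i, j, x, y) l)"
  define A where "A = nat \<lfloor>G N\<rfloor>"
  have A: "A \<ge> 1" "real A \<le> G N" using G1[OF N1] unfolding A_def by linarith+
  have abd: "\<bar>a r s\<bar> \<le> int A" if rs: "r \<in> J" "s \<in> U" for r s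
  proof -
    obtain x y l where r: "r = ((x, y), l)" "x < N" "y < N" "l \<in> I" using rs unfolding J_def by auto
    obtain i j where s: "s = (i, j)" by (cases s)
    have "\<bar>real_of_int (m (i, j, x, y) l)\<bar> \<le> (\<Sum>l\<in>I. \<bar>real_of_int (m (i, j, x, y) l)\<bar>)"
      using r I by (intro member_le_sum) auto
    also have "\<dots> \<le> G N" using m(2) r s rs by auto
    finally show ?thesis unfolding A_def r s a_def by simp linarith
  qed
  have "\<exists>c :: nat \<times> nat \<Rightarrow> int. (\<exists>i\<in>U. c i \<noteq> 0) \<and> (\<forall>i\<in>U. \<bar>c i\<bar> \<le> int (card U * A)) \<and>
           (\<forall>j\<in>J. (\<Sum>i\<in>U. a j i * c i) = 0)"
  proof (rule siegel_lemma)
    show "finite J" using I by (simp add: J_def)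
    have "card U > 0" using nN N1 d by (simp add: cU)
    then show "U \<noteq> {}" by auto
    show "2 * card J \<le> card U" unfolding cU nN by (simp add: J_def d_def card_cartesian_product)
  qed (use finU A abd in auto)
  then obtain X :: "nat \<times> nat \<Rightarrow> int" where X: "\<exists>i\<in>U. X i \<noteq> 0" "\<And>i. i \<in> U \<Longrightarrow> \<bar>X i\<bar> \<le> int (n * A)"
      "\<And>r. r \<in> J \<Longrightarrow> (\<Sum>i\<in>U. a r i * X i) = 0" by (auto simp: cU)
  have XG: "\<bar>real_of_int (X i)\<bar> \<le> n * G N" if "i \<in> U" for i
  proof -
    have "\<bar>real_of_int (X i)\<bar> \<le> real (n * A)" using X(2)[OF that]
      by (metis of_int_abs of_int_le_iff of_int_of_nat_eq)
    also have "\<dots> \<le> n * G N" using A by (simp add: mult_left_mono)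
    finally show ?thesis .
  qed
  define F where "F = (\<lambda>z. \<Sum>(i, j)\<in>U. of_int (X (i, j)) * (z ^ i * exp (2 * pi * \<i> * j * z)))"
  have holF: "F holomorphic_on UNIV" unfolding F_def split_def by (intro holomorphic_intros)
  have Fp: "of_int b ^ D * of_int c ^ (q * M) * F (p x y) = (\<Sum>(i, j)\<in>U. of_int (X (i, j)) * T M i j x y)" for M x y
    unfolding F_def T_def sum_distrib_left exp_p split_def by (simp add: algebra_simps)
  have F0: "F (p x y) = 0" if xy: "x < N" "y < N" for x y
  proof -
    have "(\<Sum>(i, j)\<in>U. of_int (X (i, j)) * T N i j x y) =
       (\<Sum>(i, j)\<in>U. \<Sum>l\<in>I. of_int (a ((x, y), l) (i, j) * X (i, j)) * e l)"
      using xy m(1) by (intro sum.cong refl) (auto simp: a_def sum_distrib_left algebra_simps)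
    also have "\<dots> = (\<Sum>l\<in>I. of_int (\<Sum>u\<in>U. a ((x, y), l) u * X u) * e l)"
      unfolding split_def by (subst sum.swap) (simp add: sum_distrib_right)
    also have "\<dots> = 0" using X(3) xy by (simp add: J_def)
    finally have "of_int b ^ D * of_int c ^ (q * N) * F (p x y) = 0" unfolding Fp .
    then show ?thesis using bc by simp
  qed
  have Fbound: "norm (F z) \<le> real n * (real n * G N) * ((6 * real M) ^ D * exp (12 * pi * real q * real M))"
    if z: "norm z = 6 * real M" and M: "M \<ge> 1" for z M
  proof -
    have "norm (F z) \<le> (\<Sum>(i, j)\<in>U. norm (of_int (X (i, j)) * (z ^ i * exp (2 * pi * \<i> * j * z))))"
      unfolding F_def split_def by (rule norm_sum)
    also have "\<dots> \<le> (\<Sum>(i, j)\<in>U. (n * G N) * ((6 * real M) ^ D * exp (12 * pi * real q * real M)))"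
      unfolding split_def
    proof (rule sum_mono)
      fix u assume u: "u \<in> U"
      obtain i j where ij: "u = (i, j)" "i < D" "j < q" using u by (auto simp: U_def)
      have "norm (z ^ i) = (6 * real M) ^ i" by (simp add: norm_power z)
      also have "\<dots> \<le> (6 * real M) ^ D" using ij M by (intro power_increasing) auto
      finally have 1: "norm (z ^ i) \<le> (6 * real M) ^ D" .
      have "norm (2 * pi * \<i> * j * z) = 2 * pi * j * (6 * real M)" by (simp add: norm_mult z)
      also have "\<dots> \<le> 2 * pi * q * (6 * real M)" using ij by (intro mult_left_mono mult_right_mono) auto
      finally have "norm (exp (2 * pi * \<i> * j * z)) \<le> exp (12 * pi * real q * real M)"
        by (intro order_trans[OF norm_exp]) simp
      with 1 XG[OF u] G1[OF N1] show "norm (of_int (X (fst u, snd u)) * (z ^ fst u * exp (2 * pi * \<i> * snd u * z))) \<le>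
          (n * G N) * ((6 * real M) ^ D * exp (12 * pi * real q * real M))"
        unfolding norm_mult norm_of_int ij by (intro mult_mono) auto
    qed
    also have "\<dots> = n * ((n * G N) * ((6 * real M) ^ D * exp (12 * pi * real q * real M)))" by (simp add: cU split_def)
    finally show ?thesis by (simp add: mult.assoc)
  qed
  \<comment> \<open>One enlargement of the grid of zeros. A nonzero new value, cleared of
    denominators, would be smaller than \<open>zbounded_liouville\<close> permits.\<close>
  have extrapolate: "F (p x y) = 0" if M: "M \<ge> N" and zeros: "\<And>x y. x < M \<Longrightarrow> y < M \<Longrightarrow> F (p x y) = 0"
    and xy: "x \<le> M" "y \<le> M" for M x y
  proof (rule ccontr)
    assume nz: "F (p x y) \<noteq> 0"
    have M1: "M \<ge> 1" using M N1 by simp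
    define \<xi> where "\<xi> = of_int b ^ D * of_int c ^ (q * M) * F (p x y)"
    have \<xi>0: "\<xi> \<noteq> 0" using nz bc by (simp add: \<xi>_def)
    have GNM: "G N \<le> G M" "1 \<le> G M" using Gmono[OF M N1] G1[OF M1] by auto
    have "n > 0" using nN N1 d by simp
    then have n1: "real n \<ge> 1" by simp
    have "zbounded I e \<xi> (\<Sum>(i, j)\<in>U. (n * G N) * G M)"
      unfolding \<xi>_def Fp split_def
      using XG zbounded_mono[OF zbounded_of_int[OF I(1)]] G1[OF N1] xy M1 I finU
      by (intro zbounded_sum zbounded_mult zbT) auto
    moreover have "(\<Sum>(i, j)\<in>U. (n * G N) * G M) \<le> (real n * G M)\<^sup>2"
    proof -
      have "(\<Sum>(i, j)\<in>U. (n * G N) * G M) = n * n * G M * G N" by (simp add: cU split_def)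
      also have "\<dots> \<le> n * n * G M * G M" using GNM by (intro mult_left_mono) auto
      finally show ?thesis by (simp add: power2_eq_square algebra_simps)
    qed
    ultimately have "zbounded I e \<xi> ((real n * G M)\<^sup>2)" by (rule zbounded_mono)
    moreover have "1 * 1 \<le> real n * G M" using n1 GNM by (intro mult_mono) auto
    ultimately have L: "1 \<le> norm \<xi> * (2 * real d + 1)\<^sup>2 * ((real n * G M)\<^sup>2) ^ (2 * d)"
      unfolding d_def using \<xi>0 I by (intro zbounded_liouville[of I k e]) auto
    define Z where "Z = (\<lambda>(x, y). p x y) ` ({..<M} \<times> {..<M})"
    have cZ: "card Z = M\<^sup>2" unfolding Z_def
      by (subst card_image) (auto intro!: inj_onI dest: inj_p simp: power2_eq_square)
    have p_le: "real x + real y * \<beta> \<ge> 0" "real x + real y * \<beta> \<le> 2 * real M" if "x \<le> M" "y \<le> M" for x y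
    proof -
      have "real y * \<beta> \<le> real M * 1" using that \<beta> by (intro mult_mono) auto
      then show "real x + real y * \<beta> \<le> 2 * real M" using that by simp
      show "real x + real y * \<beta> \<ge> 0" using \<beta> by simp
    qed
    \<comment> \<open>The zeros and the new point lie on the real segment from 0 to 2 M, so the
      circle of radius 6 M yields a factor 2 M / (6 M - 2 M) = 1/2 for each of the M^2
      zeros.\<close>
    have "norm (F (p x y)) \<le> (2 * real M / (6 * real M - 2 * real M)) ^ card Z *
         (real n * (real n * G N) * ((6 * real M) ^ D * exp (12 * pi * real q * real M)))"
    proof (rule schwarz_zeros[where f = F and w = "p x y"])
      show "finite Z" by (simp add: Z_def)
      show "F z = 0" if "z \<in> Z" for z using that zeros by (auto simp: Z_def)
      show "norm (F z) \<le> real n * (real n * G N) * ((6 * real M) ^ D * exp (12 * pi * real q * real M))" if "norm z = 6 * real M" for z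
        by (rule Fbound[OF that M1])
      have *: "\<exists>t. z = of_real t \<and> 0 \<le> t \<and> t \<le> 2 * real M" if "z \<in> Z" for z
      proof -
        obtain x' y' where "z = p x' y'" "x' < M" "y' < M" using \<open>z \<in> Z\<close> by (auto simp: Z_def)
        then show ?thesis using p_le[of x' y'] p_real[of x' y']
          by (intro exI[of _ "real x' + real y' * \<beta>"]) simp
      qed
      show "norm z \<le> 2 * real M" if "z \<in> Z" for z using *[OF that] by (metis norm_of_real abs_of_nonneg)
      show "norm (p x y - z) \<le> 2 * real M" if "z \<in> Z" for z
        
      proof -
        obtain t where t: "z = of_real t" "0 \<le> t" "t \<le> 2 * real M" using * [OF \<open>z \<in> Z\<close>] by blast
        then have "p x y - z = of_real (real x + real y * \<beta> - t)" by (simp add: p_real)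
        then have "norm (p x y - z) = \<bar>real x + real y * \<beta> - t\<bar>" by (simp only: norm_of_real)
        then show ?thesis using t p_le[OF xy] by linarith
      qed
      show "norm (p x y) \<le> 6 * real M" using p_le[OF xy] unfolding p_real norm_of_real by linarith
    qed (use M1 holF in auto)
    also have "2 * real M / (6 * real M - 2 * real M) = 1 / 2" using M1 by (simp add: field_simps)
    also have "(1 / 2) ^ card Z * (real n * (real n * G N) * ((6 * real M) ^ D * exp (12 * pi * real q * real M))) \<le>
       (1 / 2) ^ (M\<^sup>2) * (real n * (real n * G M) * ((6 * real M) ^ D * exp (12 * pi * real q * real M)))"
      unfolding cZ using GNM by (intro mult_left_mono mult_right_mono) auto
    finally have "norm (F (p x y)) \<le> (1 / 2) ^ (M\<^sup>2) * (real n * (real n * G M) * ((6 * real M) ^ D * exp (12 * pi * real q * real M)))" .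
    moreover have "norm (of_int b ^ D * of_int c ^ (q * M) :: complex) \<le> G M"
    proof -
      have "\<bar>real_of_int b\<bar> * 1 \<le> \<kappa> * M" using \<kappa> M1 by (intro mult_mono) auto
      then show ?thesis unfolding norm_mult norm_power norm_of_int G_def
        using \<mu> by (intro mult_mono power_mono) auto
    qed
    ultimately have "norm \<xi> \<le> G M * ((1 / 2) ^ (M\<^sup>2) * (real n * (real n * G M) * ((6 * real M) ^ D * exp (12 * pi * real q * real M))))"
      unfolding \<xi>_def norm_mult[of _ "F (p x y)"] using GNM by (intro mult_mono) auto
    then have "norm \<xi> * ((2 * real d + 1)\<^sup>2 * ((real n * G M)\<^sup>2) ^ (2 * d)) \<le>
       G M * ((1 / 2) ^ (M\<^sup>2) * (real n * (real n * G M) * ((6 * real M) ^ D * exp (12 * pi * real q * real M)))) *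
         ((2 * real d + 1)\<^sup>2 * ((real n * G M)\<^sup>2) ^ (2 * d))"
      by (rule mult_right_mono) simp
    also have "\<dots> = (1 / 2) ^ (M\<^sup>2) * ((2 * real d + 1)\<^sup>2 * real n ^ h * G M ^ h * ((6 * real M) ^ D * exp (12 * pi * real q * real M)))"
    proof -
      have "real n ^ h * G M ^ h = (real n * G M) ^ (2 + 2 * (2 * d))" by (simp add: h_def power_mult_distrib)
      also have "\<dots> = real n * G M * (real n * G M) * ((real n * G M)\<^sup>2) ^ (2 * d)"
        unfolding power_add power_mult by (simp add: power2_eq_square)
      finally have pow: "real n ^ h * G M ^ h = real n * G M * (real n * G M) * ((real n * G M)\<^sup>2) ^ (2 * d)" .
      have "(2 * real d + 1)\<^sup>2 * real n ^ h * G M ^ h = (2 * real d + 1)\<^sup>2 * (real n ^ h * G M ^ h)" by simp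
      then show ?thesis unfolding pow by (simp only: mult_ac)
    qed
    finally have "1 \<le> (1 / 2) ^ (M\<^sup>2) * ((2 * real d + 1)\<^sup>2 * real n ^ h * G M ^ h * ((6 * real M) ^ D * exp (12 * pi * real q * real M)))"
      by (rule order_trans[OF L[unfolded mult.assoc[of "norm \<xi>"]]])
    then have "2 ^ (M\<^sup>2) \<le> (2 * real d + 1)\<^sup>2 * real n ^ h * G M ^ h * ((6 * real M) ^ D * exp (12 * pi * real q * real M))"
      by (simp add: power_divide field_simps)
    with growth[of M] M show False unfolding n_def D_def N_def G_def by simp
  qed
  have all: "\<forall>x y. x < M \<longrightarrow> y < M \<longrightarrow> F (p x y) = 0" if "M \<ge> N" for M
    using that
  proof (induction M rule: dec_induct)
    case base
    then show ?case using F0 by blast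
  next
    case (step M)
    then show ?case using extrapolate[of M] by (auto simp: less_Suc_eq_le)
  qed
  have F_all: "F (p x y) = 0" for x y
    using all[of "max N (Suc (max x y))"] by (simp add: less_Suc_eq_le)
  have wn: "\<omega> ^ r \<noteq> 1" if "r > 0" for r
  proof
    assume "\<omega> ^ r = 1"
    then have "exp (of_nat r * (2 * pi * \<i> * \<beta>)) = 1" unfolding \<omega>_def exp_of_nat_mult .
    then obtain n :: int where "2 * pi * \<beta> * r = of_int (2 * n) * pi" unfolding exp_eq_1 by (auto simp: algebra_simps)
    then have "\<beta> = of_int n / of_nat r" using that by (simp add: field_simps)
    also have "\<dots> \<in> \<rat>" by simp
    finally show False using \<beta> by simp
  qed
  have "(of_int (X (i, j)) :: complex) = 0" if "(i, j) \<in> U" for i j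
  proof (rule exp_poly_coeffs_zero[where \<omega> = \<omega> and D = D and q = q and x = "\<lambda>u. of_int (X u)" and \<beta> = "of_real \<beta>"])
    fix x y
    have "(\<Sum>(i, j)\<in>{..<D} \<times> {..<q}. of_int (X (i, j)) * (of_nat x + of_nat y * of_real \<beta>) ^ i * \<omega> ^ (j * y)) = F (p x y)"
      unfolding F_def exp_p U_def by (simp add: p_def mult.assoc)
    then show "(\<Sum>(i, j)\<in>{..<D} \<times> {..<q}. of_int (X (i, j)) * (of_nat x + of_nat y * of_real \<beta>) ^ i * \<omega> ^ (j * y)) = 0"
      using F_all by simp
  qed (use wn that norm_w in \<open>auto simp: U_def\<close>)
  then show False using X(1) by auto
qed

text \<open>With omega = exp(2 i alpha) the quotient of the cosines is (omega^5 + 1) / (omega^4 +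
  omega). If it equals a / b, then omega is a root of an integer polynomial of degree 5 with leading
  coefficient b.\<close>

lemma cos_ratio_irrational:
  fixes \<alpha> :: real
  assumes \<alpha>: "0 < \<alpha>" "\<alpha> < pi" "algebraic (\<alpha> / pi)" "\<alpha> / pi \<notin> \<rat>" and c: "cos (3 * \<alpha>) \<noteq> 0"
  shows "cos (5 * \<alpha>) / cos (3 * \<alpha>) \<notin> \<rat>"
proof
  assume "cos (5 * \<alpha>) / cos (3 * \<alpha>) \<in> \<rat>"
  then obtain a b :: int where b: "b \<noteq> 0" "cos (5 * \<alpha>) / cos (3 * \<alpha>) = of_int a / of_int b"
    by (metis Rats_cases' less_irrefl)
  then have rel: "of_int b * cos (5 * \<alpha>) = of_int a * cos (3 * \<alpha>)" using c by (simp add: field_simps)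
  define \<omega> where "\<omega> = cis (2 * \<alpha>)"
  have pw: "\<omega> ^ n = cis (2 * n * \<alpha>)" for n by (simp only: \<omega>_def Complex.DeMoivre mult_ac)
  have 5: "\<omega> ^ 5 + 1 = cis (5 * \<alpha>) * of_real (2 * cos (5 * \<alpha>))"
    and 3: "\<omega> ^ 4 + \<omega> = cis (5 * \<alpha>) * of_real (2 * cos (3 * \<alpha>))"
  proof -
    have "of_real (2 * cos t) = cis t + cis (- t)" for t by (simp add: complex_eq_iff)
    note cos = this
    have "\<omega> ^ 5 = cis (10 * \<alpha>)" "\<omega> ^ 4 = cis (8 * \<alpha>)" "\<omega> = cis (2 * \<alpha>)"
      using pw[of 5] pw[of 4] pw[of 1] by simp_all
    moreover have "cis (10 * \<alpha>) + 1 = cis (5 * \<alpha>) * of_real (2 * cos (5 * \<alpha>))"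
      "cis (8 * \<alpha>) + cis (2 * \<alpha>) = cis (5 * \<alpha>) * of_real (2 * cos (3 * \<alpha>))"
      unfolding cos distrib_left cis_mult by simp_all
    ultimately show "\<omega> ^ 5 + 1 = cis (5 * \<alpha>) * of_real (2 * cos (5 * \<alpha>))"
      "\<omega> ^ 4 + \<omega> = cis (5 * \<alpha>) * of_real (2 * cos (3 * \<alpha>))" by metis+
  qed
  have "of_int b * (\<omega> ^ 5 + 1) = cis (5 * \<alpha>) * of_real (2 * (of_int b * cos (5 * \<alpha>)))"
    unfolding 5 by simp
  also have "\<dots> = of_int a * (\<omega> ^ 4 + \<omega>)" unfolding rel 3 by simp
  finally have root: "of_int b * (\<omega> ^ 5 + 1) = of_int a * (\<omega> ^ 4 + \<omega>)" .
  have "algebraic \<omega>"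
  proof (rule algebraicI)
    show "poly [:of_int b, - of_int a, 0, 0, - of_int a, of_int b:] \<omega> = 0"
      using root by (simp add: algebra_simps eval_nat_numeral)
    show "[:of_int b, - of_int a, 0, 0, - of_int a, of_int b:] \<noteq> (0 :: complex poly)" using b by simp
    show "coeff [:of_int b, - of_int a, 0, 0, - of_int a, of_int b:] i \<in> (\<int> :: complex set)" for i
      by (auto simp: coeff_pCons split: nat.splits)
  qed
  moreover have "\<omega> = exp (2 * pi * \<i> * (\<alpha> / pi))" by (simp add: \<omega>_def cis_conv_exp mult_ac)
  moreover have "\<not> algebraic (exp (2 * pi * \<i> * (\<alpha> / pi)))"
    using \<alpha> gelfond_schneider_unit_circle[of "\<alpha> / pi"] by simp
  ultimately show False by simp
qed

section \<open>Billiard motions from collision sequences\<close>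

text \<open>Used to turn flight lengths into collision times and cycle lengths into starting
  indices, over all integers; the subtracted sum in the witness serves the negative indices.\<close>

lemma int_antidifference:
  fixes f :: "int \<Rightarrow> 'a :: ab_group_add"
  shows "\<exists>F. F 0 = 0 \<and> (\<forall>n. F (n + 1) = F n + f n)"
proof -
  define F where "F = (\<lambda>n. sum f {0..<n} - sum f {n..<0})"
  have "F (n + 1) = F n + f n" for n
  proof (cases "n \<ge> 0")
    case True
    then have "{0..<n + 1} = insert n {0..<n}" by auto
    then show ?thesis using True by (simp add: F_def)
  next
    case False
    then have "{n..<0} = insert n {n + 1..<0}" by auto
    then show ?thesis using False by (simp add: F_def)
  qed
  moreover have "F 0 = 0" by (simp add: F_def)
  ultimately show ?thesis by blast
qed

lemma int_strict_monoI:
  fixes f :: "int \<Rightarrow> 'a :: order"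
  assumes "\<And>n. f n < f (n + 1)"
  shows "strict_mono f"
proof (rule strict_monoI)
  fix i j :: int assume "i < j"
  then show "f i < f j"
  proof (induction j rule: int_gr_induct)
    case base then show ?case by (rule assms)
  next
    case (step j) then show ?case using assms[of j] by (meson less_trans)
  qed
qed

lemma int_bracket:
  fixes f :: "int \<Rightarrow> 'a :: linorder"
  assumes "f a \<le> t" "t < f b" "strict_mono f"
  shows "\<exists>n. f n \<le> t \<and> t < f (n + 1)"
proof (rule ccontr)
  assume no: "\<not> ?thesis"
  have ab: "a \<le> b" using assms by (metis leD le_less_trans linorder_le_cases strict_mono_less_eq)
  have "f n \<le> t" if "n \<ge> a" for n
    using that
  proof (induction n rule: int_ge_induct)
    case base then show ?case using assms by simp
  next
    case (step n) then show ?case using no by (metis linorder_not_le)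
  qed
  then show False using ab assms(2) by (meson leD)
qed

lemma int_bracket_unique:
  fixes f :: "int \<Rightarrow> 'a :: linorder"
  assumes "strict_mono f" "f n \<le> t" "t < f (n + 1)" "f m \<le> t" "t < f (m + 1)"
  shows "n = m"
proof -
  have "n < m + 1" "m < n + 1"
    using assms by (meson le_less_trans strict_mono_less)+
  then show ?thesis by simp
qed

text \<open>Only \<open>W\<close> steps together are required to advance by \<open>\<delta>\<close>,
  because single flights can be arbitrarily short.\<close>

lemma int_seq_unbounded:
  fixes \<tau> :: "int \<Rightarrow> real"
  assumes mono: "strict_mono \<tau>" and W: "\<And>n. \<tau> n + \<delta> \<le> \<tau> (n + W)" and \<delta>: "\<delta> > 0"
  shows "filterlim \<tau> at_top at_top" "filterlim \<tau> at_bot at_bot"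
proof -
  have up: "\<tau> n + real j * \<delta> \<le> \<tau> (n + int j * W)" for n j
  proof (induction j)
    case (Suc j)
    then show ?case using W[of "n + int j * W"] by (simp add: algebra_simps)
  qed simp
  show "filterlim \<tau> at_top at_top"
    unfolding filterlim_at_top
  proof
    fix Z
    obtain j :: nat where j: "(Z - \<tau> 0) / \<delta> \<le> real j" using real_arch_simple by blast
    then have "Z \<le> \<tau> (int j * W)" using up[of 0 j] \<delta> by (simp add: field_simps)
    then show "eventually (\<lambda>n. Z \<le> \<tau> n) at_top"
      using mono unfolding eventually_at_top_linorder by (meson order_trans strict_mono_less_eq)
  qed
  show "filterlim \<tau> at_bot at_bot"
    unfolding filterlim_at_bot
  proof
    fix Z
    obtain j :: nat where j: "(\<tau> 0 - Z) / \<delta> \<le> real j" using real_arch_simple by blast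
    then have "\<tau> (- int j * W) \<le> Z" using up[of "- int j * W" j] \<delta> by (simp add: field_simps)
    then show "eventually (\<lambda>n. \<tau> n \<le> Z) at_bot"
      using mono unfolding eventually_at_bot_linorder by (meson order_trans strict_mono_less_eq)
  qed
qed

text \<open>Glues orbit pieces, one for each integer, into a two-sided sequence in which piece
  \<open>k\<close> starts at the index \<open>N k\<close>. The clauses on the neighbours of
  \<open>N k\<close> allow the flights around a return to the base to be measured.\<close>

lemma cycles_to_sequence:
  fixes cyc :: "int \<Rightarrow> 'a list"
  assumes ne: "\<And>k. cyc k \<noteq> []" and len: "\<And>k. length (cyc k) \<le> W"
    and succ: "\<And>k. successively R (cyc k @ [hd (cyc (k + 1))])"
  shows "\<exists>(x :: int \<Rightarrow> 'a) (N :: int \<Rightarrow> int).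
     (\<forall>n. R (x n) (x (n + 1))) \<and> (\<forall>n. \<exists>k. x n \<in> set (cyc k)) \<and>
     (\<forall>k. x (N k) = hd (cyc k)) \<and> (\<forall>k. x (N k - 1) = last (cyc (k - 1))) \<and>
     (\<forall>k. x (N k + 1) = (cyc k @ [hd (cyc (k + 1))]) ! 1) \<and>
     (\<forall>n. \<exists>k. n < N k \<and> N k \<le> n + int W)"
proof -
  define L where "L = (\<lambda>k. int (length (cyc k)))"
  have L: "L k \<ge> 1" "L k \<le> W" for k using ne[of k] len[of k] by (cases "cyc k"; auto simp: L_def)+
  obtain N :: "int \<Rightarrow> int" where N: "N 0 = 0" "\<And>k. N (k + 1) = N k + L k"
    using int_antidifference[of L] by blast
  have "0 < L k" for k using L(1)[of k] by linarith
  then have mono: "strict_mono N" by (intro int_strict_monoI) (simp add: N)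
  have ex: "\<exists>k. N k \<le> n \<and> n < N (k + 1)" for n
  proof (induction n rule: int_induct[of _ 0])
    case base
    show ?case using N(2)[of 0] L(1)[of 0] by (intro exI[of _ 0]) (simp add: N(1))
  next
    case (step1 i)
    then obtain k where "N k \<le> i" "i < N (k + 1)" by blast
    then show ?case using N(2)[of "k + 1"] L(1)[of "k + 1"]
      by (cases "i + 1 < N (k + 1)") (force intro: exI[of _ k], force intro: exI[of _ "k + 1"])
  next
    case (step2 i)
    then obtain k where "N k \<le> i" "i < N (k + 1)" by blast
    then show ?case using N(2)[of "k - 1"] L(1)[of "k - 1"]
      by (cases "N k \<le> i - 1") (force intro: exI[of _ k], force intro: exI[of _ "k - 1"])
  qed
  define K where "K = (\<lambda>n. SOME k. N k \<le> n \<and> n < N (k + 1))"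
  have K: "N (K n) \<le> n" "n < N (K n + 1)" for n using someI_ex[OF ex[of n]] unfolding K_def by auto
  define x where "x = (\<lambda>n. cyc (K n) ! nat (n - N (K n)))"
  have xNj: "x (N k + int j) = cyc k ! j" if "j < length (cyc k)" for k j
  proof -
    have "N k \<le> N k + int j" "N k + int j < N (k + 1)" using that N(2)[of k] by (auto simp: L_def)
    then have "K (N k + int j) = k" using int_bracket_unique[OF mono K] by blast
    then show ?thesis by (simp add: x_def)
  qed
  have xN: "x (N k) = hd (cyc k)" for k
    using xNj[of 0 k] ne[of k] by (simp add: hd_conv_nth)
  have xl: "x (N k - 1) = last (cyc (k - 1))" for k
  proof -
    have "N k - 1 = N (k - 1) + int (length (cyc (k - 1)) - 1)"
      using N(2)[of "k - 1"] L(1)[of "k - 1"] by (simp add: L_def of_nat_diff)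
    then show ?thesis using xNj[of "length (cyc (k - 1)) - 1" "k - 1"] ne[of "k - 1"] by (simp add: last_conv_nth)
  qed
  have next_x: "x (N k + int j + 1) = (cyc k @ [hd (cyc (k + 1))]) ! Suc j" if "j < length (cyc k)" for k j
  proof (cases "Suc j < length (cyc k)")
    case True
    then show ?thesis using xNj[of "Suc j" k] by (simp add: nth_append add_ac)
  next
    case False
    then have j: "Suc j = length (cyc k)" using that by simp
    then have "N k + int j + 1 = N (k + 1)" using N(2)[of k] unfolding L_def by simp
    then show ?thesis using xN[of "k + 1"] j by (simp add: nth_append)
  qed
  have index: "\<exists>k j. n = N k + int j \<and> j < length (cyc k)" for n
    using K[of n] N(2)[of "K n"]
    by (intro exI[of _ "K n"] exI[of _ "nat (n - N (K n))"]) (auto simp: L_def)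
  have "R (x n) (x (n + 1))" for n
  proof -
    obtain k j where n: "n = N k + int j" "j < length (cyc k)" using index by blast
    have "R ((cyc k @ [hd (cyc (k + 1))]) ! j) ((cyc k @ [hd (cyc (k + 1))]) ! Suc j)"
      using succ[of k] n(2) unfolding successively_conv_nth by simp
    then show ?thesis using n xNj[of j k] next_x[of j k] by (simp add: nth_append)
  qed
  moreover have "\<exists>k. x n \<in> set (cyc k)" for n
    using index[of n] xNj by (metis nth_mem)
  moreover have "x (N k + 1) = (cyc k @ [hd (cyc (k + 1))]) ! 1" for k
    using next_x[of 0 k] ne[of k] by simp
  moreover have "\<exists>k. n < N k \<and> N k \<le> n + int W" for n
    using K[of n] N(2)[of "K n"] L(2)[of "K n"] by (intro exI[of _ "K n + 1"]) auto
  ultimately show ?thesis using xN xl by blast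
qed

section \<open>Collision data and flights inside a triangle\<close>

definition sides :: "complex \<Rightarrow> complex \<Rightarrow> complex \<Rightarrow> (complex \<times> complex) set" where
  "sides A B C = {(A, B), (B, C), (C, A)}"

text \<open>A collision is recorded by the end points of the side, the position and the outgoing velocity.\<close>

type_synonym collision = "complex \<times> complex \<times> complex \<times> complex"

definition position :: "collision \<Rightarrow> complex" where
  "position = (\<lambda>(P, Q, p, v). p)"

definition collision_at :: "complex \<Rightarrow> complex \<Rightarrow> complex \<Rightarrow> collision \<Rightarrow> bool" where
  "collision_at A B C = (\<lambda>(P, Q, p, v). (P, Q) \<in> sides A B C \<and> p \<in> open_segment P Q \<and> norm v = 1)"

text \<open>The points between the two collisions are not mentioned: by
  \<open>sides_open_segment_interior\<close>, collisions on different sides already force them into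
  the interior.\<close>

definition flight :: "collision \<Rightarrow> collision \<Rightarrow> bool" where
  "flight = (\<lambda>(P, Q, p, v) (P', Q', p', v'). (P, Q) \<noteq> (P', Q') \<and> p \<noteq> p' \<and>
     p' - p = norm (p' - p) *\<^sub>R v \<and> v' = reflect (Q' - P') v)"

text \<open>In barycentric coordinates all three weights of a point strictly between
  \<open>p\<close> and \<open>p'\<close> are positive.\<close>

lemma open_segment_subset_interior_triangle:
  fixes P Q R :: complex
  assumes "\<not> collinear {P, Q, R}" "p \<in> open_segment P Q" "p' \<in> open_segment Q R"
  shows "open_segment p p' \<subseteq> interior (convex hull {P, Q, R})"
proof
  fix z assume "z \<in> open_segment p p'"
  then obtain a where a: "0 < a" "a < 1" "z = (1 - a) *\<^sub>R p + a *\<^sub>R p'" by (auto simp: in_segment)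
  obtain b where b: "0 < b" "b < 1" "p = (1 - b) *\<^sub>R P + b *\<^sub>R Q" using assms(2) by (auto simp: in_segment)
  obtain c where c: "0 < c" "c < 1" "p' = (1 - c) *\<^sub>R Q + c *\<^sub>R R" using assms(3) by (auto simp: in_segment)
  have "z = ((1 - a) * (1 - b)) *\<^sub>R P + ((1 - a) * b + a * (1 - c)) *\<^sub>R Q + (a * c) *\<^sub>R R"
    unfolding a b c by (simp add: algebra_simps)
  moreover have "(1 - a) * (1 - b) > 0" "(1 - a) * b + a * (1 - c) > 0" "a * c > 0"
    using a b c by (auto intro: add_pos_pos)
  moreover have "(1 - a) * (1 - b) + ((1 - a) * b + a * (1 - c)) + a * c = 1" by (simp add: algebra_simps)
  ultimately show "z \<in> interior (convex hull {P, Q, R})"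
    using interior_convex_hull_3_minimal[OF assms(1)] by auto
qed

lemma sides_open_segment_interior:
  assumes nc: "\<not> collinear {A, B, C}" and "(P, Q) \<in> sides A B C" "(P', Q') \<in> sides A B C" "(P, Q) \<noteq> (P', Q')"
    and "p \<in> open_segment P Q" "p' \<in> open_segment P' Q'"
  shows "open_segment p p' \<subseteq> interior (convex hull {A, B, C})"
proof -
  have 1: "open_segment p p' \<subseteq> interior (convex hull {A, B, C})" if "p \<in> open_segment A B" "p' \<in> open_segment B C" for p p'
    using open_segment_subset_interior_triangle[OF nc that] .
  have 2: "open_segment p p' \<subseteq> interior (convex hull {A, B, C})" if "p \<in> open_segment B C" "p' \<in> open_segment C A" for p p'
    using open_segment_subset_interior_triangle[of B C A p p'] nc that by (simp add: insert_commute)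
  have 3: "open_segment p p' \<subseteq> interior (convex hull {A, B, C})" if "p \<in> open_segment C A" "p' \<in> open_segment A B" for p p'
    using open_segment_subset_interior_triangle[of C A B p p'] nc that by (simp add: insert_commute)
  show ?thesis using assms 1[of p p'] 2[of p p'] 3[of p p'] 1[of p' p] 2[of p' p] 3[of p' p]
    unfolding sides_def by (auto simp: open_segment_commute[of p' p])
qed

lemma side_not_interior:
  fixes p :: complex
  assumes "(P, Q) \<in> sides A B C" "p \<in> open_segment P Q"
  shows "p \<notin> interior (convex hull {A, B, C})"
proof -
  have "p \<in> closed_segment P Q" using assms(2) by (rule subsetD[OF segment_open_subset_closed])
  then have "p \<in> frontier (convex hull {A, B, C})"
    using assms(1) by (subst frontier_of_triangle) (auto simp: sides_def)
  then show ?thesis by (simp add: frontier_def)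
qed

text \<open>Time is accumulated flight length. A periodic motion would meet all collision points
  within one period, at collision times, of which a bounded interval contains only finitely many;
  this contradicts \<open>inf\<close>. Density fails because a disc about \<open>C\<close> is
  missed.\<close>

lemma billiard_of_collisions:
  fixes x :: "int \<Rightarrow> collision"
  assumes nc: "\<not> collinear {A, B, C}"
    and coll: "\<And>n. collision_at A B C (x n)" and fl: "\<And>n. flight (x n) (x (n + 1))"
    and \<delta>: "\<delta> > 0" "\<And>n. \<exists>m\<in>{n<..n + W}. \<delta> \<le> dist (position (x (m - 1))) (position (x m)) + dist (position (x m)) (position (x (m + 1)))"
    and inf: "infinite (range (position \<circ> x))"
    and \<epsilon>: "\<epsilon> > 0" "\<And>n z. z \<in> closed_segment (position (x n)) (position (x (n + 1))) \<Longrightarrow> \<epsilon> \<le> dist C z"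
  shows "has_nonperiodic_nondense_trajectory A B C"
proof -
  define P Q p v where "P = (\<lambda>n. fst (x n))" and "Q = (\<lambda>n. fst (snd (x n)))" and "p = (\<lambda>n. fst (snd (snd (x n))))"
    and "v = (\<lambda>n. snd (snd (snd (x n))))"
  have x: "x n = (P n, Q n, p n, v n)" for n by (simp add: P_def Q_def p_def v_def)
  have pos: "position (x n) = p n" for n by (simp add: x position_def)
  have side: "(P n, Q n) \<in> sides A B C" "p n \<in> open_segment (P n) (Q n)" "norm (v n) = 1" for n
    using coll[of n] by (auto simp: x collision_at_def)
  define l where "l = (\<lambda>n. norm (p (n + 1) - p n))"
  have step: "(P n, Q n) \<noteq> (P (n + 1), Q (n + 1))" "l n > 0" "p (n + 1) = p n + l n *\<^sub>R v n"
     "v (n + 1) = reflect (Q (n + 1) - P (n + 1)) (v n)" for n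
    using fl[of n] by (auto simp: x flight_def l_def algebra_simps)
  obtain \<tau> where \<tau>: "\<And>n. \<tau> (n + 1) = \<tau> n + l n" using int_antidifference[of l] by blast
  have mono: "strict_mono \<tau>" by (rule int_strict_monoI) (use \<tau> step(2) in auto)
  \<comment> \<open>The window is longer by one step because the second of the two flights ends at
    the collision \<open>m + 1\<close>.\<close>
  have "\<tau> n + \<delta> \<le> \<tau> (n + (W + 1))" for n
  proof -
    obtain m where m: "n < m" "m \<le> n + W" "\<delta> \<le> l (m - 1) + l m"
      using \<delta>(2)[of n] by (force simp: pos l_def dist_norm norm_minus_commute)
    have "\<tau> n \<le> \<tau> (m - 1)" "\<tau> (m + 1) \<le> \<tau> (n + (W + 1))" using mono m by (auto simp: strict_mono_less_eq)
    moreover have "\<tau> (m + 1) = \<tau> (m - 1) + l (m - 1) + l m" using \<tau>[of m] \<tau>[of "m - 1"] by simp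
    ultimately show ?thesis using m(3) by simp
  qed
  note lims = int_seq_unbounded[OF mono this \<delta>(1)]
  have ex: "\<exists>n. \<tau> n \<le> t \<and> t < \<tau> (n + 1)" for t
  proof -
    have "eventually (\<lambda>n. \<tau> n \<le> t) at_bot" using lims(2) by (simp add: filterlim_at_bot)
    then obtain a where "\<tau> a \<le> t" by (auto simp: eventually_at_bot_linorder)
    moreover have "eventually (\<lambda>n. \<tau> n \<ge> t + 1) at_top" using lims(1) by (simp add: filterlim_at_top)
    then obtain b where "\<tau> b \<ge> t + 1" by (auto simp: eventually_at_top_linorder)
    ultimately show ?thesis using int_bracket[of \<tau> a t b] mono by auto
  qed
  define K where "K = (\<lambda>t. SOME n. \<tau> n \<le> t \<and> t < \<tau> (n + 1))"
  have K: "\<tau> (K t) \<le> t" "t < \<tau> (K t + 1)" for t using someI_ex[OF ex[of t]] unfolding K_def by auto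
  define \<gamma> where "\<gamma> = (\<lambda>t. p (K t) + (t - \<tau> (K t)) *\<^sub>R v (K t))"
  have \<gamma>_lt: "\<gamma> t = p n + (t - \<tau> n) *\<^sub>R v n" if "\<tau> n \<le> t" "t < \<tau> (n + 1)" for n t
    using int_bracket_unique[OF mono K that] by (simp add: \<gamma>_def)
  have \<gamma>_\<tau>: "\<gamma> (\<tau> n) = p n" for n using \<gamma>_lt[of n "\<tau> n"] mono by (simp add: strict_mono_less)
  have \<gamma>: "\<gamma> t = p n + (t - \<tau> n) *\<^sub>R v n" if "t \<in> {\<tau> n..\<tau> (n + 1)}" for n t
    using that \<gamma>_lt[of n t] \<gamma>_\<tau>[of "n + 1"] step(3)[of n] \<tau>[of n] by (cases "t = \<tau> (n + 1)") auto
  have \<gamma>_seg: "\<gamma> t \<in> closed_segment (p n) (p (n + 1))" if "t \<in> {\<tau> n..\<tau> (n + 1)}" for n t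
  proof -
    have "t - \<tau> n = (t - \<tau> n) / l n * l n" using step(2)[of n] by simp
    then have "\<gamma> t = p n + ((t - \<tau> n) / l n) *\<^sub>R (l n *\<^sub>R v n)"
      unfolding \<gamma>[OF that] scaleR_scaleR by simp
    also have "l n *\<^sub>R v n = p (n + 1) - p n" using step(3)[of n] by simp
    finally have "\<gamma> t = (1 - (t - \<tau> n) / l n) *\<^sub>R p n + ((t - \<tau> n) / l n) *\<^sub>R p (n + 1)"
      by (simp add: algebra_simps)
    then show ?thesis using that step(2)[of n] \<tau>[of n]
      unfolding in_segment by (intro exI[of _ "(t - \<tau> n) / l n"]) auto
  qed
  have \<gamma>_int: "\<gamma> t \<in> interior (convex hull {A, B, C})" if "t \<in> {\<tau> n<..<\<tau> (n + 1)}" for n t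
  proof -
    have ne: "\<gamma> t \<noteq> p n" "\<gamma> t \<noteq> p (n + 1)"
      using \<gamma>[of t n] that step(3)[of n] \<tau>[of n] side(3)[of n] by auto
    have "\<gamma> t \<in> open_segment (p n) (p (n + 1))"
      unfolding open_segment_def using \<gamma>_seg[of t n] that ne by auto
    then show ?thesis
      using sides_open_segment_interior[OF nc side(1)[of n] side(1)[of "n + 1"] step(1) side(2)[of n] side(2)[of "n + 1"]] by blast
  qed
  have "billiard_motion A B C \<gamma>"
    unfolding billiard_motion_def
  proof (intro exI[of _ \<tau>] exI[of _ v] conjI allI ballI mono lims side(3))
    show "\<gamma> t = \<gamma> (\<tau> n) + (t - \<tau> n) *\<^sub>R v n" if "t \<in> {\<tau> n..\<tau> (n + 1)}" for n t
      using \<gamma>[OF that] \<gamma>_\<tau> by simp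
    show "\<gamma> t \<in> interior (convex hull {A, B, C})" if "t \<in> {\<tau> n<..<\<tau> (n + 1)}" for n t
      using \<gamma>_int[OF that] .
    show "\<exists>(P, Q)\<in>{(A, B), (B, C), (C, A)}. \<gamma> (\<tau> n) \<in> open_segment P Q \<and> v n = reflect (Q - P) (v (n - 1))" for n
      using side(1,2)[of n] step(4)[of "n - 1"] unfolding \<gamma>_\<tau> sides_def by (intro bexI[of _ "(P n, Q n)"]) auto
  qed
  moreover have "\<not> periodic_motion \<gamma>"
  proof
    assume "periodic_motion \<gamma>"
    then obtain T where T: "T > 0" "\<And>t. \<gamma> (t + T) = \<gamma> t" by (auto simp: periodic_motion_def)
    have shift: "\<gamma> (t + of_int k * T) = \<gamma> t" for k :: int and t
    proof (induction k rule: int_induct[of _ 0])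
      case (step1 i)
      then show ?case using T(2)[of "t + of_int i * T"] by (simp add: algebra_simps)
    next
      case (step2 i)
      then show ?case using T(2)[of "t + of_int (i - 1) * T"] by (simp add: algebra_simps)
    qed simp
    obtain a where a: "\<tau> a \<le> 0" using ex[of 0] by auto
    obtain b where b: "T < \<tau> b" using ex[of T] by auto
    have "range p \<subseteq> p ` {a..b}"
    proof
      fix z assume "z \<in> range p"
      then obtain n where z: "z = p n" by auto
      define t where "t = \<tau> n + of_int (- \<lfloor>\<tau> n / T\<rfloor>) * T"
      have t: "0 \<le> t" "t \<le> T"
      proof -
        have "of_int \<lfloor>\<tau> n / T\<rfloor> * T \<le> \<tau> n / T * T" "\<tau> n / T * T \<le> (of_int \<lfloor>\<tau> n / T\<rfloor> + 1) * T"
          using T(1) by (intro mult_right_mono; linarith)+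
        then have "of_int \<lfloor>\<tau> n / T\<rfloor> * T \<le> \<tau> n" "\<tau> n \<le> of_int \<lfloor>\<tau> n / T\<rfloor> * T + T"
          using T(1) by (simp_all add: distrib_right)
        then show "0 \<le> t" "t \<le> T" by (auto simp: t_def)
      qed
      have \<gamma>t: "\<gamma> t = z" unfolding t_def shift \<gamma>_\<tau> z ..
      \<comment> \<open>Strictly between collisions the motion is in the interior, whereas
        \<open>z\<close> lies on a side.\<close>
      have "t = \<tau> (K t)"
      proof (rule ccontr)
        assume "t \<noteq> \<tau> (K t)"
        then have "t \<in> {\<tau> (K t)<..<\<tau> (K t + 1)}" using K[of t] by auto
        then have "p n \<in> interior (convex hull {A, B, C})" using \<gamma>_int[of t "K t"] \<gamma>t z by simp
        then show False using side_not_interior[OF side(1,2)] by blast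
      qed
      then have "z = p (K t)" "\<tau> a \<le> \<tau> (K t)" "\<tau> (K t) \<le> \<tau> b" using \<gamma>t \<gamma>_\<tau>[of "K t"] t a b by auto
      then show "z \<in> p ` {a..b}" using mono by (auto simp: strict_mono_less_eq)
    qed
    then have "finite (range p)" by (rule finite_subset) simp
    then show False using inf by (simp add: comp_def pos)
  qed
  moreover have "\<not> everywhere_dense_in (trajectory \<gamma>) (convex hull {A, B, C})"
  proof
    assume "everywhere_dense_in (trajectory \<gamma>) (convex hull {A, B, C})"
    then have "C \<in> closure (range \<gamma>)"
      unfolding everywhere_dense_in_def trajectory_def by (auto intro: hull_inc subsetD)
    then obtain z where "z \<in> range \<gamma>" "dist z C < \<epsilon>" using \<epsilon>(1) unfolding closure_approachable by blast
    then obtain t where t: "dist (\<gamma> t) C < \<epsilon>" by auto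
    have "\<gamma> t \<in> closed_segment (p (K t)) (p (K t + 1))" by (rule \<gamma>_seg) (use K[of t] in auto)
    then have "\<epsilon> \<le> dist C (\<gamma> t)" using \<epsilon>(2)[of "\<gamma> t" "K t"] by (simp add: pos)
    then show False using t by (simp add: dist_commute)
  qed
  ultimately show ?thesis unfolding has_nonperiodic_nondense_trajectory_def by blast
qed

section \<open>The return map to the base\<close>

lemma reflect_cis:
  assumes "r \<noteq> 0"
  shows "reflect (of_real r * cis \<theta>) (cis \<psi>) = cis (2 * \<theta> - \<psi>)"
proof -
  have d: "(of_real r * cis \<theta>) \<bullet> (of_real r * cis \<theta>) = r\<^sup>2"
    by (simp add: inner_complex_def power2_eq_square algebra_simps flip: distrib_left power2_eq_square)
  have v: "cis \<psi> \<bullet> (of_real r * cis \<theta>) = r * cos (\<psi> - \<theta>)"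
    by (simp add: inner_complex_def cos_diff algebra_simps)
  have "reflect (of_real r * cis \<theta>) (cis \<psi>) = of_real (2 * cos (\<psi> - \<theta>)) * cis \<theta> - cis \<psi>"
    unfolding reflect_def d v using assms by (simp add: scaleR_conv_of_real power2_eq_square)
  also have "of_real (2 * cos (\<psi> - \<theta>)) = cis (\<psi> - \<theta>) + cis (\<theta> - \<psi>)"
    by (simp add: complex_eq_iff cos_diff sin_diff)
  also have "(cis (\<psi> - \<theta>) + cis (\<theta> - \<psi>)) * cis \<theta> - cis \<psi> = cis (2 * \<theta> - \<psi>)"
    by (simp add: distrib_right cis_mult)
  finally show ?thesis .
qed

lemma flightI:
  assumes "(P, Q) \<noteq> (P', Q')" "l > 0" "p' - p = of_real l * cis \<psi>" "v' = reflect (Q' - P') (cis \<psi>)"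
  shows "flight (P, Q, p, cis \<psi>) (P', Q', p', v')"
proof -
  have "norm (p' - p) = l" unfolding assms(3) using assms(2) by (simp add: norm_mult)
  moreover have "p \<noteq> p'" using assms(2,3) by auto
  ultimately show ?thesis using assms by (simp add: flight_def scaleR_conv_of_real)
qed

text \<open>The last assumption is how \<open>\<alpha>\<close> exceeding \<open>alpha_star\<close>
  enters the sign computations; \<open>above_alpha_star\<close> provides it.\<close>

locale isosceles_billiard =
  fixes \<alpha> :: real
  assumes \<alpha>_gt: "pi / 4 < \<alpha>" and \<alpha>_lt: "\<alpha> < 3 * pi / 10"
    and \<alpha>_star: "sin (7 * \<alpha>) - sin (3 * \<alpha>) + sin \<alpha> > 0"
begin

definition A where "A = - complex_of_real (cos \<alpha>)"
definition B where "B = complex_of_real (cos \<alpha>)"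
definition C where "C = \<i> * complex_of_real (sin \<alpha>)"

text \<open>The angle \<open>\<phi>\<close> is chosen such that \<open>\<sigma> 2 - \<sigma> 0 = \<sigma> 6\<close>, which makes the two branches of the
  return map fit together to a rotation.\<close>

definition \<phi> where "\<phi> = Arg (Complex (1 + cos (6 * \<alpha>) - cos (2 * \<alpha>)) (sin (2 * \<alpha>) - sin (6 * \<alpha>)))"

text \<open>Sines of the directions of the orbit. Changing \<open>j\<close> by 1 passes from the
  angle with the base to the angle with a leg, as the legs have slope angles alpha and
  -alpha.\<close>

definition \<sigma> :: "real \<Rightarrow> real" where "\<sigma> j = sin (j * \<alpha> + \<phi>)"

lemma trig_signs:
  "cos \<alpha> > 0" "sin \<alpha> > 0" "sin (2 * \<alpha>) > 0" "sin (3 * \<alpha>) > 0" "sin (4 * \<alpha>) < 0"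
  "sin (5 * \<alpha>) < 0" "sin (6 * \<alpha>) < 0" "cos (5 * \<alpha>) < 0" "cos (2 * \<alpha>) < 1"
proof -
  have pi: "pi > 0" by simp
  show "cos \<alpha> > 0" "sin \<alpha> > 0" using \<alpha>_gt \<alpha>_lt pi by (intro cos_gt_zero sin_gt_zero; linarith)+
  show "sin (2 * \<alpha>) > 0" "sin (3 * \<alpha>) > 0" using \<alpha>_gt \<alpha>_lt pi by (intro sin_gt_zero; linarith)+
  show "sin (4 * \<alpha>) < 0" "sin (5 * \<alpha>) < 0" "sin (6 * \<alpha>) < 0" using \<alpha>_gt \<alpha>_lt pi by (intro sin_lt_zero; linarith)+
  have "cos (5 * \<alpha> - pi) > 0" using \<alpha>_gt \<alpha>_lt pi by (intro cos_gt_zero; linarith)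
  then show "cos (5 * \<alpha>) < 0" by (simp add: cos_diff)
  have "cos (2 * \<alpha>) < cos 0" using \<alpha>_gt \<alpha>_lt pi by (intro cos_monotone_0_pi) linarith+
  then show "cos (2 * \<alpha>) < 1" by simp
qed

text \<open>Removes \<open>Arg\<close>: up to the norm of the complex number that defines phi, each
  \<open>\<sigma> j\<close> is a sum of sines of multiples of alpha.\<close>

lemma \<sigma>_scaled:
  obtains N where "N > 0"
    "\<And>j. N * \<sigma> j = sin (j * \<alpha>) + sin ((j - 6) * \<alpha>) - sin ((j - 2) * \<alpha>)"
proof -
  define X where "X = 1 + cos (6 * \<alpha>) - cos (2 * \<alpha>)"
  define Y where "Y = sin (2 * \<alpha>) - sin (6 * \<alpha>)"
  define N where "N = norm (Complex X Y)"
  have "Y > 0" using trig_signs by (simp add: Y_def)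
  then have N: "N > 0" by (auto simp: N_def complex_eq_iff)
  have "of_real N * cis \<phi> = Complex X Y"
    using rcis_cmod_Arg[of "Complex X Y"] unfolding rcis_def N_def \<phi>_def X_def Y_def .
  then have "N * cos \<phi> = X" "N * sin \<phi> = Y" by (auto simp: complex_eq_iff)
  then have "N * \<sigma> j = sin (j * \<alpha>) * X + cos (j * \<alpha>) * Y" for j
    by (metis \<sigma>_def sin_add distrib_left mult.left_commute)
  moreover have "sin (j * \<alpha>) * X + cos (j * \<alpha>) * Y = sin (j * \<alpha>) + sin ((j - 6) * \<alpha>) - sin ((j - 2) * \<alpha>)" for j
    unfolding X_def Y_def left_diff_distrib sin_diff by (simp add: algebra_simps)
  ultimately show ?thesis using that N by simp
qed

lemma \<sigma>_rec: "2 * cos \<alpha> * \<sigma> j = \<sigma> (j + 1) + \<sigma> (j - 1)"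
  unfolding \<sigma>_def distrib_right left_diff_distrib
  by (simp add: sin_add sin_diff cos_add cos_diff algebra_simps)

text \<open>After scaling by the positive \<open>N\<close> every claim concerns sines of multiples
  of alpha, whose signs are known on the interval. The two inequalities with
  \<open>2 * cos \<alpha>\<close> become \<open>\<sigma> (-1) < 0\<close> and
  \<open>\<sigma> 7 > 0\<close> by the recurrence; both use \<open>\<alpha>_star\<close>.\<close>

lemma \<sigma>_signs:
  "\<sigma> 0 > 0" "\<sigma> 1 > 0" "\<sigma> 2 > 0" "\<sigma> 3 < 0" "\<sigma> 4 < 0" "\<sigma> 5 < 0" "\<sigma> 6 < 0" "\<sigma> 4 < \<sigma> 6"
  "2 * cos \<alpha> * \<sigma> 0 < \<sigma> 1" "\<sigma> 5 < 2 * cos \<alpha> * \<sigma> 6" and \<sigma>_26: "\<sigma> 2 - \<sigma> 0 = \<sigma> 6"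
proof -
  obtain N where N: "N > 0" "\<And>j. N * \<sigma> j = sin (j * \<alpha>) + sin ((j - 6) * \<alpha>) - sin ((j - 2) * \<alpha>)"
    using \<sigma>_scaled by blast
  have pos: "\<sigma> j > 0 \<longleftrightarrow> N * \<sigma> j > 0" and neg: "\<sigma> j < 0 \<longleftrightarrow> N * \<sigma> j < 0"
    and less: "\<sigma> j < \<sigma> k \<longleftrightarrow> N * \<sigma> j < N * \<sigma> k" for j k
    using N(1) by (simp_all add: zero_less_mult_iff mult_less_0_iff)
  note t = trig_signs
  show "\<sigma> 0 > 0" "\<sigma> 1 > 0" "\<sigma> 2 > 0" "\<sigma> 3 < 0" "\<sigma> 4 < 0" "\<sigma> 5 < 0"
    unfolding pos neg N(2) using t by simp_all
  have "sin (6 * \<alpha>) - sin (4 * \<alpha>) = 2 * sin \<alpha> * cos (5 * \<alpha>)"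
    using sin_diff_sin[of "6 * \<alpha>" "4 * \<alpha>"] by (simp add: algebra_simps)
  moreover have "2 * sin \<alpha> * cos (5 * \<alpha>) < 0" using t by (intro mult_pos_neg) auto
  ultimately show "\<sigma> 6 < 0" unfolding neg N(2) by simp
  have "sin (6 * \<alpha>) + sin (2 * \<alpha>) = 2 * sin (4 * \<alpha>) * cos (2 * \<alpha>)"
    using sin_plus_sin[of "6 * \<alpha>" "2 * \<alpha>"] by (simp add: algebra_simps)
  moreover have "sin (4 * \<alpha>) * 1 < sin (4 * \<alpha>) * cos (2 * \<alpha>)" using t by (intro mult_strict_left_mono_neg) auto
  moreover have "N * \<sigma> 4 = sin (4 * \<alpha>) - 2 * sin (2 * \<alpha>)" "N * \<sigma> 6 = sin (6 * \<alpha>) - sin (4 * \<alpha>)"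
    unfolding N(2) by simp_all
  ultimately show "\<sigma> 4 < \<sigma> 6" unfolding less using t(3) by linarith
  \<comment> \<open>\<open>2 cos \<alpha> \<sigma> 0 < \<sigma> 1\<close> means \<open>\<phi> < \<alpha>\<close> and is equivalent to \<open>\<alpha>\<close> exceeding the threshold\<close>
  have "\<sigma> (-1) < 0" unfolding neg N(2) using \<alpha>_star by simp
  then show "2 * cos \<alpha> * \<sigma> 0 < \<sigma> 1" using \<sigma>_rec[of 0] by simp
  have "\<sigma> 7 > 0" unfolding pos N(2) using \<alpha>_star t by simp
  then show "\<sigma> 5 < 2 * cos \<alpha> * \<sigma> 6" using \<sigma>_rec[of 6] by simp
  have "N * \<sigma> 2 - N * \<sigma> 0 = N * \<sigma> 6" unfolding N(2) by simp
  then show "\<sigma> 2 - \<sigma> 0 = \<sigma> 6" using N(1) by (simp flip: right_diff_distrib)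
qed

text \<open>On the base of length \<open>2 cos \<alpha>\<close> the return map is \<open>d \<mapsto> d - 2 \<rho> cos \<alpha>\<close> modulo \<open>2 cos \<alpha>\<close>.\<close>

definition \<rho> where "\<rho> = \<sigma> 2 / \<sigma> 0"

lemma \<rho>_bounds: "0 < \<rho>" "\<rho> < 1"
  using \<sigma>_signs \<sigma>_26 by (auto simp: \<rho>_def)

text \<open>Sum-to-product formulas give 1 / rho = 1 + cos(5 alpha) / cos(3 alpha).\<close>

lemma \<rho>_irrational:
  assumes "cos (5 * \<alpha>) / cos (3 * \<alpha>) \<notin> \<rat>"
  shows "\<rho> \<notin> \<rat>"
proof
  assume \<rho>: "\<rho> \<in> \<rat>"
  obtain N where N: "N > 0" "\<And>j. N * \<sigma> j = sin (j * \<alpha>) + sin ((j - 6) * \<alpha>) - sin ((j - 2) * \<alpha>)"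
    using \<sigma>_scaled by blast
  have c: "cos (3 * \<alpha>) \<noteq> 0" using assms by auto
  have "sin (2 * \<alpha>) - sin (4 * \<alpha>) = - 2 * sin \<alpha> * cos (3 * \<alpha>)"
    using sin_diff_sin[of "2 * \<alpha>" "4 * \<alpha>"] by (simp add: algebra_simps)
  then have N2: "N * \<sigma> 2 = - 2 * sin \<alpha> * cos (3 * \<alpha>)" unfolding N(2) by simp
  have "sin (2 * \<alpha>) - sin (6 * \<alpha>) = - 2 * sin (2 * \<alpha>) * cos (4 * \<alpha>)"
    using sin_diff_sin[of "2 * \<alpha>" "6 * \<alpha>"] by (simp add: algebra_simps)
  moreover have "cos (3 * \<alpha>) + cos (5 * \<alpha>) = 2 * cos (4 * \<alpha>) * cos \<alpha>"
    using cos_plus_cos[of "5 * \<alpha>" "3 * \<alpha>"] by (simp add: algebra_simps)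
  ultimately have N0: "N * \<sigma> 0 = - 2 * sin \<alpha> * (cos (3 * \<alpha>) + cos (5 * \<alpha>))"
    unfolding N(2) by (simp add: sin_double)
  have "1 / \<rho> = (N * \<sigma> 0) / (N * \<sigma> 2)" using N(1) by (simp add: \<rho>_def)
  also have "\<dots> = 1 + cos (5 * \<alpha>) / cos (3 * \<alpha>)"
    unfolding N0 N2 using c trig_signs by (simp add: field_simps)
  finally have "cos (5 * \<alpha>) / cos (3 * \<alpha>) = 1 / \<rho> - 1" by simp
  also have "\<dots> \<in> \<rat>" using \<rho> by simp
  finally show False using assms by simp
qed

text \<open>Collisions with the three sides, with outgoing direction \<open>\<psi>\<close>: \<open>d\<close> is the distance from \<open>B\<close>
  on the base, \<open>t\<close> the distance from \<open>B\<close> on the right leg and from \<open>A\<close> on the left leg (the legs have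
  length 1).\<close>

definition base :: "real \<Rightarrow> real \<Rightarrow> collision" where
  "base d \<psi> = (A, B, complex_of_real (cos \<alpha> - d), cis \<psi>)"

definition right :: "real \<Rightarrow> real \<Rightarrow> collision" where
  "right t \<psi> = (B, C, B - of_real t * cis (- \<alpha>), cis \<psi>)"

definition left :: "real \<Rightarrow> real \<Rightarrow> collision" where
  "left t \<psi> = (C, A, A + of_real t * cis \<alpha>, cis \<psi>)"

section \<open>Reflections at the sides and flights between them\<close>

lemma side_vectors: "B - A = of_real (2 * cos \<alpha>) * cis 0" "C - B = of_real (- 1) * cis (- \<alpha>)"
    "A - C = of_real (- 1) * cis \<alpha>"
  by (auto simp: A_def B_def C_def complex_eq_iff)

lemma sides_ne: "A \<noteq> B" "B \<noteq> C" "C \<noteq> A"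
  using trig_signs by (auto simp: A_def B_def C_def complex_eq_iff)

lemma reflect_side:
  "reflect (B - A) (cis \<psi>) = cis (- \<psi>)"
  "reflect (C - B) (cis \<psi>) = cis (- 2 * \<alpha> - \<psi>)"
  "reflect (A - C) (cis \<psi>) = cis (2 * \<alpha> - \<psi>)"
  unfolding side_vectors using trig_signs by (subst reflect_cis; simp)+

lemma collision_at_base: "0 < d \<Longrightarrow> d < 2 * cos \<alpha> \<Longrightarrow> collision_at A B C (base d \<psi>)"
  using trig_signs
  by (auto simp: collision_at_def base_def sides_def A_def B_def in_segment complex_eq_iff field_simps
        intro!: exI[of _ "1 - d / (2 * cos \<alpha>)"])

lemma collision_at_right: "0 < t \<Longrightarrow> t < 1 \<Longrightarrow> collision_at A B C (right t \<psi>)"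
  using sides_ne
  by (auto simp: collision_at_def right_def sides_def B_def C_def in_segment complex_eq_iff algebra_simps
        intro!: exI[of _ t])

lemma collision_at_left: "0 < t \<Longrightarrow> t < 1 \<Longrightarrow> collision_at A B C (left t \<psi>)"
  using sides_ne
  by (auto simp: collision_at_def left_def sides_def A_def C_def in_segment complex_eq_iff algebra_simps
        intro!: exI[of _ "1 - t"])

text \<open>The law of sines in the triangle formed by \<open>B\<close>, the base point and the leg
  point, with angle alpha at \<open>B\<close>. The length on the right may be negative, so the
  identity serves flights in both directions.\<close>

lemma base_right_segment:
  assumes "sin (\<psi> + \<alpha>) \<noteq> 0" "d * sin \<psi> = t * sin (\<psi> + \<alpha>)"
  shows "(B - of_real t * cis (- \<alpha>)) - of_real (cos \<alpha> - d) = of_real (d * sin \<alpha> / sin (\<psi> + \<alpha>)) * cis \<psi>"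
proof -
  have t: "t = d * sin \<psi> / sin (\<psi> + \<alpha>)" using assms by (simp add: field_simps)
  have "d * sin (\<psi> + \<alpha>) = d * sin \<psi> * cos \<alpha> + d * sin \<alpha> * cos \<psi>" by (simp add: sin_add algebra_simps)
  then have "d = d * sin \<psi> / sin (\<psi> + \<alpha>) * cos \<alpha> + d * sin \<alpha> / sin (\<psi> + \<alpha>) * cos \<psi>"
    using assms(1) by (simp add: field_simps)
  then show ?thesis unfolding t by (simp add: B_def complex_eq_iff)
qed

lemma base_left_segment:
  assumes "sin (\<psi> - \<alpha>) \<noteq> 0" "x * sin \<psi> = t * sin (\<psi> - \<alpha>)"
  shows "(A + of_real t * cis \<alpha>) - of_real (x - cos \<alpha>) = of_real (x * sin \<alpha> / sin (\<psi> - \<alpha>)) * cis \<psi>"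
proof -
  have t: "t = x * sin \<psi> / sin (\<psi> - \<alpha>)" using assms by (simp add: field_simps)
  have "x * sin (\<psi> - \<alpha>) = x * sin \<psi> * cos \<alpha> - x * sin \<alpha> * cos \<psi>" by (simp add: sin_diff algebra_simps)
  then have "x = x * sin \<psi> / sin (\<psi> - \<alpha>) * cos \<alpha> - x * sin \<alpha> / sin (\<psi> - \<alpha>) * cos \<psi>"
    using assms(1) by (simp add: field_simps)
  then show ?thesis unfolding t by (simp add: A_def complex_eq_iff)
qed

lemma flight_base_right:
  assumes "d > 0" "sin (\<psi> + \<alpha>) > 0" "d * sin \<psi> = t * sin (\<psi> + \<alpha>)" "\<psi>' = - 2 * \<alpha> - \<psi>"
  shows "flight (base d \<psi>) (right t \<psi>')"
  unfolding base_def right_def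
  by (rule flightI[where l = "d * sin \<alpha> / sin (\<psi> + \<alpha>)"])
    (use assms sides_ne trig_signs reflect_side base_right_segment[of \<psi> d t] in auto)

lemma flight_right_base:
  assumes "d > 0" "sin (\<psi> + \<alpha>) < 0" "d * sin \<psi> = t * sin (\<psi> + \<alpha>)" "\<psi>' = - \<psi>"
  shows "flight (right t \<psi>) (base d \<psi>')"
  unfolding base_def right_def
proof (rule flightI[where l = "- (d * sin \<alpha> / sin (\<psi> + \<alpha>))"])
  show "complex_of_real (cos \<alpha> - d) - (B - complex_of_real t * cis (- \<alpha>)) =
      complex_of_real (- (d * sin \<alpha> / sin (\<psi> + \<alpha>))) * cis \<psi>"
    using base_right_segment[of \<psi> d t] assms by (simp add: algebra_simps)
qed (use assms sides_ne trig_signs reflect_side in \<open>auto simp: divide_neg_neg divide_pos_neg\<close>)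

lemma flight_base_left:
  assumes "d < 2 * cos \<alpha>" "sin (\<psi> - \<alpha>) > 0" "(2 * cos \<alpha> - d) * sin \<psi> = t * sin (\<psi> - \<alpha>)" "\<psi>' = 2 * \<alpha> - \<psi>"
  shows "flight (base d \<psi>) (left t \<psi>')"
  unfolding base_def left_def
proof (rule flightI[where l = "(2 * cos \<alpha> - d) * sin \<alpha> / sin (\<psi> - \<alpha>)"])
  show "A + complex_of_real t * cis \<alpha> - complex_of_real (cos \<alpha> - d) =
      complex_of_real ((2 * cos \<alpha> - d) * sin \<alpha> / sin (\<psi> - \<alpha>)) * cis \<psi>"
    using base_left_segment[of \<psi> "2 * cos \<alpha> - d" t] assms by simp
qed (use assms sides_ne trig_signs reflect_side in auto)

lemma flight_left_base:
  assumes "d < 2 * cos \<alpha>" "sin (\<psi> - \<alpha>) < 0" "(2 * cos \<alpha> - d) * sin \<psi> = t * sin (\<psi> - \<alpha>)" "\<psi>' = - \<psi>"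
  shows "flight (left t \<psi>) (base d \<psi>')"
  unfolding base_def left_def
proof (rule flightI[where l = "- ((2 * cos \<alpha> - d) * sin \<alpha> / sin (\<psi> - \<alpha>))"])
  have "(A + of_real t * cis \<alpha>) - of_real (cos \<alpha> - d) = of_real ((2 * cos \<alpha> - d) * sin \<alpha> / sin (\<psi> - \<alpha>)) * cis \<psi>"
    using base_left_segment[of \<psi> "2 * cos \<alpha> - d" t] assms by simp
  then show "complex_of_real (cos \<alpha> - d) - (A + complex_of_real t * cis \<alpha>) =
      complex_of_real (- ((2 * cos \<alpha> - d) * sin \<alpha> / sin (\<psi> - \<alpha>))) * cis \<psi>"
    by (simp only: of_real_minus mult_minus_left) (metis minus_diff_eq)
  show "0 < - ((2 * cos \<alpha> - d) * sin \<alpha> / sin (\<psi> - \<alpha>))"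
    using assms trig_signs by (simp add: divide_pos_neg)
qed (use assms sides_ne trig_signs reflect_side in auto)

text \<open>The law of sines at the apex, where the angle is pi - 2 alpha and the two distances are
  \<open>1 - t\<close> and \<open>1 - t'\<close>.\<close>

lemma flight_right_left:
  assumes "t < 1" "sin (\<psi> - \<alpha>) > 0" "(1 - t) * sin (\<psi> + \<alpha>) + (1 - t') * sin (\<psi> - \<alpha>) = 0" "\<psi>' = 2 * \<alpha> - \<psi>"
  shows "flight (right t \<psi>) (left t' \<psi>')"
  unfolding right_def left_def
proof (rule flightI[where l = "(1 - t) * sin (2 * \<alpha>) / sin (\<psi> - \<alpha>)"])
  have t': "t' = 1 + (1 - t) * sin (\<psi> + \<alpha>) / sin (\<psi> - \<alpha>)" using assms by (simp add: field_simps)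
  have eq: "sin (\<psi> + \<alpha>) * cos \<alpha> - cos \<alpha> * sin (\<psi> - \<alpha>) = sin (2 * \<alpha>) * cos \<psi>"
    "sin (\<psi> + \<alpha>) * sin \<alpha> + sin \<alpha> * sin (\<psi> - \<alpha>) = sin (2 * \<alpha>) * sin \<psi>"
    unfolding sin_double by (simp_all add: sin_add sin_diff algebra_simps)
  have "(1 - t) * sin (\<psi> + \<alpha>) / sin (\<psi> - \<alpha>) * cos \<alpha> - (1 - t) * cos \<alpha> = (1 - t) * sin (2 * \<alpha>) / sin (\<psi> - \<alpha>) * cos \<psi>"
    "(1 - t) * sin (\<psi> + \<alpha>) / sin (\<psi> - \<alpha>) * sin \<alpha> + (1 - t) * sin \<alpha> = (1 - t) * sin (2 * \<alpha>) / sin (\<psi> - \<alpha>) * sin \<psi>"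
    using assms(2) arg_cong[OF eq(1), of "\<lambda>x. (1 - t) * x"] arg_cong[OF eq(2), of "\<lambda>x. (1 - t) * x"]
    by (simp_all add: field_simps)
  then show "A + complex_of_real t' * cis \<alpha> - (B - complex_of_real t * cis (- \<alpha>)) =
      complex_of_real ((1 - t) * sin (2 * \<alpha>) / sin (\<psi> - \<alpha>)) * cis \<psi>"
    unfolding t' by (simp add: A_def B_def complex_eq_iff algebra_simps)
qed (use assms sides_ne trig_signs reflect_side in auto)

text \<open>Every leg hit in the cycles is at a distance k r from a base vertex, with r one of three
  quotients of values of \<open>\<sigma>\<close> and k less than the base length. Taking k equal to
  that length gives \<open>h\<close>; as \<open>h < 1\<close>, the hits stay uniformly below the
  apex.\<close>

definition h where "h = Max {2 * cos \<alpha> * \<sigma> 0 / \<sigma> 1, 2 * cos \<alpha> * \<sigma> 6 / \<sigma> 3, 2 * cos \<alpha> * \<sigma> 6 / \<sigma> 5}"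

text \<open>Translates the sines in the flight lemmas for the directions that occur, j alpha + phi
  and its negative.\<close>

lemma sin_\<sigma>:
  "sin (j * \<alpha> + \<phi> + \<alpha>) = \<sigma> (j + 1)" "sin (j * \<alpha> + \<phi> - \<alpha>) = \<sigma> (j - 1)"
  "sin (- (j * \<alpha> + \<phi>) + \<alpha>) = - \<sigma> (j - 1)" "sin (- (j * \<alpha> + \<phi>) - \<alpha>) = - \<sigma> (j + 1)"
  "sin (j * \<alpha> + \<phi>) = \<sigma> j" "sin (- (j * \<alpha> + \<phi>)) = - \<sigma> j"
proof -
  show 1: "sin (j * \<alpha> + \<phi> + \<alpha>) = \<sigma> (j + 1)" "sin (j * \<alpha> + \<phi> - \<alpha>) = \<sigma> (j - 1)"
    "sin (j * \<alpha> + \<phi>) = \<sigma> j" by (simp_all add: \<sigma>_def algebra_simps)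
  show "sin (- (j * \<alpha> + \<phi>)) = - \<sigma> j" unfolding sin_minus 1 ..
  have "- (j * \<alpha> + \<phi>) + \<alpha> = - (j * \<alpha> + \<phi> - \<alpha>)" "- (j * \<alpha> + \<phi>) - \<alpha> = - (j * \<alpha> + \<phi> + \<alpha>)" by simp_all
  then show "sin (- (j * \<alpha> + \<phi>) + \<alpha>) = - \<sigma> (j - 1)" "sin (- (j * \<alpha> + \<phi>) - \<alpha>) = - \<sigma> (j + 1)"
    by (simp_all only: sin_minus 1)
qed

lemma h_props: "0 < h" "h < 1" "2 * cos \<alpha> * (\<sigma> 0 / \<sigma> 1) \<le> h" "2 * cos \<alpha> * (\<sigma> 6 / \<sigma> 3) \<le> h" "2 * cos \<alpha> * (\<sigma> 6 / \<sigma> 5) \<le> h"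
proof -
  show h: "2 * cos \<alpha> * (\<sigma> 0 / \<sigma> 1) \<le> h" "2 * cos \<alpha> * (\<sigma> 6 / \<sigma> 3) \<le> h" "2 * cos \<alpha> * (\<sigma> 6 / \<sigma> 5) \<le> h"
    by (simp_all add: h_def)
  have "0 < 2 * cos \<alpha> * (\<sigma> 0 / \<sigma> 1)" using trig_signs \<sigma>_signs by simp
  then show "0 < h" using h(1) by linarith
  \<comment> \<open>By \<open>\<sigma>_26\<close> and the recurrence this is the inequality
    \<open>2 * cos \<alpha> * \<sigma> 0 < \<sigma> 1\<close> again.\<close>
  have "\<sigma> 3 < 2 * cos \<alpha> * \<sigma> 6"
    using \<sigma>_signs(9) \<sigma>_26 \<sigma>_rec[of 2] by (simp add: algebra_simps flip: \<sigma>_26)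
  then show "h < 1" using \<sigma>_signs by (simp add: h_def field_simps)
qed

text \<open>A bound on the height passes to convex combinations, so whole flights, and not just
  their end points, stay away from \<open>C\<close>.\<close>

definition admissible :: "collision \<Rightarrow> bool" where
  "admissible x \<longleftrightarrow> collision_at A B C x \<and> Im (position x) \<le> h * sin \<alpha>"

lemma admissible_base: "0 < d \<Longrightarrow> d < 2 * cos \<alpha> \<Longrightarrow> admissible (base d \<psi>)"
  using collision_at_base h_props trig_signs by (auto simp: admissible_def position_def base_def)

lemma admissible_right: "0 < t \<Longrightarrow> t \<le> h \<Longrightarrow> admissible (right t \<psi>)"
  using collision_at_right[of t] h_props trig_signs
  by (auto simp: admissible_def position_def right_def B_def intro!: mult_right_mono)

lemma admissible_left: "0 < t \<Longrightarrow> t \<le> h \<Longrightarrow> admissible (left t \<psi>)"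
  using collision_at_left[of t] h_props trig_signs
  by (auto simp: admissible_def position_def left_def A_def intro!: mult_right_mono)

text \<open>The first three quotients locate leg hits; \<open>\<sigma> 6 / \<sigma> 4\<close>
  locates base hits, which must stay on the base.\<close>

lemma scaled_bounds:
  assumes "0 < k" "k < 2 * cos \<alpha>"
  shows "0 < k * (\<sigma> 0 / \<sigma> 1)" "k * (\<sigma> 0 / \<sigma> 1) \<le> h"
    "0 < k * (\<sigma> 6 / \<sigma> 3)" "k * (\<sigma> 6 / \<sigma> 3) \<le> h"
    "0 < k * (\<sigma> 6 / \<sigma> 5)" "k * (\<sigma> 6 / \<sigma> 5) \<le> h"
    "0 < k * (\<sigma> 6 / \<sigma> 4)" "k * (\<sigma> 6 / \<sigma> 4) < 2 * cos \<alpha>"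
proof -
  note s = \<sigma>_signs trig_signs
  have pos: "\<sigma> 0 / \<sigma> 1 > 0" "\<sigma> 6 / \<sigma> 3 > 0" "\<sigma> 6 / \<sigma> 5 > 0" "\<sigma> 6 / \<sigma> 4 > 0"
    using s by (auto intro: divide_pos_pos divide_neg_neg)
  then show "0 < k * (\<sigma> 0 / \<sigma> 1)" "0 < k * (\<sigma> 6 / \<sigma> 3)" "0 < k * (\<sigma> 6 / \<sigma> 5)" "0 < k * (\<sigma> 6 / \<sigma> 4)"
    using assms by (auto intro!: mult_pos_pos simp del: times_divide_eq_right)
  have "k * r \<le> 2 * cos \<alpha> * r" if "r > 0" for r using assms that by (intro mult_right_mono) auto
  from this[OF pos(1)] this[OF pos(2)] this[OF pos(3)] h_props
  show "k * (\<sigma> 0 / \<sigma> 1) \<le> h" "k * (\<sigma> 6 / \<sigma> 3) \<le> h" "k * (\<sigma> 6 / \<sigma> 5) \<le> h" by linarith+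
  have "\<sigma> 6 / \<sigma> 4 < 1" using s by (simp add: field_simps)
  then have "k * (\<sigma> 6 / \<sigma> 4) < k * 1" using assms by (intro mult_strict_left_mono) auto
  then show "k * (\<sigma> 6 / \<sigma> 4) < 2 * cos \<alpha>" using assms by simp
qed

text \<open>By the law of sines the distance from \<open>B\<close> is multiplied by
  \<open>\<sigma> 0 / \<sigma> 2\<close> between the first two base hits. The second one is on the
  base exactly if d is below 2 rho cos alpha, which separates the two branches.\<close>

definition short_cycle :: "real \<Rightarrow> collision list" where
  "short_cycle d =
     [base d \<phi>,
      right (d * (\<sigma> 0 / \<sigma> 1)) (- (2 * \<alpha> + \<phi>)),
      base (d * (\<sigma> 0 / \<sigma> 2)) (2 * \<alpha> + \<phi>),
      left ((2 * cos \<alpha> * \<rho> - d) * (\<sigma> 0 / \<sigma> 1)) (- \<phi>)]"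

text \<open>The middle base hit has distance \<open>k\<close> from \<open>A\<close> and
  \<open>q\<close> from \<open>B\<close>. The second half is the first half reversed in time and
  mirrored in the axis of the triangle, with \<open>q\<close> in place of \<open>k\<close>.\<close>

definition long_cycle :: "real \<Rightarrow> collision list" where
  "long_cycle d = (let k = \<sigma> 0 * (2 * cos \<alpha> * \<rho> - d) / \<sigma> 6; q = 2 * cos \<alpha> - k in
     [base d \<phi>,
      right (d * (\<sigma> 0 / \<sigma> 1)) (- (2 * \<alpha> + \<phi>)),
      left (k * (\<sigma> 6 / \<sigma> 3)) (4 * \<alpha> + \<phi>),
      base (2 * cos \<alpha> - k * (\<sigma> 6 / \<sigma> 4)) (- (4 * \<alpha> + \<phi>)),
      left (k * (\<sigma> 6 / \<sigma> 5)) (6 * \<alpha> + \<phi>),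
      base q (- (6 * \<alpha> + \<phi>)),
      right (q * (\<sigma> 6 / \<sigma> 5)) (4 * \<alpha> + \<phi>),
      base (q * (\<sigma> 6 / \<sigma> 4)) (- (4 * \<alpha> + \<phi>)),
      right (q * (\<sigma> 6 / \<sigma> 3)) (2 * \<alpha> + \<phi>),
      left ((2 * cos \<alpha> * \<rho> + 2 * cos \<alpha> - d) * (\<sigma> 0 / \<sigma> 1)) (- \<phi>)])"

lemma \<rho>_\<sigma>: "\<rho> * \<sigma> 0 = \<sigma> 2"
  using \<sigma>_signs by (simp add: \<rho>_def)

lemma short_cycle:
  assumes d: "0 < d" "d < 2 * cos \<alpha> * \<rho>"
  shows "\<forall>x \<in> set (short_cycle d). admissible x"
    "successively flight (short_cycle d @ [base (d - 2 * cos \<alpha> * \<rho> + 2 * cos \<alpha>) \<phi>])"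
proof -
  note s = \<sigma>_signs trig_signs \<rho>_bounds
  have c\<rho>: "2 * cos \<alpha> * \<rho> < 2 * cos \<alpha>" using s by simp
  have a: "0 < 2 * cos \<alpha> * \<rho> - d" "2 * cos \<alpha> * \<rho> - d < 2 * cos \<alpha>" using d c\<rho> by linarith+
  have e: "0 < d * (\<sigma> 0 / \<sigma> 2)" "d * (\<sigma> 0 / \<sigma> 2) < 2 * cos \<alpha>"
  proof -
    show "0 < d * (\<sigma> 0 / \<sigma> 2)" using d s by simp
    have "d * \<sigma> 0 < 2 * cos \<alpha> * (\<rho> * \<sigma> 0)" using d s by (simp add: mult.assoc[symmetric])
    then show "d * (\<sigma> 0 / \<sigma> 2) < 2 * cos \<alpha>" unfolding \<rho>_\<sigma> using s by (simp add: field_simps)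
  qed
  have d': "d < 2 * cos \<alpha>" using d c\<rho> by linarith
  show "\<forall>x \<in> set (short_cycle d). admissible x"
    unfolding short_cycle_def
    using d(1) d' a e scaled_bounds[of d] scaled_bounds[OF a]
    by (auto intro: admissible_base admissible_left admissible_right)
  \<comment> \<open>Writing phi as \<open>0 * \<alpha> + \<phi>\<close> lets the rules
    \<open>sin_\<sigma>\<close> match.\<close>
  have "flight (base d (0 * \<alpha> + \<phi>)) (right (d * (\<sigma> 0 / \<sigma> 1)) (- (2 * \<alpha> + \<phi>)))"
    by (rule flight_base_right; (simp only: sin_\<sigma>)?) (use d s in auto)
  moreover have "flight (right (d * (\<sigma> 0 / \<sigma> 1)) (- (2 * \<alpha> + \<phi>))) (base (d * (\<sigma> 0 / \<sigma> 2)) (2 * \<alpha> + \<phi>))"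
    by (rule flight_right_base; (simp only: sin_\<sigma>)?) (use e s in auto)
  moreover have "flight (base (d * (\<sigma> 0 / \<sigma> 2)) (2 * \<alpha> + \<phi>)) (left ((2 * cos \<alpha> * \<rho> - d) * (\<sigma> 0 / \<sigma> 1)) (- (0 * \<alpha> + \<phi>)))"
  proof (rule flight_base_left; (simp only: sin_\<sigma>)?)
    show "(2 * cos \<alpha> - d * (\<sigma> 0 / \<sigma> 2)) * \<sigma> 2 = (2 * cos \<alpha> * \<rho> - d) * (\<sigma> 0 / \<sigma> 1) * \<sigma> (2 - 1)"
      using s by (simp add: \<rho>_def field_simps)
  qed (use e s in auto)
  moreover have "flight (left ((2 * cos \<alpha> * \<rho> - d) * (\<sigma> 0 / \<sigma> 1)) (- (0 * \<alpha> + \<phi>))) (base (d - 2 * cos \<alpha> * \<rho> + 2 * cos \<alpha>) (0 * \<alpha> + \<phi>))"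
    by (rule flight_left_base; (simp only: sin_\<sigma>)?) (use a s in auto)
  ultimately show "successively flight (short_cycle d @ [base (d - 2 * cos \<alpha> * \<rho> + 2 * cos \<alpha>) \<phi>])"
    by (simp add: short_cycle_def)
qed

lemma long_cycle:
  assumes d: "2 * cos \<alpha> * \<rho> < d" "d < 2 * cos \<alpha>"
  shows "\<forall>x \<in> set (long_cycle d). admissible x"
    "successively flight (long_cycle d @ [base (d - 2 * cos \<alpha> * \<rho>) \<phi>])"
proof -
  note s = \<sigma>_signs trig_signs \<rho>_bounds
  define k where "k = \<sigma> 0 * (2 * cos \<alpha> * \<rho> - d) / \<sigma> 6"
  define q where "q = 2 * cos \<alpha> - k"
  have c\<rho>: "0 < 2 * cos \<alpha> * \<rho>" using s by simp
  have a: "0 < 2 * cos \<alpha> * \<rho> + 2 * cos \<alpha> - d" "2 * cos \<alpha> * \<rho> + 2 * cos \<alpha> - d < 2 * cos \<alpha>" using d c\<rho> by linarith+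
  have d0: "0 < d" using d c\<rho> by linarith
  have k6: "k * \<sigma> 6 = 2 * cos \<alpha> * \<sigma> 2 - \<sigma> 0 * d" using s by (simp add: k_def \<rho>_def field_simps)
  \<comment> \<open>Here \<open>\<sigma>_26\<close> makes \<open>q * \<sigma> 6\<close> a multiple
    of \<open>d - 2 * cos \<alpha>\<close>, so \<open>q\<close> stays positive up to the very end of
    the base and the middle hit never leaves it.\<close>
  have q6: "q * \<sigma> 6 = \<sigma> 0 * d - 2 * cos \<alpha> * \<sigma> 0"
    unfolding q_def left_diff_distrib k6 by (simp add: algebra_simps flip: \<sigma>_26)
  have k: "0 < k"
  proof -
    have "\<sigma> 0 * (2 * cos \<alpha> * \<rho> - d) < 0" using s d by (intro mult_pos_neg) auto
    then show ?thesis unfolding k_def using s by (intro divide_neg_neg) auto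
  qed
  have q: "0 < q"
  proof -
    have "q * \<sigma> 6 = \<sigma> 0 * (d - 2 * cos \<alpha>)" unfolding q6 by (simp add: algebra_simps)
    also have "\<dots> < 0" using s d by (intro mult_pos_neg) auto
    finally show ?thesis using s by (simp add: mult_less_0_iff)
  qed
  have kq: "k < 2 * cos \<alpha>" "q < 2 * cos \<alpha>" using k q by (auto simp: q_def)
  have cyc: "long_cycle d = 
     [base d \<phi>,
      right (d * (\<sigma> 0 / \<sigma> 1)) (- (2 * \<alpha> + \<phi>)),
      left (k * (\<sigma> 6 / \<sigma> 3)) (4 * \<alpha> + \<phi>),
      base (2 * cos \<alpha> - k * (\<sigma> 6 / \<sigma> 4)) (- (4 * \<alpha> + \<phi>)),
      left (k * (\<sigma> 6 / \<sigma> 5)) (6 * \<alpha> + \<phi>),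
      base q (- (6 * \<alpha> + \<phi>)),
      right (q * (\<sigma> 6 / \<sigma> 5)) (4 * \<alpha> + \<phi>),
      base (q * (\<sigma> 6 / \<sigma> 4)) (- (4 * \<alpha> + \<phi>)),
      right (q * (\<sigma> 6 / \<sigma> 3)) (2 * \<alpha> + \<phi>),
      left ((2 * cos \<alpha> * \<rho> + 2 * cos \<alpha> - d) * (\<sigma> 0 / \<sigma> 1)) (- \<phi>)]"
    unfolding long_cycle_def Let_def k_def q_def ..
  have t1: "d * (\<sigma> 0 / \<sigma> 1) < 1" "q * (\<sigma> 6 / \<sigma> 3) < 1"
    using scaled_bounds(2)[OF d0 d(2)] scaled_bounds(4)[OF q kq(2)] h_props by linarith+
  note kb = scaled_bounds[OF k kq(1)] and qb = scaled_bounds[OF q kq(2)]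
  show "\<forall>x \<in> set (long_cycle d). admissible x"
    unfolding cyc using d d0 k q kq kb qb scaled_bounds[OF d0 d(2)] scaled_bounds[OF a]
    by (auto intro: admissible_base admissible_left admissible_right)
  have "flight (base d (0 * \<alpha> + \<phi>)) (right (d * (\<sigma> 0 / \<sigma> 1)) (- (2 * \<alpha> + \<phi>)))"
    by (rule flight_base_right; (simp only: sin_\<sigma>)?) (use d0 s in auto)
  moreover have "flight (right (d * (\<sigma> 0 / \<sigma> 1)) (- (2 * \<alpha> + \<phi>))) (left (k * (\<sigma> 6 / \<sigma> 3)) (4 * \<alpha> + \<phi>))"
  proof (rule flight_right_left; (simp only: sin_\<sigma>)?)
    \<comment> \<open>With the denominators cleared, the apex condition is this instance of the
      recurrence combined with \<open>k6\<close>.\<close>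
    have "\<sigma> 1 + \<sigma> 3 = 2 * cos \<alpha> * \<sigma> 2" using \<sigma>_rec[of 2] by simp
    then show "(1 - d * (\<sigma> 0 / \<sigma> 1)) * - \<sigma> (2 - 1) + (1 - k * (\<sigma> 6 / \<sigma> 3)) * - \<sigma> (2 + 1) = 0"
      using s k6 by (simp add: algebra_simps)
  qed (use s t1 in auto)
  moreover have "flight (left (k * (\<sigma> 6 / \<sigma> 3)) (4 * \<alpha> + \<phi>)) (base (2 * cos \<alpha> - k * (\<sigma> 6 / \<sigma> 4)) (- (4 * \<alpha> + \<phi>)))"
    by (rule flight_left_base; (simp only: sin_\<sigma>)?) (use kb s in auto)
  moreover have "flight (base (2 * cos \<alpha> - k * (\<sigma> 6 / \<sigma> 4)) (- (4 * \<alpha> + \<phi>))) (left (k * (\<sigma> 6 / \<sigma> 5)) (6 * \<alpha> + \<phi>))"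
    by (rule flight_base_left; (simp only: sin_\<sigma>)?) (use kb s in auto)
  moreover have "flight (left (k * (\<sigma> 6 / \<sigma> 5)) (6 * \<alpha> + \<phi>)) (base q (- (6 * \<alpha> + \<phi>)))"
    by (rule flight_left_base; (simp only: sin_\<sigma>)?) (use kq s in \<open>auto simp: q_def\<close>)
  moreover have "flight (base q (- (6 * \<alpha> + \<phi>))) (right (q * (\<sigma> 6 / \<sigma> 5)) (4 * \<alpha> + \<phi>))"
    by (rule flight_base_right; (simp only: sin_\<sigma>)?) (use q s in auto)
  moreover have "flight (right (q * (\<sigma> 6 / \<sigma> 5)) (4 * \<alpha> + \<phi>)) (base (q * (\<sigma> 6 / \<sigma> 4)) (- (4 * \<alpha> + \<phi>)))"
    by (rule flight_right_base; (simp only: sin_\<sigma>)?) (use qb s in auto)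
  moreover have "flight (base (q * (\<sigma> 6 / \<sigma> 4)) (- (4 * \<alpha> + \<phi>))) (right (q * (\<sigma> 6 / \<sigma> 3)) (2 * \<alpha> + \<phi>))"
    by (rule flight_base_right; (simp only: sin_\<sigma>)?) (use qb s in auto)
  moreover have "flight (right (q * (\<sigma> 6 / \<sigma> 3)) (2 * \<alpha> + \<phi>)) (left ((2 * cos \<alpha> * \<rho> + 2 * cos \<alpha> - d) * (\<sigma> 0 / \<sigma> 1)) (- (0 * \<alpha> + \<phi>)))"
  proof (rule flight_right_left; (simp only: sin_\<sigma>)?)
    let ?a = "2 * cos \<alpha> * \<rho> + 2 * cos \<alpha> - d"
    have "\<sigma> 1 + \<sigma> 3 = 2 * cos \<alpha> * \<sigma> 2" using \<sigma>_rec[of 2] by simp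
    moreover have "?a * \<sigma> 0 = 2 * cos \<alpha> * \<sigma> 2 + 2 * cos \<alpha> * \<sigma> 0 - \<sigma> 0 * d"
      using \<rho>_\<sigma> by (simp add: algebra_simps)
    moreover have e: "(1 - q * (\<sigma> 6 / \<sigma> 3)) * \<sigma> 3 = \<sigma> 3 - q * \<sigma> 6" "(1 - x * (\<sigma> 0 / \<sigma> 1)) * \<sigma> 1 = \<sigma> 1 - x * \<sigma> 0" for x
      using s by (simp_all add: field_simps)
    moreover have n: "\<sigma> (2 + 1) = \<sigma> 3" "\<sigma> (2 - 1) = \<sigma> 1" by simp_all
    ultimately show "(1 - q * (\<sigma> 6 / \<sigma> 3)) * \<sigma> (2 + 1) + (1 - ?a * (\<sigma> 0 / \<sigma> 1)) * \<sigma> (2 - 1) = 0"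
      using q6 unfolding n e by linarith
  qed (use s t1 in auto)
  moreover have "flight (left ((2 * cos \<alpha> * \<rho> + 2 * cos \<alpha> - d) * (\<sigma> 0 / \<sigma> 1)) (- (0 * \<alpha> + \<phi>))) (base (d - 2 * cos \<alpha> * \<rho>) (0 * \<alpha> + \<phi>))"
    by (rule flight_left_base; (simp only: sin_\<sigma>)?) (use a s in auto)
  ultimately show "successively flight (long_cycle d @ [base (d - 2 * cos \<alpha> * \<rho>) \<phi>])"
    by (simp add: cyc)
qed

end

section \<open>The orbit of the rotation as a sequence of collisions\<close>

lemma frac_diff_irrational_rotation:
  fixes \<rho> x :: real
  assumes "0 < \<rho>" "\<rho> < 1"
  shows "frac (x - \<rho>) = (if frac x < \<rho> then frac x - \<rho> + 1 else frac x - \<rho>)"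
proof -
  have "x - \<rho> - (frac x - \<rho>) \<in> \<int>" "x - \<rho> - (frac x - \<rho> + 1) \<in> \<int>" by (simp_all add: frac_def)
  moreover have "0 \<le> frac x - \<rho> + 1" "frac x - \<rho> < 1" using assms frac_ge_0[of x] frac_lt_1[of x] by linarith+
  ultimately show ?thesis by (auto simp: frac_unique_iff)
qed

lemma dist_of_real_cis: "q - p = of_real l * cis \<psi> \<Longrightarrow> dist p q = \<bar>l\<bar>"
  by (simp add: dist_norm norm_minus_commute[of p q] norm_mult)

lemma frac_eq_imp_diff_Ints: "frac x = frac y \<Longrightarrow> x - y \<in> \<int>"
proof -
  assume "frac x = frac y"
  then have "x - y = of_int (\<lfloor>x\<rfloor> - \<lfloor>y\<rfloor>)" by (simp add: frac_def)
  then show ?thesis by (metis Ints_of_int)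
qed

context isosceles_billiard
begin

lemma exists_collision_sequence:
  assumes irr: "\<rho> \<notin> \<rat>"
  shows "\<exists>(x :: int \<Rightarrow> collision) \<delta> W. (\<forall>n. admissible (x n)) \<and> (\<forall>n. flight (x n) (x (n + 1))) \<and> \<delta> > 0 \<and>
    (\<forall>n. \<exists>m\<in>{n<..n + W}. \<delta> \<le> dist (position (x (m - 1))) (position (x m)) + dist (position (x m)) (position (x (m + 1)))) \<and>
    infinite (range (position \<circ> x))"
proof -
  note s = \<sigma>_signs trig_signs \<rho>_bounds
  \<comment> \<open>starting at \<open>\<rho> / 2\<close> ensures that neither 0 nor \<open>\<rho>\<close>, which lead into a vertex, is ever met\<close>
  define u where "u = (\<lambda>k::int. frac (\<rho> / 2 - of_int k * \<rho>))"
  define d where "d = (\<lambda>k. 2 * cos \<alpha> * u k)"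
  have u_next: "u (k + 1) = (if u k < \<rho> then u k - \<rho> + 1 else u k - \<rho>)" for k
    using frac_diff_irrational_rotation[OF \<rho>_bounds, of "\<rho> / 2 - of_int k * \<rho>"]
    by (simp add: u_def algebra_simps)
  have not_int: "a * \<rho> \<notin> \<int>" if "a \<in> \<rat>" "a \<noteq> 0" for a
  proof
    assume "a * \<rho> \<in> \<int>"
    then have "a * \<rho> / a \<in> \<rat>" using that by (intro Rats_divide) (auto elim: Ints_cases)
    then show False using irr that by simp
  qed
  have u_ne: "u k \<noteq> 0" for k
  proof -
    have "1 / 2 - of_int k \<noteq> (0 :: real)"
    proof
      assume "1 / 2 - of_int k = (0 :: real)"
      then have "of_int (2 * k) = (of_int 1 :: real)" by simp
      then have "2 * k = 1" by (simp only: of_int_eq_iff)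
      then show False by presburger
    qed
    then have "(1 / 2 - of_int k) * \<rho> \<notin> \<int>" by (intro not_int) auto
    then show ?thesis by (simp add: u_def left_diff_distrib)
  qed
  have u: "0 < u k" "u k < 1" for k using u_ne[of k] frac_ge_0[of "\<rho> / 2 - of_int k * \<rho>"] frac_lt_1[of "\<rho> / 2 - of_int k * \<rho>"]
    by (auto simp: u_def)
  \<comment> \<open>The rotation sends \<open>\<rho>\<close> to 0, a value that the orbit
    avoids.\<close>
  have u\<rho>: "u k \<noteq> \<rho>" for k using u_next[of k] u_ne[of "k + 1"] by auto
  have inj_u: "inj u"
  proof (rule injI, rule ccontr)
    fix k k' assume "u k = u k'" "k \<noteq> k'"
    then have "(\<rho> / 2 - of_int k * \<rho>) - (\<rho> / 2 - of_int k' * \<rho>) \<in> \<int>"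
      unfolding u_def by (intro frac_eq_imp_diff_Ints)
    then have "of_int (k' - k) * \<rho> \<in> \<int>" by (simp add: algebra_simps)
    moreover have "of_int (k' - k) * \<rho> \<notin> \<int>" using \<open>k \<noteq> k'\<close> by (intro not_int) auto
    ultimately show False by simp
  qed
  have d_bounds: "0 < d k" "d k < 2 * cos \<alpha>" for k using u[of k] s by (auto simp: d_def)
  define cyc where "cyc = (\<lambda>k. if u k < \<rho> then short_cycle (d k) else long_cycle (d k))"
  have d_case: "d k < 2 * cos \<alpha> * \<rho> \<and> d (k + 1) = d k - 2 * cos \<alpha> * \<rho> + 2 * cos \<alpha>" if "u k < \<rho>" for k
    using that s unfolding d_def u_next by (simp add: algebra_simps)
  have d_case': "2 * cos \<alpha> * \<rho> < d k \<and> d (k + 1) = d k - 2 * cos \<alpha> * \<rho>" if "\<not> u k < \<rho>" for k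
    using that s u\<rho>[of k] unfolding d_def u_next by (simp add: algebra_simps)
  have ends: "cyc k \<noteq> []" "length (cyc k) \<le> 10" "hd (cyc k) = base (d k) \<phi>"
    "cyc k ! 1 = right (d k * (\<sigma> 0 / \<sigma> 1)) (- (2 * \<alpha> + \<phi>))" "1 < length (cyc k)"
    "last (cyc k) = left ((2 * cos \<alpha> - d (k + 1)) * (\<sigma> 0 / \<sigma> 1)) (- \<phi>)" for k
  proof -
    have long: "2 * cos \<alpha> * \<rho> + 2 * cos \<alpha> - d k = 2 * cos \<alpha> - (d k - 2 * cos \<alpha> * \<rho>)" by simp
    show "cyc k \<noteq> []" "length (cyc k) \<le> 10" "hd (cyc k) = base (d k) \<phi>"
      "cyc k ! 1 = right (d k * (\<sigma> 0 / \<sigma> 1)) (- (2 * \<alpha> + \<phi>))" "1 < length (cyc k)"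
      "last (cyc k) = left ((2 * cos \<alpha> - d (k + 1)) * (\<sigma> 0 / \<sigma> 1)) (- \<phi>)"
      using d_case[of k] d_case'[of k] by (auto simp: cyc_def short_cycle_def long_cycle_def Let_def)
        (simp only: long)
  qed
  have adm: "admissible y" if "y \<in> set (cyc k)" for y k
    using that short_cycle(1)[of "d k"] long_cycle(1)[of "d k"] d_bounds[of k] d_case[of k] d_case'[of k]
    by (auto simp: cyc_def split: if_splits)
  have succ: "successively flight (cyc k @ [hd (cyc (k + 1))])" for k
    unfolding ends(3)
    using short_cycle(2)[of "d k"] long_cycle(2)[of "d k"] d_bounds[of k] d_case[of k] d_case'[of k]
    by (simp add: cyc_def)
  obtain x N where x: "\<And>n. flight (x n) (x (n + 1))" "\<And>n. \<exists>k. x n \<in> set (cyc k)"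
    "\<And>k. x (N k) = hd (cyc k)" "\<And>k. x (N k - 1) = last (cyc (k - 1))"
    "\<And>k. x (N k + 1) = (cyc k @ [hd (cyc (k + 1))]) ! 1" "\<And>n. \<exists>k. n < N k \<and> N k \<le> n + int 10"
    using cycles_to_sequence[of cyc 10 flight] ends(1,2) succ by metis
  \<comment> \<open>At a return at distance d from \<open>B\<close> the incoming flight has length
    (2 cos alpha - d) sin alpha / \<open>\<sigma> 1\<close> and the outgoing one d sin alpha /
    \<open>\<sigma> 1\<close>. Either may be tiny, but the sum does not depend on d.\<close>
  define \<delta> where "\<delta> = 2 * cos \<alpha> * sin \<alpha> / \<sigma> 1"
  have \<delta>: "dist (position (x (N k - 1))) (position (x (N k))) + dist (position (x (N k))) (position (x (N k + 1))) = \<delta>" for k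
  proof -
    have "position (x (N k + 1)) - position (x (N k)) = of_real (d k * sin \<alpha> / sin (0 * \<alpha> + \<phi> + \<alpha>)) * cis (0 * \<alpha> + \<phi>)"
      using base_right_segment[of "0 * \<alpha> + \<phi>" "d k" "d k * (\<sigma> 0 / \<sigma> 1)"] s ends(4,5)[of k]
      unfolding sin_\<sigma> x(3,5) ends(3) by (simp add: nth_append position_def base_def right_def)
    from dist_of_real_cis[OF this]
    have 1: "dist (position (x (N k))) (position (x (N k + 1))) = d k * sin \<alpha> / \<sigma> 1"
      unfolding sin_\<sigma> using s d_bounds[of k] by simp
    have "position (x (N k - 1)) - position (x (N k)) =
        of_real ((2 * cos \<alpha> - d k) * sin \<alpha> / sin (- (0 * \<alpha> + \<phi>) - \<alpha>)) * cis (- (0 * \<alpha> + \<phi>))"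
      using base_left_segment[of "- (0 * \<alpha> + \<phi>)" "2 * cos \<alpha> - d k" "(2 * cos \<alpha> - d k) * (\<sigma> 0 / \<sigma> 1)"] s ends(6)[of "k - 1"]
      unfolding sin_\<sigma> x(3,4) ends(3) by (simp add: position_def base_def left_def)
    from dist_of_real_cis[OF this]
    have 2: "dist (position (x (N k - 1))) (position (x (N k))) = (2 * cos \<alpha> - d k) * sin \<alpha> / \<sigma> 1"
      unfolding sin_\<sigma> dist_commute[of "position (x (N k))"] using s d_bounds[of k] by simp
    have "(2 * cos \<alpha> - d k) * sin \<alpha> / \<sigma> 1 + d k * sin \<alpha> / \<sigma> 1 = \<delta>"
      by (simp add: \<delta>_def left_diff_distrib flip: add_divide_distrib)
    then show ?thesis unfolding 1 2 .
  qed
  have "infinite (range (position \<circ> x))"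
  proof
    assume fin: "finite (range (position \<circ> x))"
    have "range (\<lambda>k. complex_of_real (cos \<alpha> - d k)) \<subseteq> range (position \<circ> x)"
    proof
      fix z assume "z \<in> range (\<lambda>k. complex_of_real (cos \<alpha> - d k))"
      then obtain k where "z = complex_of_real (cos \<alpha> - d k)" by auto
      then have "z = (position \<circ> x) (N k)" by (simp add: x(3) ends(3) position_def base_def)
      then show "z \<in> range (position \<circ> x)" by blast
    qed
    then have "finite (range (\<lambda>k. complex_of_real (cos \<alpha> - d k)))" using fin finite_subset by blast
    moreover have "inj (\<lambda>k. complex_of_real (cos \<alpha> - d k))"
      using inj_u s by (auto simp: inj_def d_def)
    ultimately have "finite (UNIV :: int set)" by (rule finite_imageD)
    then show False by simp
  qed
  moreover have "\<delta> > 0" using s by (simp add: \<delta>_def)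
  moreover have "\<exists>m\<in>{n<..n + 10}. \<delta> \<le> dist (position (x (m - 1))) (position (x m)) + dist (position (x m)) (position (x (m + 1)))" for n
  proof -
    obtain k where "n < N k" "N k \<le> n + 10" using x(6)[of n] by auto
    then show ?thesis using \<delta>[of k] by (intro bexI[of _ "N k"]) auto
  qed
  moreover have "admissible (x n)" for n using x(2)[of n] adm by blast
  ultimately show ?thesis using x(1)
    by (intro exI[of _ x] exI[of _ \<delta>] exI[of _ "10 :: int"]) blast
qed

end

section \<open>Similar triangles\<close>

text \<open>The scale of the side cancels in \<open>reflect\<close>, and an orthogonal map preserves
  the inner products in it; reversal of orientation is harmless.\<close>

lemma reflect_similarity:
  fixes g :: "complex \<Rightarrow> complex"
  assumes g: "orthogonal_transformation g" and r: "r \<noteq> 0"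
  shows "reflect (r *\<^sub>R g d) (g v) = g (reflect d v)"
proof -
  have lin: "linear g" and inner: "g x \<bullet> g y = x \<bullet> y" for x y
    using g by (auto simp: orthogonal_transformation_def)
  have "reflect (r *\<^sub>R g d) (g v) = (2 * (v \<bullet> d) / (d \<bullet> d)) *\<^sub>R g d - g v"
    using r by (simp add: reflect_def inner)
  then show ?thesis by (simp add: reflect_def linear_diff[OF lin] linear_scale[OF lin])
qed

text \<open>Velocities are moved by the orthogonal part \<open>g\<close> alone, so that the speed
  remains 1.\<close>

definition similarity_collision :: "(complex \<Rightarrow> complex) \<Rightarrow> (complex \<Rightarrow> complex) \<Rightarrow> collision \<Rightarrow> collision" where
  "similarity_collision f g = (\<lambda>(P, Q, p, v). (f P, f Q, f p, g v))"

context
  fixes f g :: "complex \<Rightarrow> complex" and a :: complex and r :: real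
  assumes g: "orthogonal_transformation g" and r: "r > 0" and f: "\<And>z. f z = a + r *\<^sub>R g z"
begin

lemma similarity_diff: "f y - f x = r *\<^sub>R g (y - x)"
  using g by (simp add: f linear_diff orthogonal_transformation_def algebra_simps)

lemma similarity_norm: "norm (f y - f x) = r * norm (y - x)"
  using g r by (simp add: similarity_diff orthogonal_transformation_norm)

lemma similarity_dist: "dist (f x) (f y) = r * dist x y"
  using similarity_norm by (simp add: dist_norm)

lemma similarity_eq_iff: "f x = f y \<longleftrightarrow> x = y"
  using similarity_dist[of x y] r by (metis dist_eq_0_iff less_irrefl mult_eq_0_iff)

lemma similarity_convex_combination: "f ((1 - u) *\<^sub>R x + u *\<^sub>R y) = (1 - u) *\<^sub>R f x + u *\<^sub>R f y"
proof -
  have lin: "linear g" using g by (simp add: orthogonal_transformation_def)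
  show ?thesis unfolding f linear_add[OF lin] linear_scale[OF lin] by (simp add: algebra_simps)
qed

lemma similarity_collision_at:
  assumes "collision_at A B C x"
  shows "collision_at (f A) (f B) (f C) (similarity_collision f g x)"
  using assms g
  by (cases x)
    (auto simp: collision_at_def similarity_collision_def sides_def in_segment similarity_eq_iff
      orthogonal_transformation_norm similarity_convex_combination)

lemma similarity_flight:
  assumes "flight x y"
  shows "flight (similarity_collision f g x) (similarity_collision f g y)"
proof -
  obtain P Q p v P' Q' p' v' where xy: "x = (P, Q, p, v)" "y = (P', Q', p', v')" by (metis prod_cases4)
  have h: "(P, Q) \<noteq> (P', Q')" "p \<noteq> p'" "p' - p = norm (p' - p) *\<^sub>R v" "v' = reflect (Q' - P') v"
    using assms by (auto simp: flight_def xy)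
  have lin: "linear g" using g by (simp add: orthogonal_transformation_def)
  have "f p' - f p = norm (f p' - f p) *\<^sub>R g v"
    unfolding similarity_norm using similarity_diff[of p' p] h(3) linear_scale[OF lin] by (metis scaleR_scaleR)
  moreover have "g v' = reflect (f Q' - f P') (g v)"
    unfolding h(4) similarity_diff using reflect_similarity[OF g, of r] r by simp
  ultimately show ?thesis using h(1,2)
    by (simp add: flight_def xy similarity_collision_def similarity_eq_iff)
qed

lemma similarity_position: "position (similarity_collision f g x) = f (position x)"
  by (cases x) (simp add: position_def similarity_collision_def)

end

context isosceles_billiard
begin

text \<open>The normalised orbit is transported by \<open>f\<close>. Its flights have height at most
  \<open>h * sin \<alpha>\<close>, hence distance at least \<open>(1 - h) * sin \<alpha>\<close>
  from the apex, and all distances scale by \<open>r\<close>.\<close>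

lemma similar_triangle:
  assumes irr: "cos (5 * \<alpha>) / cos (3 * \<alpha>) \<notin> \<rat>" and g: "orthogonal_transformation g" and r: "r > 0"
    and f: "\<And>z. f z = a + r *\<^sub>R g z" and nc: "\<not> collinear {f A, f B, f C}"
  shows "has_nonperiodic_nondense_trajectory (f A) (f B) (f C)"
proof -
  obtain x :: "int \<Rightarrow> collision" and \<delta> W where x: "\<And>n. admissible (x n)" "\<And>n. flight (x n) (x (n + 1))" and \<delta>: "\<delta> > 0"
    "\<And>n. \<exists>m\<in>{n<..n + W}. \<delta> \<le> dist (position (x (m - 1))) (position (x m)) + dist (position (x m)) (position (x (m + 1)))"
    and inf: "infinite (range (position \<circ> x))"
    using exists_collision_sequence[OF \<rho>_irrational[OF irr]] by blast
  note sim = similarity_diff[OF g r f] similarity_dist[OF g r f] similarity_eq_iff[OF g r f]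
  define y where "y = (\<lambda>n. similarity_collision f g (x n))"
  have pos: "position (y n) = f (position (x n))" for n
    unfolding y_def by (rule similarity_position[OF g r f])
  show ?thesis
  proof (rule billiard_of_collisions[OF nc, of y "r * \<delta>" W "r * ((1 - h) * sin \<alpha>)"])
    show "collision_at (f A) (f B) (f C) (y n)" for n
      unfolding y_def using x(1)[of n] by (intro similarity_collision_at[OF g r f]) (simp add: admissible_def)
    show "flight (y n) (y (n + 1))" for n
      unfolding y_def using x(2) by (intro similarity_flight[OF g r f])
    show "0 < r * \<delta>" using r \<delta> by simp
    show "0 < r * ((1 - h) * sin \<alpha>)" using r h_props trig_signs by simp
    show "\<exists>m\<in>{n<..n + W}. r * \<delta> \<le> dist (position (y (m - 1))) (position (y m)) + dist (position (y m)) (position (y (m + 1)))" for n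
      unfolding pos sim using \<delta>(2)[of n] r by (simp flip: distrib_left)
    have "range (position \<circ> y) = f ` range (position \<circ> x)" by (auto simp: pos image_image)
    moreover have "inj f" using sim(3) by (simp add: inj_def)
    ultimately show "infinite (range (position \<circ> y))"
      using inf finite_imageD[of f "range (position \<circ> x)"] by (metis inj_on_subset subset_UNIV)
    fix n z assume "z \<in> closed_segment (position (y n)) (position (y (n + 1)))"
    then obtain u where u: "0 \<le> u" "u \<le> 1" "z = (1 - u) *\<^sub>R f (position (x n)) + u *\<^sub>R f (position (x (n + 1)))"
      by (auto simp: in_segment pos)
    define w where "w = (1 - u) *\<^sub>R position (x n) + u *\<^sub>R position (x (n + 1))"
    have z: "z = f w" unfolding u w_def similarity_convex_combination[OF g r f] ..
    have "Im w = (1 - u) * Im (position (x n)) + u * Im (position (x (n + 1)))" by (simp add: w_def)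
    also have "\<dots> \<le> (1 - u) * (h * sin \<alpha>) + u * (h * sin \<alpha>)"
      using x(1)[of n] x(1)[of "n + 1"] u by (intro add_mono mult_left_mono) (auto simp: admissible_def)
    also have "\<dots> = h * sin \<alpha>" by (simp add: algebra_simps)
    finally have "(1 - h) * sin \<alpha> \<le> Im (C - w)" by (simp add: C_def algebra_simps)
    also have "\<dots> \<le> dist C w" unfolding dist_norm using abs_Im_le_cmod[of "C - w"] by simp
    finally show "r * ((1 - h) * sin \<alpha>) \<le> dist (f C) z"
      unfolding z sim using r by (intro mult_left_mono) auto
  qed
qed

end

section \<open>The threshold angle\<close>

lemma threshold_cubic:
  fixes x :: real
  shows "sin (7 * x) - sin (3 * x) + sin x = sin x * (8 * cos (2 * x) ^ 3 + 4 * (cos (2 * x))\<^sup>2 - 6 * cos (2 * x) - 1)"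
proof -
  have "sin (7 * x) - sin (3 * x) = 2 * sin (2 * x) * cos (5 * x)"
    using sin_diff_sin[of "7 * x" "3 * x"] by (simp add: algebra_simps)
  also have "\<dots> = sin x * (2 * (2 * cos (5 * x) * cos x))" by (simp add: sin_double)
  also have "2 * cos (5 * x) * cos x = cos (6 * x) + cos (4 * x)"
    using cos_plus_cos[of "6 * x" "4 * x"] by (simp add: algebra_simps)
  also have "cos (6 * x) = 4 * cos (2 * x) ^ 3 - 3 * cos (2 * x)"
    using cos_treble_cos[of "2 * x"] by simp
  also have "cos (4 * x) = 2 * (cos (2 * x))\<^sup>2 - 1"
    using cos_double_cos[of "2 * x"] by simp
  finally show ?thesis by (simp add: algebra_simps)
qed

text \<open>The divided difference is negative: 8 (a^2 + a b + b^2) is at most 6 because all three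
  terms are at most 1/4, and 4 (a + b) < 0 makes it strict.\<close>

lemma cubic_strict_antimono:
  fixes a b :: real
  assumes "-1/2 \<le> a" "a < b" "b \<le> 0"
  shows "8 * b ^ 3 + 4 * b\<^sup>2 - 6 * b - 1 < 8 * a ^ 3 + 4 * a\<^sup>2 - 6 * a - 1"
proof -
  have "a\<^sup>2 \<le> (1/2)\<^sup>2" "b\<^sup>2 \<le> (1/2)\<^sup>2" using assms by (intro abs_le_square_iff[THEN iffD1]; simp)+
  moreover have "a * b \<le> (a\<^sup>2 + b\<^sup>2) / 2" using sum_squares_bound[of a b] by simp
  ultimately have "8 * (a\<^sup>2 + a * b + b\<^sup>2) + 4 * (a + b) - 6 < 0" using assms by (simp add: power2_eq_square)
  then have "(b - a) * (8 * (a\<^sup>2 + a * b + b\<^sup>2) + 4 * (a + b) - 6) < 0" using assms by (intro mult_pos_neg) auto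
  then show ?thesis by (simp add: algebra_simps power2_eq_square power3_eq_cube)
qed

text \<open>The defining equation of \<open>alpha_star\<close> divided by \<open>sin x\<close>.\<close>

definition threshold :: "real \<Rightarrow> real" where
  "threshold x = 8 * cos (2 * x) ^ 3 + 4 * (cos (2 * x))\<^sup>2 - 6 * cos (2 * x) - 1"

lemma threshold_mono:
  assumes "pi / 4 \<le> x" "x < y" "y \<le> 3 * pi / 10"
  shows "threshold x < threshold y"
proof -
  have pi: "pi > 0" by simp
  have "cos (2 * y) < cos (2 * x)" using assms pi by (intro cos_monotone_0_pi) linarith+
  moreover have "cos (2 * x) \<le> cos (pi / 2)" using assms pi by (intro cos_monotone_0_pi_le) linarith+
  \<comment> \<open>Since 2 y is at most 3 pi / 5 < 2 pi / 3, the cosine stays in the range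
    [-1/2, 0] of \<open>cubic_strict_antimono\<close>.\<close>
  moreover have "cos (2 * pi / 3) \<le> cos (2 * y)" using assms pi by (intro cos_monotone_0_pi_le) linarith+
  ultimately show ?thesis unfolding threshold_def
    by (intro cubic_strict_antimono) (simp_all add: cos_120)
qed

lemma is_alpha_star_iff: "is_alpha_star x \<longleftrightarrow> x \<in> {pi / 4<..<3 * pi / 10} \<and> threshold x = 0"
proof -
  have "sin x > 0" if "x \<in> {pi / 4<..<3 * pi / 10}"
    using that pi_gt_zero by (intro sin_gt_zero) (simp; linarith)+
  then show ?thesis unfolding is_alpha_star_def threshold_cubic threshold_def by auto
qed

lemma ex1_alpha_star: "\<exists>!x. is_alpha_star x"
proof -
  have t: "threshold (pi / 4) = -1" "threshold (3 * pi / 10) = 1"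
  proof -
    show "threshold (pi / 4) = -1" by (simp add: threshold_def)
    \<comment> \<open>At this end point 5 x is 3 pi / 2, so the first two sines cancel and the
      original expression is sin x; division by sin x gives 1.\<close>
    have "sin (3 * pi / 10) > 0" by (intro sin_gt_zero) auto
    moreover have "sin (7 * (3 * pi / 10)) - sin (3 * (3 * pi / 10)) = 2 * sin (2 * (3 * pi / 10)) * cos (5 * (3 * pi / 10))"
      using sin_diff_sin[of "7 * (3 * pi / 10)" "3 * (3 * pi / 10)"] by (simp add: algebra_simps)
    moreover have "cos (5 * (3 * pi / 10)) = 0"
      using cos_3over2_pi by (simp add: field_simps)
    ultimately show "threshold (3 * pi / 10) = 1"
      using threshold_cubic[of "3 * pi / 10"] unfolding threshold_def by simp
  qed
  have "continuous_on {pi / 4..3 * pi / 10} threshold" unfolding threshold_def by (intro continuous_intros)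
  then obtain x where x: "pi / 4 \<le> x" "x \<le> 3 * pi / 10" "threshold x = 0"
    using IVT'[of threshold "pi / 4" 0 "3 * pi / 10"] t by auto
  have ne: "x \<noteq> pi / 4" "x \<noteq> 3 * pi / 10"
  proof -
    show "x \<noteq> pi / 4"
    proof
      assume "x = pi / 4"
      then have "threshold x = - 1" by (simp only: t)
      then show False using x(3) by simp
    qed
    show "x \<noteq> 3 * pi / 10"
    proof
      assume "x = 3 * pi / 10"
      then have "threshold x = 1" by (simp only: t)
      then show False using x(3) by simp
    qed
  qed
  have "is_alpha_star x" unfolding is_alpha_star_iff using x ne by (simp add: less_le)
  moreover have "y = z" if "is_alpha_star y" "is_alpha_star z" for y z
    using that threshold_mono[of y z] threshold_mono[of z y] by (cases y z rule: linorder_cases) (auto simp: is_alpha_star_iff)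
  ultimately show ?thesis by blast
qed

lemma above_alpha_star:
  assumes "\<alpha> \<in> {alpha_star<..<3 * pi / 10}"
  shows "pi / 4 < \<alpha>" "sin (7 * \<alpha>) - sin (3 * \<alpha>) + sin \<alpha> > 0"
proof -
  have "is_alpha_star alpha_star" unfolding alpha_star_def using ex1_alpha_star by (rule theI')
  then have a: "pi / 4 < alpha_star" "threshold alpha_star = 0" by (auto simp: is_alpha_star_iff)
  then show 1: "pi / 4 < \<alpha>" using assms by auto
  have "threshold \<alpha> > 0" using threshold_mono[of alpha_star \<alpha>] a assms by auto
  moreover have "sin \<alpha> > 0" using 1 assms pi_gt_zero by (intro sin_gt_zero) (simp; linarith)+
  ultimately show "sin (7 * \<alpha>) - sin (3 * \<alpha>) + sin \<alpha> > 0"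
    unfolding threshold_cubic threshold_def by simp
qed

text \<open>With the base placed from 0 to 1, the base angles say that Re u = cos alpha |u| and Re
  (1 - u) = cos alpha |1 - u|. Squaring forces the real parts of u and 1 - u to agree, and leaves
  the sign of \<open>y\<close>, the orientation, open.\<close>

lemma apex_from_base_angles:
  fixes A B C :: complex
  assumes tri: "triangle_with_angles A B C \<alpha> \<alpha> \<beta>" and \<alpha>: "0 < \<alpha>" "\<alpha> < pi / 2"
  shows "\<exists>y. \<bar>y\<bar> = sin \<alpha> / (2 * cos \<alpha>) \<and> (C - A) / (B - A) = Complex (1 / 2) y"
proof -
  have c: "cos \<alpha> > 0" "sin \<alpha> > 0" using \<alpha> by (auto intro: cos_gt_zero sin_gt_zero)
  have nc: "\<not> collinear {A, B, C}" and an: "inner_angle C A B = \<alpha>" "inner_angle A B C = \<alpha>"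
    using tri by (auto simp: triangle_with_angles_def)
  have ne: "A \<noteq> B" "B \<noteq> C" "A \<noteq> C" using nc by (auto simp: insert_commute)
  have key: "Re ((R - Q) / (P - Q)) = cos \<alpha> * norm ((R - Q) / (P - Q))"
    if "inner_angle P Q R = \<alpha>" "P \<noteq> Q" "R \<noteq> Q" for P Q R
  proof -
    have "\<bar>((P - Q) \<bullet> (R - Q)) / (norm (P - Q) * norm (R - Q))\<bar> \<le> 1"
      using Cauchy_Schwarz_ineq2[of "P - Q" "R - Q"] that by (simp add: abs_divide field_simps abs_mult)
    then have "cos \<alpha> = ((P - Q) \<bullet> (R - Q)) / (norm (P - Q) * norm (R - Q))"
      using that(1) unfolding inner_angle_def by (metis cos_arccos_abs)
    then have "(P - Q) \<bullet> (R - Q) = cos \<alpha> * (norm (P - Q) * norm (R - Q))" using that by simp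
    moreover have "Re ((R - Q) / (P - Q)) = ((P - Q) \<bullet> (R - Q)) / (norm (P - Q))\<^sup>2"
      by (simp add: complex_div_cnj[of "R - Q"] inner_complex_def cmod_power2 algebra_simps add_divide_distrib)
    ultimately show ?thesis using that by (simp add: norm_divide power2_eq_square)
  qed
  define u where "u = (C - A) / (B - A)"
  have u1: "(C - B) / (A - B) = 1 - u" using ne by (simp add: u_def field_simps)
  have inner_sym: "inner_angle B A C = \<alpha>" using an(1) by (simp add: inner_angle_def inner_commute mult.commute)
  have e: "Re u = cos \<alpha> * norm u" "1 - Re u = cos \<alpha> * norm (1 - u)"
    using key[OF inner_sym] key[OF an(2)] ne unfolding u1 u_def[symmetric] by auto
  obtain x y where xy: "u = Complex x y" by (cases u)
  have "0 \<le> cos \<alpha> * norm u" "0 \<le> cos \<alpha> * norm (1 - u)" using c by simp_all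
  then have "0 \<le> Re u" "Re u \<le> 1" using e by linarith+
  then have x: "0 \<le> x" "x \<le> 1" by (simp_all add: xy)
  have s2: "1 - (cos \<alpha>)\<^sup>2 = (sin \<alpha>)\<^sup>2" by (simp add: sin_squared_eq)
  have "x\<^sup>2 = (cos \<alpha>)\<^sup>2 * (x\<^sup>2 + y\<^sup>2)" "(1 - x)\<^sup>2 = (cos \<alpha>)\<^sup>2 * ((1 - x)\<^sup>2 + y\<^sup>2)"
    using arg_cong[OF e(1), of "\<lambda>t. t\<^sup>2"] arg_cong[OF e(2), of "\<lambda>t. t\<^sup>2"]
    unfolding xy power_mult_distrib cmod_power2 by simp_all
  then have "(1 - (cos \<alpha>)\<^sup>2) * x\<^sup>2 = (cos \<alpha>)\<^sup>2 * y\<^sup>2" "(1 - (cos \<alpha>)\<^sup>2) * (1 - x)\<^sup>2 = (cos \<alpha>)\<^sup>2 * y\<^sup>2"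
    by (simp_all add: algebra_simps)
  then have sq: "(sin \<alpha> * x)\<^sup>2 = (cos \<alpha> * y)\<^sup>2" "(sin \<alpha> * (1 - x))\<^sup>2 = (cos \<alpha> * y)\<^sup>2"
    unfolding s2 power_mult_distrib by simp_all
  have "sin \<alpha> * x = sin \<alpha> * (1 - x)"
  proof (rule power2_eq_imp_eq)
    show "(sin \<alpha> * x)\<^sup>2 = (sin \<alpha> * (1 - x))\<^sup>2" unfolding sq ..
  qed (use x c in simp_all)
  then have half: "x = 1 / 2" using c by simp
  have "\<bar>sin \<alpha> * x\<bar> = \<bar>cos \<alpha> * y\<bar>" using sq(1) by (simp add: power2_eq_iff abs_eq_iff)
  then have "\<bar>y\<bar> = sin \<alpha> / (2 * cos \<alpha>)" using c half by (simp add: abs_mult field_simps)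
  then show ?thesis using xy half unfolding u_def by blast
qed

lemma isosceles_trajectory:
  assumes \<alpha>: "\<alpha> \<in> {alpha_star<..<3 * pi / 10}" and irr: "cos (5 * \<alpha>) / cos (3 * \<alpha>) \<notin> \<rat>"
    and tri: "triangle_with_angles P Q R \<alpha> \<alpha> \<beta>"
  shows "has_nonperiodic_nondense_trajectory P Q R"
proof -
  interpret isosceles_billiard \<alpha>
    using above_alpha_star[OF \<alpha>] \<alpha> by unfold_locales auto
  have nc: "\<not> collinear {P, Q, R}" using tri by (simp add: triangle_with_angles_def)
  then have ne: "P \<noteq> Q" by auto
  have "0 < \<alpha>" "\<alpha> < pi / 2" using \<alpha>_gt \<alpha>_lt pi_gt_zero by linarith+
  then obtain y where y: "\<bar>y\<bar> = sin \<alpha> / (2 * cos \<alpha>)" "(R - P) / (Q - P) = Complex (1 / 2) y"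
    using apex_from_base_angles[OF tri] by blast
  have R: "R = P + (Q - P) * Complex (1 / 2) y" using y(2) ne by (simp add: field_simps)
  define w where "w = sgn (Q - P)"
  define r where "r = norm (Q - P) / (2 * cos \<alpha>)"
  have w: "norm w = 1" using ne by (simp add: w_def norm_sgn)
  have r: "r > 0" using ne trig_signs by (simp add: r_def)
  have rw: "r *\<^sub>R (w * z) = (Q - P) * z / of_real (2 * cos \<alpha>)" for z
    using ne by (simp add: r_def w_def sgn_div_norm scaleR_conv_of_real)
  have rot: "orthogonal_transformation (\<lambda>z. w * z)"
    unfolding orthogonal_transformation using w by (auto simp: norm_mult intro!: linearI simp: algebra_simps)
  have refl: "orthogonal_transformation (\<lambda>z. w * cnj z)"
    unfolding orthogonal_transformation using w by (auto simp: norm_mult intro!: linearI simp: algebra_simps)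
  have c: "complex_of_real (cos \<alpha>) \<noteq> 0" using trig_signs by simp
  have ends: "(P + Q) / 2 + r *\<^sub>R (w * A) = P" "(P + Q) / 2 + r *\<^sub>R (w * B) = Q"
    unfolding rw using c by (simp_all add: A_def B_def field_simps)
  have cnj: "cnj A = A" "cnj B = B" "cnj C = - C" by (simp_all add: A_def B_def C_def)
  have apex: "(P + Q) / 2 + r *\<^sub>R (w * (of_real t * C)) = P + (Q - P) * Complex (1 / 2) (t * (sin \<alpha> / (2 * cos \<alpha>)))" for t
  proof -
    have "Complex (1 / 2) (t * (sin \<alpha> / (2 * cos \<alpha>))) = 1 / 2 + of_real t * C / of_real (2 * cos \<alpha>)"
      using trig_signs by (simp add: C_def complex_eq_iff)
    then show ?thesis unfolding rw by (simp add: algebra_simps add_divide_distrib diff_divide_distrib)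
  qed
  \<comment> \<open>The two orientations: the second is reached by a similarity that includes
    complex conjugation, which fixes the base vertices and sends the apex to its negative.\<close>
  consider "y = sin \<alpha> / (2 * cos \<alpha>)" | "y = - (sin \<alpha> / (2 * cos \<alpha>))" using y(1) by linarith
  then show ?thesis
  proof cases
    case 1
    have apex': "(P + Q) / 2 + r *\<^sub>R (w * C) = R" using apex[of 1] by (simp add: R 1)
    show ?thesis
      using similar_triangle[OF irr rot r, of "\<lambda>z. (P + Q) / 2 + r *\<^sub>R (w * z)" "(P + Q) / 2"] nc
      unfolding ends apex' by blast
  next
    case 2
    have apex': "(P + Q) / 2 + r *\<^sub>R (w * - C) = R" using apex[of "-1"] by (simp add: R 2)
    show ?thesis
      using similar_triangle[OF irr refl r, of "\<lambda>z. (P + Q) / 2 + r *\<^sub>R (w * cnj z)" "(P + Q) / 2"] nc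
      unfolding cnj ends apex' by blast
  qed
qed

theorem corollary2:
  shows "(\<exists>!x. is_alpha_star x) \<and>
    (\<forall>\<alpha> \<in> {alpha_star<..<3 * pi / 10}.
       cos (5 * \<alpha>) / cos (3 * \<alpha>) \<notin> \<rat> \<longrightarrow>
       (\<forall>A B C. triangle_with_angles A B C \<alpha> \<alpha> (pi - 2 * \<alpha>) \<longrightarrow>
          has_nonperiodic_nondense_trajectory A B C)) \<and>
    (\<forall>\<alpha> \<in> {alpha_star<..<3 * pi / 10}.
       algebraic (\<alpha> / pi) \<and> \<alpha> / pi \<notin> \<rat> \<longrightarrow>
       cos (5 * \<alpha>) / cos (3 * \<alpha>) \<notin> \<rat> \<and>
       (\<forall>A B C. triangle_with_angles A B C \<alpha> \<alpha> (pi - 2 * \<alpha>) \<longrightarrow>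
          has_nonperiodic_nondense_trajectory A B C))"
proof (intro conjI ballI impI allI)
  show "\<exists>!x. is_alpha_star x" by (rule ex1_alpha_star)
next
  fix \<alpha> A B C
  assume "\<alpha> \<in> {alpha_star<..<3 * pi / 10}" "cos (5 * \<alpha>) / cos (3 * \<alpha>) \<notin> \<rat>"
    "triangle_with_angles A B C \<alpha> \<alpha> (pi - 2 * \<alpha>)"
  then show "has_nonperiodic_nondense_trajectory A B C" by (rule isosceles_trajectory)
next
  fix \<alpha>
  assume \<alpha>: "\<alpha> \<in> {alpha_star<..<3 * pi / 10}" and alg: "algebraic (\<alpha> / pi) \<and> \<alpha> / pi \<notin> \<rat>"
  have bounds: "pi / 4 < \<alpha>" "\<alpha> < 3 * pi / 10" using above_alpha_star[OF \<alpha>] \<alpha> by auto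
  have "cos (3 * \<alpha> - pi) > 0" using bounds pi_gt_zero by (intro cos_gt_zero_pi) linarith+
  then have "cos (3 * \<alpha>) \<noteq> 0" by (simp add: cos_diff)
  moreover have "0 < \<alpha>" "\<alpha> < pi" using bounds pi_gt_zero by linarith+
  ultimately show irr: "cos (5 * \<alpha>) / cos (3 * \<alpha>) \<notin> \<rat>"
    using alg by (intro cos_ratio_irrational) auto
  show "has_nonperiodic_nondense_trajectory A B C"
    if "triangle_with_angles A B C \<alpha> \<alpha> (pi - 2 * \<alpha>)" for A B C
    using isosceles_trajectory[OF \<alpha> irr that] .
qed

end
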